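(* If $\Omega\subset\mathbb{C}^m$ is a wHHR domain, then $\Omega$ is taut and pseudoconvex.
   Context: $\mathbb{B}^m\subset\mathbb{C}^m$ is the open unit ball, $\mathbb{D}\subset\mathbb{C}$ is the open unit disk, $g_{\mathrm{Euc}}$ is the Euclidean metric on $\mathbb{C}^m$. Levi form: for a $\mathcal{C}^2$ real-valued function $f$ on a complex $m$-manifold, $\mathscr{L}(f)=\sum_{1\le j,k\le m}\frac{\partial^2 f}{\partial z^j\partial\bar z^k}\,dz^j\otimes d\bar z^k$ in local holomorphic coordinates. For $f$ on $\mathbb{B}^m$, the inequality $\mathscr{L}(f)\ge c\, g_{\mathrm{Euc}}$ means $\sum_{j,k}\frac{\partial^2 f}{\partial z^j\partial\bar z^k}(w)\,x_j\bar x_k\ge c\sum_j|x_j|^2$ for all $w\in\mathbb{B}^m$ and $x\in\mathbb{C}^m$. wHHR domain: a domain $\Omega\subset\mathbb{C}^m$ is a weakly holomorphic homogeneous regular (wHHR) domain if there exists $s>0$ such that for every $\zeta\in\Omega$ there exist a holomorphic embedding $\Phi:\mathbb{B}^m\to\Omega$ and a $\mathcal{C}^2$ plurisubharmonic function $\phi:\Omega\to[0,1]$ with $\Phi(0)=\zeta$ and $\mathscr{L}(\phi\circ\Phi)\ge s^2 g_{\mathrm{Euc}}$ on $\mathbb{B}^m$. Taut: $\Omega$ is taut if every sequence of holomorphic maps $\mathbb{D}\to\Omega$ has a subsequence which either converges locally uniformly to a holomorphic map $\mathbb{D}\to\Omega$ or is compactly divergent. *)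

theory Defs
  imports "HOL-Analysis.Analysis"
begin

text \<open>
  \<open>\<complex>\<^sup>m\<close> is rendered as \<^typ>\<open>complex ^ 'm\<close> with \<open>m = CARD('m)\<close>; its norm is the
  Euclidean one.
\<close>

definition is_domain :: "'a::topological_space set \<Rightarrow> bool" where
  "is_domain S \<longleftrightarrow> open S \<and> connected S \<and> S \<noteq> {}"


subsection \<open>Regularity and the Levi form\<close>

text \<open>
  All derivatives below are total real derivatives; \<^term>\<open>frechet_derivative f (at x) v\<close> is the
  derivative of \<^term>\<open>f\<close> at \<^term>\<open>x\<close> in direction \<^term>\<open>v\<close>. The notions are meant for open sets.
\<close>

definition C1_on :: "'a::euclidean_space set \<Rightarrow> ('a \<Rightarrow> real) \<Rightarrow> bool" where
  "C1_on S f \<longleftrightarrow>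
     (\<forall>x\<in>S. f differentiable (at x)) \<and>
     (\<forall>v. continuous_on S (\<lambda>x. frechet_derivative f (at x) v))"

definition C2_on :: "'a::euclidean_space set \<Rightarrow> ('a \<Rightarrow> real) \<Rightarrow> bool" where
  "C2_on S f \<longleftrightarrow>
     C1_on S f \<and> (\<forall>v. C1_on S (\<lambda>x. frechet_derivative f (at x) v))"

text \<open>The Wirtinger operators with respect to \<open>z\<^sup>j\<close> and to the conjugate of \<open>z\<^sup>k\<close>.\<close>

definition wirtinger :: "'m::finite \<Rightarrow> (complex ^ 'm \<Rightarrow> complex) \<Rightarrow> complex ^ 'm \<Rightarrow> complex" where
  "wirtinger j f w =
     (frechet_derivative f (at w) (axis j 1) - \<i> * frechet_derivative f (at w) (axis j \<i>)) / 2"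

definition wirtinger_bar :: "'m::finite \<Rightarrow> (complex ^ 'm \<Rightarrow> complex) \<Rightarrow> complex ^ 'm \<Rightarrow> complex" where
  "wirtinger_bar k f w =
     (frechet_derivative f (at w) (axis k 1) + \<i> * frechet_derivative f (at w) (axis k \<i>)) / 2"

text \<open>
  The value on \<^term>\<open>x\<close> of the Levi form at \<^term>\<open>w\<close>. For a function of class \<open>C\<^sup>2\<close> the form is
  Hermitian, so the sum is real and \<^const>\<open>Re\<close> only changes its type.
\<close>

definition levi_form :: "(complex ^ 'm::finite \<Rightarrow> real) \<Rightarrow> complex ^ 'm \<Rightarrow> complex ^ 'm \<Rightarrow> real" where
  "levi_form f w x =
     Re (\<Sum>j\<in>UNIV. \<Sum>k\<in>UNIV.
           wirtinger j (wirtinger_bar k (\<lambda>z. complex_of_real (f z))) w * x $ j * cnj (x $ k))"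


subsection \<open>Plurisubharmonic functions\<close>

definition usc_on :: "'a::topological_space set \<Rightarrow> ('a \<Rightarrow> real) \<Rightarrow> bool" where
  "usc_on S u \<longleftrightarrow> (\<forall>c. openin (top_of_set S) {z \<in> S. u z < c})"

text \<open>
  Only functions that do not take the value \<open>-\<infinity>\<close> are needed. For these the sub-mean value
  inequality forces the circle integrals, which are bounded above by upper semicontinuity, to be
  finite; this is the integrability condition.
\<close>

definition subharmonic_on :: "complex set \<Rightarrow> (complex \<Rightarrow> real) \<Rightarrow> bool" where
  "subharmonic_on S u \<longleftrightarrow>
     usc_on S u \<and>
     (\<forall>a r. 0 < r \<longrightarrow> cball a r \<subseteq> S \<longrightarrow>
        (\<lambda>t. u (a + of_real r * cis t)) integrable_on {0..2*pi} \<and>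
        u a \<le> 1 / (2*pi) * integral {0..2*pi} (\<lambda>t. u (a + of_real r * cis t)))"

definition plurisubharmonic_on :: "(complex ^ 'm::finite) set \<Rightarrow> (complex ^ 'm \<Rightarrow> real) \<Rightarrow> bool" where
  "plurisubharmonic_on \<Omega> u \<longleftrightarrow>
     usc_on \<Omega> u \<and>
     (\<forall>a b. subharmonic_on {l. a + l *s b \<in> \<Omega>} (\<lambda>l. u (a + l *s b)))"

text \<open>Existence of a continuous plurisubharmonic exhaustion function.\<close>

definition pseudoconvex :: "(complex ^ 'm::finite) set \<Rightarrow> bool" where
  "pseudoconvex \<Omega> \<longleftrightarrow>
     open \<Omega> \<and>
     (\<exists>u. continuous_on \<Omega> u \<and> plurisubharmonic_on \<Omega> u \<and>
        (\<forall>c. compact (closure {z \<in> \<Omega>. u z < c}) \<and> closure {z \<in> \<Omega>. u z < c} \<subseteq> \<Omega>))"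


subsection \<open>Holomorphic embeddings and wHHR domains\<close>

text \<open>
  Complex differentiability: the real derivative is given by a complex (Jacobian) matrix.
\<close>

definition holomorphic_map_on :: "(complex ^ 'n::finite) set \<Rightarrow> (complex ^ 'n \<Rightarrow> complex ^ 'm::finite) \<Rightarrow> bool" where
  "holomorphic_map_on S F \<longleftrightarrow>
     (\<forall>w\<in>S. \<exists>A :: complex ^ 'n ^ 'm. (F has_derivative (\<lambda>v. A *v v)) (at w))"

text \<open>An injective holomorphic immersion that is a homeomorphism onto its image.\<close>

definition holomorphic_embedding_on :: "(complex ^ 'n::finite) set \<Rightarrow> (complex ^ 'n \<Rightarrow> complex ^ 'm::finite) \<Rightarrow> bool" where
  "holomorphic_embedding_on S F \<longleftrightarrow>
     holomorphic_map_on S F \<and>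
     (\<forall>w\<in>S. inj (frechet_derivative F (at w))) \<and>
     (\<exists>G. homeomorphism S (F ` S) F G)"

definition wHHR_domain :: "(complex ^ 'm::finite) set \<Rightarrow> bool" where
  "wHHR_domain \<Omega> \<longleftrightarrow>
     is_domain \<Omega> \<and>
     (\<exists>s>0. \<forall>\<zeta>\<in>\<Omega>. \<exists>(\<Phi> :: complex ^ 'm \<Rightarrow> complex ^ 'm) (\<phi> :: complex ^ 'm \<Rightarrow> real).
        holomorphic_embedding_on (ball 0 1) \<Phi> \<and> \<Phi> ` ball 0 1 \<subseteq> \<Omega> \<and>
        C2_on \<Omega> \<phi> \<and> plurisubharmonic_on \<Omega> \<phi> \<and> \<phi> ` \<Omega> \<subseteq> {0..1} \<and>
        \<Phi> 0 = \<zeta> \<and>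
        (\<forall>w\<in>ball 0 1. \<forall>x. levi_form (\<phi> \<circ> \<Phi>) w x \<ge> s\<^sup>2 * (\<Sum>j\<in>UNIV. (cmod (x $ j))\<^sup>2)))"


subsection \<open>Taut domains\<close>

definition holomorphic_disc :: "(complex ^ 'm::finite) set \<Rightarrow> (complex \<Rightarrow> complex ^ 'm) \<Rightarrow> bool" where
  "holomorphic_disc \<Omega> f \<longleftrightarrow>
     (\<forall>j. (\<lambda>z. f z $ j) holomorphic_on ball 0 1) \<and> f ` ball 0 1 \<subseteq> \<Omega>"

definition disc_locally_uniform_limit :: "(nat \<Rightarrow> complex \<Rightarrow> complex ^ 'm::finite) \<Rightarrow> (complex \<Rightarrow> complex ^ 'm) \<Rightarrow> bool" where
  "disc_locally_uniform_limit f g \<longleftrightarrow>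
     (\<forall>K. compact K \<and> K \<subseteq> ball 0 1 \<longrightarrow> uniform_limit K f g sequentially)"

definition disc_compactly_divergent :: "(complex ^ 'm::finite) set \<Rightarrow> (nat \<Rightarrow> complex \<Rightarrow> complex ^ 'm) \<Rightarrow> bool" where
  "disc_compactly_divergent \<Omega> f \<longleftrightarrow>
     (\<forall>K L. compact K \<and> K \<subseteq> ball 0 1 \<and> compact L \<and> L \<subseteq> \<Omega> \<longrightarrow>
        (\<forall>\<^sub>F n in sequentially. f n ` K \<inter> L = {}))"

definition taut :: "(complex ^ 'm::finite) set \<Rightarrow> bool" where
  "taut \<Omega> \<longleftrightarrow>
     (\<forall>f :: nat \<Rightarrow> complex \<Rightarrow> complex ^ 'm. (\<forall>n. holomorphic_disc \<Omega> (f n)) \<longrightarrow>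
        (\<exists>r :: nat \<Rightarrow> nat. strict_mono r \<and>
           ((\<exists>g. holomorphic_disc \<Omega> g \<and> disc_locally_uniform_limit (f \<circ> r) g) \<or>
            disc_compactly_divergent \<Omega> (f \<circ> r))))"

end

theory Submission
  imports Defs "HOL-Complex_Analysis.Complex_Analysis"
begin

text \<open>
  Everything rests on one estimate in the spirit of Sibony: a holomorphic disc \<open>f\<close> whose centre lies
  well inside a chart \<open>\<Phi>\<close> maps a disc of radius depending only on \<open>s\<close> into \<open>\<Phi> (ball w\<^sub>0 (1/4))\<close>, where
  \<open>f 0 = \<Phi> w\<^sub>0\<close>. Since \<open>A \<phi> - A s\<^sup>2 |\<Phi>\<^sup>-\<^sup>1 - w\<^sub>0|\<^sup>2\<close> is plurisubharmonic on the chart, the function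
  \<open>log |\<Phi>\<^sup>-\<^sup>1 - w\<^sub>0|\<^sup>2 + A \<phi> - A s\<^sup>2 |\<Phi>\<^sup>-\<^sup>1 - w\<^sub>0|\<^sup>2 + const\<close> can be glued by a maximum to \<open>A \<phi>\<close>, which gives
  a function on \<open>\<Omega>\<close> that is bounded above and has a logarithmic pole at \<open>f 0\<close>; along \<open>f\<close> the maximum
  principle compares it with \<open>log |z|\<close>.

  Chaining the estimate shows that for compact \<open>L \<subseteq> \<Omega>\<close> and \<open>\<rho> < 1\<close> all discs that meet \<open>L\<close> on
  \<open>|z| \<le> \<rho>\<close> send \<open>|z| \<le> \<rho>\<close> into one compact subset of \<open>\<Omega>\<close>. With Montel's theorem this gives
  tautness. It also gives the continuity principle for families of discs, which by the classical
  argument of Hartogs makes \<open>- log dist (\<cdot>, \<partial>\<Omega>)\<close> plurisubharmonic; the maximum of this function and the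
  norm is then an exhaustion.
\<close>

no_notation fps_nth (infixl \<open>$\<close> 75)

section \<open>Second-order expansions\<close>

text \<open>What shapes the proof is that the comparison function is glued from two pieces and must
  be tested along a disc that may leave the chart. Instead of a calculus of subharmonic functions
  (composition with discs, maxima, gluing), the maximum principle is run by hand: a term
  \<epsilon>|z|^2 makes the function strictly subharmonic, so an interior maximum contradicts
  second-order information at that single point. Everything is exponentiated, so the pole is an
  ordinary zero and logarithms of moduli become holomorphic factors. Hence second-order expansions
  are the basic tool, and B(b,b) + B(ib,ib), four times the Levi form, is the quantity that counts.

  Holomorphy of a chart is merely complex differentiability; Cauchy's formula has to supply the
  second derivatives of \<open>\<phi> \<circ> \<Phi>\<close>.

  The constant s is the same for all charts. This makes the radius in the estimate independent of
  the compact set at which a disc starts, so the chain from z to w has a number of links fixed in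
  advance, although each link enlarges the compact set.\<close>

definition second_order_at ::
  "('a::euclidean_space \<Rightarrow> real) \<Rightarrow> 'a \<Rightarrow> ('a \<Rightarrow> real) \<Rightarrow> ('a \<Rightarrow> 'a \<Rightarrow> real) \<Rightarrow> bool" where
  "second_order_at f y L B \<longleftrightarrow> linear L \<and> bilinear B \<and>
     (\<lambda>h. f (y + h) - f y - L h - B h h / 2) \<in> o[nhds 0](\<lambda>h. (norm h)\<^sup>2)"

text \<open>Only the scalar functions \<open>D x v\<close>, one \<open>v\<close> at a time, are
  known to be differentiable at \<open>y\<close>. Linearity in \<open>v\<close> and the finite basis
  make their expansions uniform in \<open>v\<close>; the mean value theorem turns the expansion of
  the derivative into one of \<open>f\<close>.\<close>

lemma second_order_at_C2:
  fixes f :: "'a::euclidean_space \<Rightarrow> real"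
  assumes "open S" "y \<in> S"
    and diff: "\<And>x. x \<in> S \<Longrightarrow> f differentiable (at x)"
    and diff2: "\<And>v. (\<lambda>x. frechet_derivative f (at x) v) differentiable (at y)"
  shows "second_order_at f y (frechet_derivative f (at y))
           (\<lambda>h v. frechet_derivative (\<lambda>x. frechet_derivative f (at x) v) (at y) h)"
proof -
  define D where "D x = frechet_derivative f (at x)" for x
  define B where "B h v = frechet_derivative (\<lambda>x. D x v) (at y) h" for h v
  have D: "(f has_derivative D x) (at x)" if "x \<in> S" for x
    using diff[OF that] by (simp add: D_def frechet_derivative_works)
  have linD: "linear (D x)" if "x \<in> S" for x
    using D[OF that] has_derivative_linear by blast
  have B: "((\<lambda>x. D x v) has_derivative (\<lambda>h. B h v)) (at y)" for v
    using diff2[of v] unfolding B_def D_def by (simp add: frechet_derivative_works)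
  obtain e where e: "e > 0" "ball y e \<subseteq> S"
    using assms(1,2) openE by blast
  have linB1: "linear (\<lambda>h. B h v)" for v
    using B has_derivative_linear by blast
  have Badd: "B h (v + w) = B h v + B h w" for h v w
  proof -
    have "((\<lambda>x. D x v + D x w) has_derivative (\<lambda>h. B h v + B h w)) (at y)"
      by (intro has_derivative_add B)
    then have "((\<lambda>x. D x (v + w)) has_derivative (\<lambda>h. B h v + B h w)) (at y)"
      by (rule has_derivative_transform_within_open[OF _ assms(1,2)]) (simp add: linD linear_add)
    from has_derivative_unique[OF B this] show ?thesis by metis
  qed
  have Bscale: "B h (c *\<^sub>R v) = c * B h v" for h v c
  proof -
    have "((\<lambda>x. c * D x v) has_derivative (\<lambda>h. c * B h v)) (at y)"
      by (intro has_derivative_mult_right B)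
    then have "((\<lambda>x. D x (c *\<^sub>R v)) has_derivative (\<lambda>h. c * B h v)) (at y)"
      by (rule has_derivative_transform_within_open[OF _ assms(1,2)]) (simp add: linD linear_cmul)
    from has_derivative_unique[OF B this] show ?thesis by metis
  qed
  have linB2: "linear (B h)" for h
    by (rule linearI) (simp_all add: Badd Bscale)
  have bil: "bilinear B"
    unfolding bilinear_def using linB1 linB2 by auto
  have "(\<lambda>h. f (y + h) - f y - D y h - B h h / 2) \<in> o[nhds 0](\<lambda>h. (norm h)\<^sup>2)"
  proof (rule landau_o.smallI)
    fix c :: real assume "c > 0"
    define n where "n = real DIM('a)"
    \<comment> \<open>The errors in the basis directions are summed, each against a coordinate of
      size at most \<open>norm v\<close>.\<close>
    define \<eta> where "\<eta> = c / n"
    have n: "n > 0" by (simp add: n_def)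
    have \<eta>: "\<eta> > 0" using \<open>c > 0\<close> n by (simp add: \<eta>_def)
    have "\<forall>i\<in>Basis. \<exists>d>0. \<forall>h. norm h < d \<longrightarrow> \<bar>D (y + h) i - D y i - B h i\<bar> \<le> \<eta> * norm h"
    proof
      fix i :: 'a
      from B[of i, unfolded has_derivative_at_alt] \<eta>
      obtain d where "d > 0" "\<And>x. norm (x - y) < d \<Longrightarrow> norm (D x i - D y i - B (x - y) i) \<le> \<eta> * norm (x - y)"
        by blast
      from this(2)[of "y + _"] this(1)
      show "\<exists>d>0. \<forall>h. norm h < d \<longrightarrow> \<bar>D (y + h) i - D y i - B h i\<bar> \<le> \<eta> * norm h"
        by auto
    qed
    then obtain d where d: "\<And>i. i \<in> Basis \<Longrightarrow> d i > 0"
        "\<And>i h. i \<in> Basis \<Longrightarrow> norm h < d i \<Longrightarrow> \<bar>D (y + h) i - D y i - B h i\<bar> \<le> \<eta> * norm h"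
      by metis
    define d0 where "d0 = min e (Min (d ` Basis))"
    have d0: "d0 > 0" "\<And>i. i \<in> Basis \<Longrightarrow> d0 \<le> d i" "d0 \<le> e"
      using d(1) e(1) unfolding d0_def by (auto simp: min_le_iff_disj)
    have est: "\<bar>D (y + h) v - D y v - B h v\<bar> \<le> c * norm h * norm v" if h: "norm h < d0" for h v
    proof -
      have yS: "y + h \<in> S" using h d0 e(2) by (auto simp: dist_norm)
      define G where "G v = D (y + h) v - D y v - B h v" for v
      have "linear G" unfolding G_def
        by (intro linear_compose_sub linD linB2 yS assms)
      then have "G (\<Sum>i\<in>Basis. (v \<bullet> i) *\<^sub>R i) = (\<Sum>i\<in>Basis. (v \<bullet> i) * G i)"
        by (simp add: linear_sum linear_cmul)
      then have "D (y + h) v - D y v - B h v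
          = (\<Sum>i\<in>Basis. (v \<bullet> i) * (D (y + h) i - D y i - B h i))"
        by (simp add: euclidean_representation G_def)
      also have "\<bar>\<dots>\<bar> \<le> (\<Sum>i\<in>(Basis::'a set). norm v * (\<eta> * norm h))"
        by (rule order_trans[OF sum_abs], rule sum_mono, unfold abs_mult, rule mult_mono)
           (use Basis_le_norm d(2) d0 h in \<open>force+\<close>)
      also have "\<dots> = c * norm h * norm v"
        using n by (simp add: \<eta>_def n_def)
      finally show ?thesis .
    qed
    have "\<forall>h. norm h < d0 \<longrightarrow> norm (f (y + h) - f y - D y h - B h h / 2) \<le> c * norm ((norm h)\<^sup>2)"
    proof (intro allI impI)
      fix h :: 'a assume h: "norm h < d0"
      \<comment> \<open>The linear and quadratic parts are subtracted along the segment, so that the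
        mean value theorem meets only the error of \<open>D\<close>.\<close>
      define \<psi> where "\<psi> t = f (y + t *\<^sub>R h) - t * D y h - t\<^sup>2 * B h h / 2" for t
      have *: "(\<psi> has_real_derivative (D (y + t *\<^sub>R h) h - D y h - t * B h h)) (at t)" if "0 \<le> t" "t \<le> 1" for t
      proof -
        have "norm (t *\<^sub>R h) \<le> norm h" using that by (simp add: mult_left_le_one_le)
        then have yS: "y + t *\<^sub>R h \<in> S" using h d0 e(2) by (auto simp: dist_norm)
        have "((\<lambda>t. y + t *\<^sub>R h) has_derivative (\<lambda>s. s *\<^sub>R h)) (at t)"
          by (auto intro!: derivative_eq_intros)
        from has_derivative_compose[OF this D[OF yS]]
        have "((\<lambda>t. f (y + t *\<^sub>R h)) has_derivative (\<lambda>s. D (y + t *\<^sub>R h) (s *\<^sub>R h))) (at t)" .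
        moreover have "(\<lambda>s. D (y + t *\<^sub>R h) (s *\<^sub>R h)) = (*) (D (y + t *\<^sub>R h) h)"
          using linear_cmul[OF linD[OF yS]] by auto
        ultimately have "((\<lambda>t. f (y + t *\<^sub>R h)) has_real_derivative D (y + t *\<^sub>R h) h) (at t)"
          by (simp add: has_field_derivative_def)
        then show ?thesis unfolding \<psi>_def
          by (auto intro!: derivative_eq_intros)
      qed
      obtain t where t: "0 < t" "t < 1" "\<psi> 1 - \<psi> 0 = D (y + t *\<^sub>R h) h - D y h - t * B h h"
        using MVT2[of 0 1 \<psi> "\<lambda>t. D (y + t *\<^sub>R h) h - D y h - t * B h h"] * by auto
      have nt: "norm (t *\<^sub>R h) \<le> norm h" using t by (simp add: mult_left_le_one_le)
      have "f (y + h) - f y - D y h - B h h / 2 = D (y + t *\<^sub>R h) h - D y h - B (t *\<^sub>R h) h"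
        using t(3) linear_cmul[OF linB1] by (simp add: \<psi>_def)
      also have "\<bar>\<dots>\<bar> \<le> c * norm (t *\<^sub>R h) * norm h"
        by (rule est) (use nt h in auto)
      also have "\<dots> \<le> c * norm h * norm h"
        using nt \<open>c > 0\<close> by (intro mult_right_mono mult_left_mono) auto
      finally show "norm (f (y + h) - f y - D y h - B h h / 2) \<le> c * norm ((norm h)\<^sup>2)"
        by (simp add: power2_eq_square)
    qed
    then show "\<forall>\<^sub>F h in nhds 0. norm (f (y + h) - f y - D y h - B h h / 2) \<le> c * norm ((norm h)\<^sup>2)"
      using d0(1) by (auto simp: eventually_nhds_metric dist_norm)
  qed
  then show ?thesis
    unfolding second_order_at_def using linD[OF assms(2)] bil[unfolded B_def[abs_def] D_def] by (simp add: B_def D_def)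
qed

lemma second_order_at_add:
  assumes "second_order_at f y L B" "second_order_at g y L' B'"
  shows "second_order_at (\<lambda>x. f x + g x) y (\<lambda>h. L h + L' h) (\<lambda>h k. B h k + B' h k)"
proof -
  have "(\<lambda>h. (f (y + h) - f y - L h - B h h / 2) + (g (y + h) - g y - L' h - B' h h / 2)) \<in> o[nhds 0](\<lambda>h. (norm h)\<^sup>2)"
    using assms unfolding second_order_at_def by (intro sum_in_smallo(1)) blast+
  moreover have "bilinear (\<lambda>h k. B h k + B' h k)"
    using assms unfolding second_order_at_def bilinear_def by (auto intro!: linear_compose_add)
  ultimately show ?thesis
    using assms unfolding second_order_at_def by (auto intro!: linear_compose_add simp: algebra_simps add_divide_distrib)
qed

lemma second_order_at_cmult:
  assumes "second_order_at f y L B"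
  shows "second_order_at (\<lambda>x. c * f x) y (\<lambda>h. c * L h) (\<lambda>h k. c * B h k)"
proof -
  have "(\<lambda>h. c * (f (y + h) - f y - L h - B h h / 2)) \<in> o[nhds 0](\<lambda>h. (norm h)\<^sup>2)"
    using assms unfolding second_order_at_def by simp
  moreover have lin: "linear (\<lambda>h. c * F h)" if "linear F" for F :: "'a \<Rightarrow> real"
    using linear_compose_scale_right[OF that, of c] by simp
  ultimately show ?thesis
    using assms unfolding second_order_at_def bilinear_def by (auto intro!: lin simp: algebra_simps)
qed

lemma second_order_at_norm_power2:
  "second_order_at (\<lambda>x. (norm (x - a))\<^sup>2) y (\<lambda>h. 2 * ((y - a) \<bullet> h)) (\<lambda>h k. 2 * (h \<bullet> k))"
proof -
  have "(norm (y + h - a))\<^sup>2 - (norm (y - a))\<^sup>2 - 2 * ((y - a) \<bullet> h) - 2 * (h \<bullet> h) / 2 = 0" for h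
    by (simp add: power2_norm_eq_inner algebra_simps inner_commute)
  moreover have "bilinear (\<lambda>h k. 2 * (h \<bullet> k) :: real)"
    unfolding bilinear_def by (auto intro!: linearI simp: inner_add_left inner_add_right algebra_simps)
  moreover have "linear (\<lambda>h. 2 * ((y - a) \<bullet> h))"
    by (auto intro!: linearI simp: inner_add_right algebra_simps)
  ultimately show ?thesis unfolding second_order_at_def by simp
qed

text \<open>The cubic Taylor remainder, controlled by the third derivative on a compact ball, is
  o(h^2).\<close>

lemma holomorphic_second_order:
  assumes "f holomorphic_on S" "open S" "z \<in> S"
  shows "(\<lambda>h. f (z + h) - f z - h * deriv f z - h\<^sup>2 * (deriv (deriv f) z / 2)) \<in> o[nhds 0](\<lambda>h. h\<^sup>2)"
proof -
  obtain e where e: "e > 0" "cball z e \<subseteq> S"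
    using assms open_contains_cball by blast
  define F where "F i = (deriv ^^ i) f" for i
  have hol: "F i holomorphic_on S" for i
    unfolding F_def using assms holomorphic_higher_deriv by blast
  have "compact (F 3 ` cball z e)"
    using holomorphic_on_imp_continuous_on[OF hol] e(2)
    by (intro compact_continuous_image) (auto intro: continuous_on_subset)
  then obtain M where M: "\<And>w. w \<in> cball z e \<Longrightarrow> cmod (F 3 w) \<le> M"
    using compact_imp_bounded[of "F 3 ` cball z e"] unfolding bounded_iff by blast
  have bd0: "cmod (F 0 w - (\<Sum>i\<le>2. F i z * (w - z) ^ i / fact i)) \<le> M * cmod (w - z) ^ Suc 2 / fact 2"
    if "w \<in> cball z e" for w
  proof (rule complex_Taylor[of "cball z e" 2 F])
    fix i x assume "x \<in> cball z e"
    then have "(F i has_field_derivative F (Suc i) x) (at x)"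
      using hol[of i] e(2) assms(2) by (auto simp: F_def intro!: holomorphic_derivI)
    then show "(F i has_field_derivative F (Suc i) x) (at x within cball z e)"
      using has_field_derivative_at_within by blast
  qed (use M that e in \<open>auto simp: numeral_3_eq_3\<close>)
  have bd: "cmod (f (z + h) - f z - h * deriv f z - h\<^sup>2 * (deriv (deriv f) z / 2)) \<le> M / 2 * cmod h ^ 3"
    if "cmod h < e" for h
  proof -
    have "cmod (F 0 (z+h) - (\<Sum>i\<le>2. F i z * ((z+h) - z) ^ i / fact i)) \<le> M * cmod ((z+h) - z) ^ Suc 2 / fact 2"
      using that by (intro bd0) (auto simp: dist_norm)
    then show ?thesis
      by (simp add: F_def numeral_2_eq_2 algebra_simps power2_eq_square power3_eq_cube)
  qed
  show ?thesis
  proof (rule landau_o.smallI)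
    fix c :: real assume "c > 0"
    define d where "d = min e (2 * c / (\<bar>M\<bar> + 1))"
    have "d > 0" using e \<open>c > 0\<close> by (simp add: d_def)
    moreover have "cmod (f (z + h) - f z - h * deriv f z - h\<^sup>2 * (deriv (deriv f) z / 2)) \<le> c * norm (h\<^sup>2)"
      if "cmod h < d" for h
    proof -
      have "cmod h * (\<bar>M\<bar> + 1) \<le> 2 * c" using that by (simp add: d_def field_simps)
      moreover have "cmod h * M \<le> cmod h * (\<bar>M\<bar> + 1)" by (intro mult_left_mono) auto
      ultimately have "M / 2 * cmod h \<le> c" by (simp add: algebra_simps)
      then have "M / 2 * cmod h * (cmod h)\<^sup>2 \<le> c * (cmod h)\<^sup>2" by (intro mult_right_mono) auto
      then show ?thesis using bd[of h] that by (simp add: d_def norm_power norm_mult power3_eq_cube power2_eq_square mult.assoc)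
    qed
    ultimately show "\<forall>\<^sub>F h in nhds 0. norm (f (z + h) - f z - h * deriv f z - h\<^sup>2 * (deriv (deriv f) z / 2)) \<le> c * norm (h\<^sup>2)"
      by (auto simp: eventually_nhds_metric)
  qed
qed

lemma norm_vector_scalar_mult: "norm (h *s (b :: complex ^ 'm::finite)) = cmod h * norm b"
proof -
  have "norm (h *s b) = L2_set (\<lambda>i. cmod h * norm (b $ i)) UNIV"
    by (simp add: norm_vec_def norm_mult)
  then show ?thesis by (simp add: L2_set_right_distrib norm_vec_def)
qed

section \<open>Asymptotic sub-mean values along holomorphic discs\<close>

text \<open>
  Four-point averages suffice: they annihilate the real parts of \<open>h\<close> and \<open>h\<^sup>2\<close>, hence the second-order
  expansion of a holomorphic function.
\<close>

definition asymp_submean :: "(complex \<Rightarrow> real) \<Rightarrow> complex \<Rightarrow> bool" where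
  "asymp_submean S z \<longleftrightarrow> (\<forall>c>0. \<forall>\<^sub>F r in at_right 0.
     4 * S z - c * r\<^sup>2 \<le> S (z + of_real r) + S (z - of_real r) + S (z + \<i> * of_real r) + S (z - \<i> * of_real r))"

text \<open>\<open>T\<close> is any model of the increment up to second order; only its four-point
  sum matters. Each of the four remainders is at most c/4 r^2.\<close>

lemma asymp_submeanI:
  assumes T: "(\<lambda>h. S (z + h) - S z - T h) \<in> o[nhds 0](\<lambda>h. (norm h)\<^sup>2)"
    and pos: "\<And>r. r > 0 \<Longrightarrow> T (of_real r) + T (- of_real r) + T (\<i> * of_real r) + T (- (\<i> * of_real r)) \<ge> 0"
  shows "asymp_submean S z"
  unfolding asymp_submean_def
proof (intro allI impI)
  fix c :: real assume "c > 0"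
  then have "\<forall>\<^sub>F h in nhds 0. norm (S (z + h) - S z - T h) \<le> c / 4 * norm ((norm h)\<^sup>2)"
    by (intro landau_o.smallD[OF T]) auto
  then obtain d where d: "d > 0" "\<And>h. norm h < d \<Longrightarrow> \<bar>S (z + h) - S z - T h\<bar> \<le> c / 4 * (norm h)\<^sup>2"
    by (auto simp: eventually_nhds_metric)
  have "4 * S z - c * r\<^sup>2 \<le> S (z + of_real r) + S (z - of_real r) + S (z + \<i> * of_real r) + S (z - \<i> * of_real r)"
    if "0 < r" "r < d" for r
  proof -
    have "\<bar>S (z + of_real r) - S z - T (of_real r)\<bar> \<le> c / 4 * r\<^sup>2"
      "\<bar>S (z - of_real r) - S z - T (- of_real r)\<bar> \<le> c / 4 * r\<^sup>2"
      "\<bar>S (z + \<i> * of_real r) - S z - T (\<i> * of_real r)\<bar> \<le> c / 4 * r\<^sup>2"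
      "\<bar>S (z - \<i> * of_real r) - S z - T (- (\<i> * of_real r))\<bar> \<le> c / 4 * r\<^sup>2"
      using d(2)[of "of_real r"] d(2)[of "- of_real r"] d(2)[of "\<i> * of_real r"]
        d(2)[of "- (\<i> * of_real r)"] that by (simp_all add: norm_mult)
    with pos[OF that(1)] show ?thesis unfolding abs_le_iff by linarith
  qed
  then show "\<forall>\<^sub>F r in at_right 0. 4 * S z - c * r\<^sup>2 \<le> S (z + of_real r) + S (z - of_real r) + S (z + \<i> * of_real r) + S (z - \<i> * of_real r)"
    using d(1) by (auto simp: eventually_at_right_field)
qed

lemma asymp_submean_add:
  assumes "asymp_submean S z" "asymp_submean S' z"
  shows "asymp_submean (\<lambda>w. S w + S' w) z"
  unfolding asymp_submean_def
proof (intro allI impI)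
  fix c :: real assume "c > 0"
  then have "c / 2 > 0" by simp
  from assms(1)[unfolded asymp_submean_def, rule_format, OF this] assms(2)[unfolded asymp_submean_def, rule_format, OF this]
  show "\<forall>\<^sub>F r in at_right 0. 4 * (S z + S' z) - c * r\<^sup>2 \<le> S (z + of_real r) + S' (z + of_real r) + (S (z - of_real r) + S' (z - of_real r)) + (S (z + \<i> * of_real r) + S' (z + \<i> * of_real r)) + (S (z - \<i> * of_real r) + S' (z - \<i> * of_real r))"
    by eventually_elim (simp add: field_simps)
qed

lemma smallo_norm_le:
  "g \<in> o[F](h) \<Longrightarrow> (\<And>x. norm (f x) \<le> norm (g x)) \<Longrightarrow> f \<in> o[F](h)"
  by (rule landau_o.big_small_trans[OF landau_o.big_mono]) auto

lemma bigo_norm_le: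
  "g \<in> O[F](h) \<Longrightarrow> (\<And>x. norm (f x) \<le> norm (g x)) \<Longrightarrow> f \<in> O[F](h)"
  by (rule landau_o.big_trans[OF landau_o.big_mono]) auto

lemma asymp_submean_Re_holomorphic:
  assumes "f holomorphic_on S" "open S" "z \<in> S"
  shows "asymp_submean (\<lambda>w. Re (f w)) z"
proof (rule asymp_submeanI)
  define T where "T h = h * deriv f z + h\<^sup>2 * (deriv (deriv f) z / 2)" for h
  have "(\<lambda>h. f (z + h) - f z - T h) \<in> o[nhds 0](\<lambda>h. h\<^sup>2)"
    using holomorphic_second_order[OF assms] by (simp add: T_def algebra_simps)
  then have "(\<lambda>h. norm (f (z + h) - f z - T h)) \<in> o[nhds 0](\<lambda>h. norm (h\<^sup>2))"
    by simp
  moreover have "norm (Re (f (z + h)) - Re (f z) - Re (T h)) \<le> norm (norm (f (z + h) - f z - T h))" for h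
    using abs_Re_le_cmod[of "f (z + h) - f z - T h"] by simp
  ultimately show "(\<lambda>h. Re (f (z + h)) - Re (f z) - Re (T h)) \<in> o[nhds 0](\<lambda>h. (norm h)\<^sup>2)"
    by (simp add: norm_power smallo_norm_le)
  fix r :: real
  show "Re (T (of_real r)) + Re (T (- of_real r)) + Re (T (\<i> * of_real r)) + Re (T (- (\<i> * of_real r))) \<ge> 0"
    by (simp add: T_def power_mult_distrib)
qed

lemma holomorphic_components_second_order:
  fixes g :: "complex \<Rightarrow> complex ^ 'm::finite"
  assumes "\<And>j. (\<lambda>z. g z $ j) holomorphic_on S" "open S" "z \<in> S"
  obtains b c where "(\<lambda>h. norm (g (z + h) - g z - h *s b - h\<^sup>2 *s c)) \<in> o[nhds 0](\<lambda>h. (norm h)\<^sup>2)"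
proof
  define b where "b = (\<chi> j. deriv (\<lambda>z. g z $ j) z)"
  define c where "c = (\<chi> j. deriv (deriv (\<lambda>z. g z $ j)) z / 2)"
  define R where "R h = g (z + h) - g z - h *s b - h\<^sup>2 *s c" for h
  have "(\<lambda>h. norm (R h $ j)) \<in> o[nhds 0](\<lambda>h. norm (h\<^sup>2))" for j
    using holomorphic_second_order[OF assms(1)[of j] assms(2,3)]
    by (simp add: R_def b_def c_def)
  then have "(\<lambda>h. \<Sum>j\<in>UNIV. norm (R h $ j)) \<in> o[nhds 0](\<lambda>h. norm (h\<^sup>2))"
    by (intro big_sum_in_smallo) auto
  moreover have "norm (norm (R h)) \<le> norm (\<Sum>j\<in>UNIV. norm (R h $ j))" for h
    by (simp add: norm_vec_def L2_set_le_sum sum_nonneg)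
  ultimately show "(\<lambda>h. norm (g (z + h) - g z - h *s b - h\<^sup>2 *s c)) \<in> o[nhds 0](\<lambda>h. (norm h)\<^sup>2)"
    unfolding R_def[symmetric]
    by (simp add: norm_power smallo_norm_le)
qed

text \<open>The disc itself bends: g(z+h) = g(z) + hb + h^2 c + o(h^2). The term L(h^2 c) is of
  second order but harmonic in h, so the four-point sum removes it, and B contributes r^2 (B(b,b) +
  B(ib,ib)). This is why the Levi form, and not the real Hessian, gives the right condition.\<close>

lemma asymp_submean_compose:
  fixes g :: "complex \<Rightarrow> complex ^ 'm::finite"
  assumes Q: "second_order_at Q (g z) L B"
    and pos: "\<And>b. B b b + B (\<i> *s b) (\<i> *s b) \<ge> 0"
    and g: "\<And>j. (\<lambda>z. g z $ j) holomorphic_on S" "open S" "z \<in> S"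
  shows "asymp_submean (\<lambda>w. Q (g w)) z"
proof -
  obtain b c where bc: "(\<lambda>h. norm (g (z + h) - g z - h *s b - h\<^sup>2 *s c)) \<in> o[nhds 0](\<lambda>h. (norm h)\<^sup>2)"
    using holomorphic_components_second_order[OF g] by blast
  define \<rho> where "\<rho> h = g (z + h) - g z - h *s b - h\<^sup>2 *s c" for h
  define k where "k h = g (z + h) - g z" for h
  have k_eq: "k h = h *s b + (h\<^sup>2 *s c + \<rho> h)" for h by (simp add: k_def \<rho>_def)
  have linL: "linear L" and bilB: "bilinear B"
    and R: "(\<lambda>h. Q (g z + h) - Q (g z) - L h - B h h / 2) \<in> o[nhds 0](\<lambda>h. (norm h)\<^sup>2)"
    using Q by (auto simp: second_order_at_def)
  have \<rho>: "(\<lambda>h. norm (\<rho> h)) \<in> o[nhds 0](\<lambda>h. (norm h)\<^sup>2)"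
    using bc by (simp add: \<rho>_def)
  have sq: "(\<lambda>h::complex. (norm h)\<^sup>2) \<in> O[nhds 0](\<lambda>h. norm h)"
    by (rule landau_o.bigI[of 1]) (auto simp: eventually_nhds_metric power2_eq_square mult_left_le_one_le intro!: exI[of _ 1])
  have e2: "(\<lambda>h. norm (h\<^sup>2 *s c + \<rho> h)) \<in> O[nhds 0](\<lambda>h. (norm h)\<^sup>2)"
  proof -
    have "(\<lambda>h. (norm h)\<^sup>2 * norm c + norm (\<rho> h)) \<in> O[nhds 0](\<lambda>h. (norm h)\<^sup>2)"
      by (intro sum_in_bigo landau_o.small_imp_big[OF \<rho>]) auto
    moreover have "norm (norm (h\<^sup>2 *s c + \<rho> h)) \<le> norm ((norm h)\<^sup>2 * norm c + norm (\<rho> h))" for h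
      using norm_triangle_ineq[of "h\<^sup>2 *s c" "\<rho> h"] by (simp add: norm_vector_scalar_mult norm_power)
    ultimately show ?thesis
      by (rule bigo_norm_le)
  qed
  have k1: "(\<lambda>h. norm (k h)) \<in> O[nhds 0](\<lambda>h. norm h)"
  proof -
    have "(\<lambda>h. norm h * norm b + norm (h\<^sup>2 *s c + \<rho> h)) \<in> O[nhds 0](\<lambda>h. norm h)"
      by (intro sum_in_bigo landau_o.big_trans[OF e2 sq]) auto
    moreover have "norm (norm (k h)) \<le> norm (norm h * norm b + norm (h\<^sup>2 *s c + \<rho> h))" for h
      unfolding k_eq using norm_triangle_ineq[of "h *s b" "h\<^sup>2 *s c + \<rho> h"] by (simp add: norm_vector_scalar_mult)
    ultimately show ?thesis
      by (rule bigo_norm_le)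
  qed
  have k0: "filterlim k (nhds 0) (nhds 0)"
  proof -
    have "isCont (\<lambda>w. g w $ j) z" for j
      using g holomorphic_on_imp_continuous_on continuous_on_eq_continuous_at by blast
    then have "isCont (\<lambda>w. \<chi> j. g w $ j) z"
      unfolding isCont_def by (intro tendsto_vec_lambda) auto
    then have "isCont g z" by simp
    then have "isCont k 0" unfolding k_def
      by (intro continuous_intros isCont_o2[where g=g and f="\<lambda>h. z + h"]) auto
    then have "filterlim k (nhds (k 0)) (nhds 0)"
      unfolding isCont_def tendsto_at_iff_tendsto_nhds .
    then show ?thesis by (simp add: k_def)
  qed
  define T where "T h = L (h *s b) + L (h\<^sup>2 *s c) + B (h *s b) (h *s b) / 2" for h
  show ?thesis
  proof (rule asymp_submeanI)
    obtain KL where KL: "\<And>x. \<bar>L x\<bar> \<le> KL * norm x"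
      using linear_bounded[OF linL] by auto
    obtain KB where KB: "\<And>x y. \<bar>B x y\<bar> \<le> KB * norm x * norm y"
      using bilinear_bounded[OF bilB] by auto
    have 1: "(\<lambda>h. Q (g z + k h) - Q (g z) - L (k h) - B (k h) (k h) / 2) \<in> o[nhds 0](\<lambda>h. (norm h)\<^sup>2)"
    proof -
      have "(\<lambda>h. Q (g z + k h) - Q (g z) - L (k h) - B (k h) (k h) / 2) \<in> o[nhds 0](\<lambda>h. (norm (k h))\<^sup>2)"
        using landau_o.small.compose[OF R k0] .
      moreover have "(\<lambda>h. (norm (k h))\<^sup>2) \<in> O[nhds 0](\<lambda>h. (norm h)\<^sup>2)"
        by (intro landau_o.big_power k1)
      ultimately show ?thesis by (rule landau_o.small_big_trans)
    qed
    have 2: "(\<lambda>h. L (\<rho> h)) \<in> o[nhds 0](\<lambda>h. (norm h)\<^sup>2)"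
    proof -
      have "(\<lambda>h. L (\<rho> h)) \<in> O[nhds 0](\<lambda>h. norm (\<rho> h))"
        by (rule landau_o.bigI[of "\<bar>KL\<bar> + 1"]) (use KL in \<open>auto intro!: always_eventually order_trans[OF KL] mult_right_mono\<close>)
      then show ?thesis using \<rho> by (rule landau_o.big_small_trans)
    qed
    have 3: "(\<lambda>h. B (h\<^sup>2 *s c + \<rho> h) (k h) + B (h *s b) (h\<^sup>2 *s c + \<rho> h)) \<in> o[nhds 0](\<lambda>h. (norm h)\<^sup>2)"
    proof -
      have B1: "(\<lambda>h. B (u h) (v h)) \<in> O[nhds 0](\<lambda>h. norm (u h) * norm (v h))" for u v :: "complex \<Rightarrow> complex^'m"
        by (rule landau_o.bigI[of "\<bar>KB\<bar> + 1"])
          (auto intro!: always_eventually order_trans[OF KB] mult_right_mono simp: mult.assoc)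
      have hb: "(\<lambda>h. norm (h *s b)) \<in> O[nhds 0](\<lambda>h. norm h)"
        by (simp add: norm_vector_scalar_mult)
      have "(\<lambda>h. B (h\<^sup>2 *s c + \<rho> h) (k h) + B (h *s b) (h\<^sup>2 *s c + \<rho> h)) \<in> O[nhds 0](\<lambda>h. (norm h)\<^sup>2 * norm h)"
        using landau_o.big_trans[OF B1 landau_o.big_mult[OF e2 k1]]
          landau_o.big_trans[OF B1 landau_o.big_mult[OF hb e2]]
        by (intro sum_in_bigo) (auto simp: mult.commute)
      moreover have "(\<lambda>h::complex. (norm h)\<^sup>2 * norm h) \<in> o[nhds 0](\<lambda>h. (norm h)\<^sup>2)"
      proof (rule landau_o.smallI)
        fix c :: real assume "c > 0"
        then show "\<forall>\<^sub>F h::complex in nhds 0. norm ((norm h)\<^sup>2 * norm h) \<le> c * norm ((norm h)\<^sup>2)"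
          by (auto simp: eventually_nhds_metric mult.commute intro!: exI[of _ c] mult_right_mono)
      qed
      ultimately show ?thesis by (rule landau_o.big_small_trans)
    qed
    \<comment> \<open>Three errors: the Taylor remainder of \<open>Q\<close>, \<open>L\<close> of
      the remainder of \<open>g\<close>, and the part of \<open>B (k h) (k h)\<close> beyond its
      leading term, of order |h|^3.\<close>
    have "Q (g (z + h)) - Q (g z) - T h = (Q (g z + k h) - Q (g z) - L (k h) - B (k h) (k h) / 2)
        + L (\<rho> h) + (B (h\<^sup>2 *s c + \<rho> h) (k h) + B (h *s b) (h\<^sup>2 *s c + \<rho> h)) / 2" for h
    proof -
      have "L (k h) = L (h *s b) + L (h\<^sup>2 *s c) + L (\<rho> h)"
        by (simp add: k_eq linear_add[OF linL])
      moreover have "B (k h) (k h) = B (h *s b) (h *s b) + (B (h\<^sup>2 *s c + \<rho> h) (k h) + B (h *s b) (h\<^sup>2 *s c + \<rho> h))"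
        by (simp add: k_eq bilinear_ladd[OF bilB] bilinear_radd[OF bilB])
      moreover have "g z + k h = g (z + h)" by (simp add: k_def)
      ultimately show ?thesis by (simp add: T_def add_divide_distrib)
    qed
    moreover have "(\<lambda>h. (Q (g z + k h) - Q (g z) - L (k h) - B (k h) (k h) / 2)
        + L (\<rho> h) + (B (h\<^sup>2 *s c + \<rho> h) (k h) + B (h *s b) (h\<^sup>2 *s c + \<rho> h)) / 2) \<in> o[nhds 0](\<lambda>h. (norm h)\<^sup>2)"
      using 3 by (intro sum_in_smallo(1)[OF sum_in_smallo(1)[OF 1 2]]) simp
    ultimately show "(\<lambda>h. Q (g (z + h)) - Q (g z) - T h) \<in> o[nhds 0](\<lambda>h. (norm h)\<^sup>2)"
      by presburger
  next
    fix r :: real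
    have neg: "(- h) *s x = - (h *s x)" for h and x :: "complex^'m"
      by (simp add: vec_eq_iff)
    have "T (of_real r) + T (- of_real r) + T (\<i> * of_real r) + T (- (\<i> * of_real r))
       = B (of_real r *s b) (of_real r *s b) + B (\<i> *s (of_real r *s b)) (\<i> *s (of_real r *s b))"
      by (simp add: T_def power_mult_distrib neg linear_neg[OF linL] bilinear_lneg[OF bilB] bilinear_rneg[OF bilB])
    then show "T (of_real r) + T (- of_real r) + T (\<i> * of_real r) + T (- (\<i> * of_real r)) \<ge> 0"
      using pos[of "of_real r *s b"] by simp
  qed
qed

text \<open>On the ball k = exp \<kappa>, so the logarithm of the tested function is Re \<kappa> + S
  + \<epsilon>|w|^2. The factor \<open>k\<close> lets the applications divide by z and replace a
  norm by the modulus of a holomorphic function.\<close>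

lemma no_local_max_strictly_subharmonic:
  assumes k: "k holomorphic_on ball z \<rho>" "\<And>w. w \<in> ball z \<rho> \<Longrightarrow> k w \<noteq> 0" and \<rho>: "\<rho> > 0"
    and S: "asymp_submean S z" and "\<epsilon> > 0"
    and max: "\<And>w. w \<in> ball z \<rho> \<Longrightarrow> cmod (k w) * exp (S w + \<epsilon> * (cmod w)\<^sup>2) \<le> cmod (k z) * exp (S z + \<epsilon> * (cmod z)\<^sup>2)"
  shows False
proof -
  obtain \<kappa> where \<kappa>: "\<kappa> holomorphic_on ball z \<rho>" "\<And>w. w \<in> ball z \<rho> \<Longrightarrow> k w = exp (\<kappa> w)"
    using contractible_imp_holomorphic_log[OF k(1) convex_imp_contractible k(2)] by auto
  define U where "U w = Re (\<kappa> w) + S w" for w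
  have U: "asymp_submean U z" unfolding U_def
    by (intro asymp_submean_add S asymp_submean_Re_holomorphic[OF \<kappa>(1)]) (use \<rho> in auto)
  have mx: "U w + \<epsilon> * (cmod w)\<^sup>2 \<le> U z + \<epsilon> * (cmod z)\<^sup>2" if "w \<in> ball z \<rho>" for w
    using max[OF that] \<kappa>(2)[OF that] \<kappa>(2)[of z] \<rho> by (simp add: U_def add.assoc flip: exp_add)
  have "\<forall>\<^sub>F r in at_right 0. 4 * U z - 2 * \<epsilon> * r\<^sup>2 \<le> U (z + of_real r) + U (z - of_real r) + U (z + \<i> * of_real r) + U (z - \<i> * of_real r)"
    using U[unfolded asymp_submean_def, rule_format, of "2 * \<epsilon>"] \<open>\<epsilon> > 0\<close> by simp
  moreover have "\<forall>\<^sub>F r in at_right 0. r < \<rho>" "\<forall>\<^sub>F r in at_right (0::real). r > 0"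
    using \<rho> by (auto simp: eventually_at_right_field)
  ultimately have "\<forall>\<^sub>F r in at_right (0::real). False"
  proof eventually_elim
    case (elim r)
    \<comment> \<open>The four-point sum of |w|^2 exceeds 4|z|^2 by 4 r^2; times \<epsilon> this is
      twice the loss that \<open>U\<close> may incur.\<close>
    have sq: "(cmod (z + of_real r))\<^sup>2 + (cmod (z - of_real r))\<^sup>2 + (cmod (z + \<i> * of_real r))\<^sup>2 + (cmod (z - \<i> * of_real r))\<^sup>2
        = 4 * (cmod z)\<^sup>2 + 4 * r\<^sup>2"
      unfolding cmod_power2 by (simp add: power2_eq_square algebra_simps)
    have "\<epsilon> * (4 * (cmod z)\<^sup>2 + 4 * r\<^sup>2) \<le> 4 * (\<epsilon> * (cmod z)\<^sup>2) + 2 * \<epsilon> * r\<^sup>2"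
      using mx[of "z + of_real r"] mx[of "z - of_real r"] mx[of "z + \<i> * of_real r"] mx[of "z - \<i> * of_real r"] elim
      unfolding sq[symmetric] by (simp add: dist_norm norm_mult algebra_simps)
    moreover have "\<epsilon> * r\<^sup>2 > 0" using elim \<open>\<epsilon> > 0\<close> by simp
    ultimately show ?case by (simp add: algebra_simps)
  qed
  then show False by simp
qed

section \<open>Holomorphic maps and the Levi form\<close>

text \<open>A real parameter integral instead of a contour integral, because it is differentiated
  later with respect to the centre of the circle. The same formula gives the mean value property of
  polynomials.\<close>

lemma Cauchy_derivative_circle_integral:
  assumes "h holomorphic_on ball 0 R" "0 < r" "r < R"
  shows "deriv h 0 = of_real (1 / (2 * pi * r)) * integral {0..2*pi} (\<lambda>t. h (of_real r * cis t) * cis (- t))"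
proof -
  have "((\<lambda>u. h u / (u - 0) ^ 2) has_contour_integral (2 * pi * \<i>) / fact 1 * (deriv ^^ 1) h 0) (circlepath 0 r)"
  proof -
    have "continuous_on (cball 0 r) h" "h holomorphic_on ball 0 r"
      using assms by (auto intro!: holomorphic_on_imp_continuous_on intro: holomorphic_on_subset[OF assms(1)])
    then show ?thesis
      using Cauchy_has_contour_integral_higher_derivative_circlepath[of 0 r h 0 1] assms
      by (simp add: numeral_2_eq_2)
  qed
  then have "((\<lambda>x. h (circlepath 0 r x) / (circlepath 0 r x)\<^sup>2 * vector_derivative (circlepath 0 r) (at x)) has_integral 2 * pi * \<i> * deriv h 0) {0..1}"
    by (simp add: has_contour_integral)
  then have *: "((\<lambda>x. h (of_real r * cis (2 * pi * x)) * cis (- (2 * pi * x)) * (2 * pi * \<i> / r)) has_integral 2 * pi * \<i> * deriv h 0) {0..1}"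
  proof (rule has_integral_eq[rotated])
    fix x :: real
    have c: "circlepath 0 r x = r * cis (2 * pi * x)"
      by (simp add: circlepath_def part_circlepath_def linepath_def cis_conv_exp mult_ac)
    have v: "vector_derivative (circlepath 0 r) (at x) = 2 * pi * \<i> * r * cis (2 * pi * x)"
      by (simp add: vector_derivative_circlepath cis_conv_exp mult_ac)
    have "cis (- (2 * pi * x)) = 1 / cis (2 * pi * x)"
      by (simp add: cis_inverse[symmetric] inverse_eq_divide)
    then show "h (circlepath 0 r x) / (circlepath 0 r x)\<^sup>2 * vector_derivative (circlepath 0 r) (at x)
        = h (of_real r * cis (2 * pi * x)) * cis (- (2 * pi * x)) * (2 * pi * \<i> / r)"
      using assms unfolding c v by (simp add: field_simps power2_eq_square)
  qed
  have "((\<lambda>t. h (of_real r * cis t) * cis (- t)) has_integral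
      (2 * pi) *\<^sub>R (2 * pi * \<i> * deriv h 0 / (2 * pi * \<i> / r))) {0..2*pi}"
  proof -
    have "((\<lambda>x. h (of_real r * cis (2 * pi * x)) * cis (- (2 * pi * x))) has_integral 2 * pi * \<i> * deriv h 0 / (2 * pi * \<i> / r)) {0..1}"
      using has_integral_divide[OF *, of "2 * pi * \<i> / r"] assms by simp
    from has_integral_affinity[OF this[unfolded box_real[symmetric]], of "1 / (2*pi)" 0]
    show ?thesis by (simp add: image_mult_atLeastAtMost_if scaleR_conv_of_real)
  qed
  then show ?thesis using assms by (auto simp: integral_unique scaleR_conv_of_real field_simps)
qed

text \<open>Cauchy's formula in the direction \<open>v\<close> turns continuity of the map into continuity of its
  derivative, and then, differentiating under the integral, into differentiability of the derivative.\<close>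

lemma complex_linear_derivative_differentiable:
  fixes F :: "complex ^ 'n::finite \<Rightarrow> complex"
  assumes "open S"
    and F: "\<And>x. x \<in> S \<Longrightarrow> (F has_derivative D x) (at x)"
    and lin: "\<And>x c v. x \<in> S \<Longrightarrow> D x (c *s v) = c * D x v"
  shows "\<And>x. x \<in> S \<Longrightarrow> (\<lambda>x. D x v) differentiable (at x)"
proof -
  \<comment> \<open>Locally one radius \<open>r\<close> serves all base points \<open>x\<close>, so
    that the formula can be differentiated in \<open>x\<close>.\<close>
  have key: "\<exists>e>0. \<exists>r>0. (\<forall>x\<in>ball x0 e. \<forall>t. x + (of_real r * cis t) *s v \<in> S) \<and>
      (\<forall>x\<in>ball x0 e. D x v = of_real (1 / (2 * pi * r)) *
          integral (cbox 0 (2*pi)) (\<lambda>t. F (x + (of_real r * cis t) *s v) * cis (- t)))"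
    if x0: "x0 \<in> S" for x0 v
  proof -
    obtain e where e: "e > 0" "ball x0 (2 * e) \<subseteq> S"
    proof -
      obtain e' where "e' > 0" "ball x0 e' \<subseteq> S" using assms(1) x0 openE by blast
      then show ?thesis using that[of "e' / 2"] by auto
    qed
    \<comment> \<open>Translations by \<zeta> v with |\<zeta>| \<le> R move a point by at most e;
      the + 1 covers v = 0.\<close>
    define R where "R = e / (norm v + 1)"
    have R: "R > 0" using e by (simp add: R_def add_nonneg_pos)
    have Rv: "cmod \<zeta> * norm v \<le> e" if "cmod \<zeta> \<le> R" for \<zeta>
    proof -
      have "cmod \<zeta> * norm v \<le> R * (norm v + 1)" using that R by (intro mult_mono) auto
      also have "\<dots> = e" by (simp add: R_def add_nonneg_eq_0_iff)
      finally show ?thesis .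
    qed
    have inS: "x + \<zeta> *s v \<in> S" if "x \<in> ball x0 e" "cmod \<zeta> \<le> R" for x \<zeta>
    proof -
      have "dist x0 (x + \<zeta> *s v) \<le> dist x0 x + norm (\<zeta> *s v)"
        by (metis dist_norm dist_triangle add_diff_cancel_left' dist_commute)
      also have "\<dots> < 2 * e" using that Rv[of \<zeta>] by (simp add: norm_vector_scalar_mult)
      finally show ?thesis using e by auto
    qed
    have "D x v = of_real (1 / (2 * pi * (R/2))) *
          integral (cbox 0 (2*pi)) (\<lambda>t. F (x + (of_real (R/2) * cis t) *s v) * cis (- t))"
      if x: "x \<in> ball x0 e" for x
    proof -
      define h where "h \<zeta> = F (x + \<zeta> *s v)" for \<zeta>
      have hd: "(h has_field_derivative D (x + \<zeta> *s v) v) (at \<zeta>)" if "\<zeta> \<in> ball 0 R" for \<zeta>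
      proof -
        have bl: "bounded_linear (\<lambda>\<zeta>. \<zeta> *s v)"
          by (rule linear_conv_bounded_linear[THEN iffD1], rule linearI) (auto simp: vec_eq_iff algebra_simps)
        have "((\<lambda>\<zeta>. x + \<zeta> *s v) has_derivative (\<lambda>c. c *s v)) (at \<zeta>)"
          using bounded_linear.has_derivative[OF bl has_derivative_ident] by (auto intro!: derivative_eq_intros)
        moreover have S: "x + \<zeta> *s v \<in> S" using inS x that by simp
        ultimately have "(h has_derivative (\<lambda>c. D (x + \<zeta> *s v) (c *s v))) (at \<zeta>)"
          unfolding h_def using F[OF S] by (auto intro: has_derivative_compose)
        moreover have "(\<lambda>c. D (x + \<zeta> *s v) (c *s v)) = (*) (D (x + \<zeta> *s v) v)"
          using lin[OF S] by (auto simp: mult.commute)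
        ultimately show ?thesis by (simp add: has_field_derivative_def)
      qed
      have "h holomorphic_on ball 0 R"
        using hd holomorphic_on_open by blast
      moreover have "deriv h 0 = D x v" using hd[of 0] R by (auto intro!: DERIV_imp_deriv)
      ultimately show ?thesis
        using Cauchy_derivative_circle_integral[of h R "R/2"] R by (simp add: h_def)
    qed
    moreover have "x + (of_real (R/2) * cis t) *s v \<in> S" if "x \<in> ball x0 e" for x t
      using that R by (intro inS) (auto simp: norm_mult)
    ultimately show ?thesis using e(1) R by (intro exI[of _ e] conjI exI[of _ "R/2"] ballI allI) auto
  qed
  have contF: "continuous_on S F"
    using F by (meson continuous_at_imp_continuous_on has_derivative_continuous)
  have contv: "continuous_on (U \<times> T) (\<lambda>(x, t). x + (of_real r * cis t) *s v)" for U T r and v :: "complex^'n"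
  proof -
    have "continuous_on (U \<times> T) (\<lambda>p. fst p + (\<chi> i. (of_real r * cis (snd p)) * v $ i))"
      by (intro continuous_intros)
    then show ?thesis by (simp add: case_prod_unfold vector_scalar_mult_def)
  qed
  \<comment> \<open>Continuity of the directional derivatives comes first: differentiation under the
    integral sign asks for a jointly continuous derivative of the integrand.\<close>
  have contD: "continuous_on S (\<lambda>x. D x v)" for v
  proof -
    have "isCont (\<lambda>x. D x v) x0" if x0: "x0 \<in> S" for x0
    proof -
      obtain e r where er: "e > 0" "r > 0" "\<And>x t. x\<in>ball x0 e \<Longrightarrow> x + (of_real r * cis t) *s v \<in> S"
        "\<And>x. x\<in>ball x0 e \<Longrightarrow> D x v = of_real (1 / (2 * pi * r)) *
          integral (cbox 0 (2*pi)) (\<lambda>t. F (x + (of_real r * cis t) *s v) * cis (- t))"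
        using key[OF x0, of v] by blast
      have "continuous_on (ball x0 e \<times> cbox 0 (2*pi)) (\<lambda>p. F ((\<lambda>(x, t). x + (of_real r * cis t) *s v) p) * cis (- snd p))"
        using er(3) by (intro continuous_intros continuous_on_compose2[OF contF contv]) auto
      then have "continuous_on (ball x0 e \<times> cbox 0 (2*pi)) (\<lambda>(x, t). F (x + (of_real r * cis t) *s v) * cis (- t))"
        by (simp add: case_prod_unfold)
      from integral_continuous_on_param[OF this]
      have "continuous_on (ball x0 e) (\<lambda>x. of_real (1 / (2 * pi * r)) *
          integral (cbox 0 (2*pi)) (\<lambda>t. F (x + (of_real r * cis t) *s v) * cis (- t)))"
        by (intro continuous_intros)
      then have "continuous_on (ball x0 e) (\<lambda>x. D x v)"
        by (subst continuous_on_cong[OF refl er(4)])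
      then show ?thesis using er(1) by (simp add: continuous_on_eq_continuous_at)
    qed
    then show ?thesis by (simp add: continuous_at_imp_continuous_on)
  qed
  fix x0 assume x0: "x0 \<in> S"
  obtain e r where er: "e > 0" "r > 0" "\<And>x t. x\<in>ball x0 e \<Longrightarrow> x + (of_real r * cis t) *s v \<in> S"
    "\<And>x. x\<in>ball x0 e \<Longrightarrow> D x v = of_real (1 / (2 * pi * r)) *
      integral (cbox 0 (2*pi)) (\<lambda>t. F (x + (of_real r * cis t) *s v) * cis (- t))"
    using key[OF x0, of v] by blast
  have blD: "bounded_linear (D x)" if "x \<in> S" for x
    using F[OF that] by (rule has_derivative_bounded_linear)
  define fx where "fx x t = Blinfun (\<lambda>h. D (x + (of_real r * cis t) *s v) h * cis (- t))" for x t
  have fx: "blinfun_apply (fx x t) = (\<lambda>h. D (x + (of_real r * cis t) *s v) h * cis (- t))"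
    if "x \<in> ball x0 e" for x t
    unfolding fx_def using blD[OF er(3)[OF that]]
    by (intro bounded_linear_Blinfun_apply bounded_linear_mult_left[THEN bounded_linear_compose])
  have "((\<lambda>x. integral (cbox 0 (2*pi)) (\<lambda>t. F (x + (of_real r * cis t) *s v) * cis (- t)))
      has_derivative integral (cbox 0 (2*pi)) (fx x0)) (at x0 within ball x0 e)"
  proof (rule leibniz_rule)
    fix x t assume x: "x \<in> ball x0 e"
    have "((\<lambda>x. x + (of_real r * cis t) *s v) has_derivative (\<lambda>h. h)) (at x)"
      by (auto intro!: derivative_eq_intros)
    from has_derivative_compose[OF this F[OF er(3)[OF x]]]
    have "((\<lambda>x. F (x + (of_real r * cis t) *s v) * cis (- t)) has_derivative
      (\<lambda>h. D (x + (of_real r * cis t) *s v) h * cis (- t))) (at x)"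
      by (intro has_derivative_mult_left)
    then show "((\<lambda>x. F (x + (of_real r * cis t) *s v) * cis (- t)) has_derivative blinfun_apply (fx x t)) (at x within ball x0 e)"
      unfolding fx[OF x] by (rule has_derivative_at_withinI)
  next
    fix x assume x: "x \<in> ball x0 e"
    have "continuous_on (cbox 0 (2*pi)) (\<lambda>t. x + (\<chi> i. (of_real r * cis t) * v $ i))"
      by (intro continuous_intros)
    then have c: "continuous_on (cbox 0 (2*pi)) (\<lambda>t. x + (of_real r * cis t) *s v)"
      by (simp add: vector_scalar_mult_def)
    show "(\<lambda>t. F (x + (of_real r * cis t) *s v) * cis (- t)) integrable_on cbox 0 (2*pi)"
      using er(3)[OF x]
      by (intro integrable_continuous continuous_on_mult[OF continuous_on_compose2[OF contF c]] continuous_intros) auto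
  next
    show "continuous_on (ball x0 e \<times> cbox 0 (2*pi)) (\<lambda>(x, t). fx x t)"
    proof (rule continuous_on_blinfun_componentwise)
      fix i :: "complex^'n"
      have "continuous_on (ball x0 e \<times> cbox 0 (2*pi)) (\<lambda>p. D ((\<lambda>(x, t). x + (of_real r * cis t) *s v) p) i * cis (- snd p))"
        using er(3) by (intro continuous_intros continuous_on_compose2[OF contD contv]) auto
      then show "continuous_on (ball x0 e \<times> cbox 0 (2*pi)) (\<lambda>y. blinfun_apply (case y of (x, t) \<Rightarrow> fx x t) i)"
        by (rule continuous_on_eq) (auto simp: fx)
    qed
  qed (use er(1) in auto)
  then have "((\<lambda>x. integral (cbox 0 (2*pi)) (\<lambda>t. F (x + (of_real r * cis t) *s v) * cis (- t)))
      has_derivative integral (cbox 0 (2*pi)) (fx x0)) (at x0)"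
    using er(1) by (simp add: at_within_open[of x0 "ball x0 e"])
  from has_derivative_mult_right[OF this, of "of_real (1 / (2 * pi * r))"]
  have "((\<lambda>x. D x v) has_derivative (\<lambda>h. of_real (1 / (2 * pi * r)) * integral (cbox 0 (2*pi)) (fx x0) h)) (at x0)"
    by (rule has_derivative_transform_within_open[of _ _ _ _ "ball x0 e"]) (use er in auto)
  then show "(\<lambda>x. D x v) differentiable (at x0)"
    unfolding differentiable_def by blast
qed

text \<open>By the chain rule the derivative is D\<phi>(\<Phi> w)(A w v), so the point is that the
  Jacobian \<open>A w\<close> is itself differentiable in \<open>w\<close>. The two conclusions are
  what the second-order expansion asks for.\<close>

lemma C2_compose_holomorphic_map:
  fixes \<Phi> :: "complex ^ 'n::finite \<Rightarrow> complex ^ 'm::finite"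
  assumes "open S" and hol: "holomorphic_map_on S \<Phi>" and sub: "\<Phi> ` S \<subseteq> \<Omega>" and C2: "C2_on \<Omega> \<phi>" and x: "x \<in> S"
  shows "(\<phi> \<circ> \<Phi>) differentiable (at x)"
    and "(\<lambda>x. frechet_derivative (\<phi> \<circ> \<Phi>) (at x) v) differentiable (at x)"
proof -
  obtain A :: "complex ^ 'n \<Rightarrow> complex ^ 'n ^ 'm" where
    A: "\<And>w. w \<in> S \<Longrightarrow> (\<Phi> has_derivative (\<lambda>v. A w *v v)) (at w)"
    using hol unfolding holomorphic_map_on_def by metis
  define D where "D y = frechet_derivative \<phi> (at y)" for y
  have D: "(\<phi> has_derivative D y) (at y)" if "y \<in> \<Omega>" for y
    using C2 that unfolding C2_on_def C1_on_def D_def by (simp add: frechet_derivative_works)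
  have D2: "(\<lambda>y. D y e) differentiable (at y)" if "y \<in> \<Omega>" for y e
    using C2 that unfolding C2_on_def C1_on_def D_def by auto
  have Q: "((\<phi> \<circ> \<Phi>) has_derivative (\<lambda>v. D (\<Phi> w) (A w *v v))) (at w)" if "w \<in> S" for w
    using has_derivative_compose[OF A[OF that] D] sub that by (auto simp: o_def)
  then show "(\<phi> \<circ> \<Phi>) differentiable (at x)" using x differentiable_def by blast
  have Aj: "(\<lambda>w. (A w *v v) $ j) differentiable (at x)" for j
  proof (rule complex_linear_derivative_differentiable[OF \<open>open S\<close> _ _ x])
    show "((\<lambda>w. \<Phi> w $ j) has_derivative (\<lambda>v. (A w *v v) $ j)) (at w)" if "w \<in> S" for w
      by (rule bounded_linear.has_derivative[OF bounded_linear_vec_nth A[OF that]])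
    show "(A w *v (c *s u)) $ j = c * (A w *v u) $ j" for w c u
      by (simp add: vector_scalar_commute)
  qed
  \<comment> \<open>A real basis separates the two dependences on \<open>w\<close> in
    \<open>D (\<Phi> w) (A w *v v)\<close> into a finite sum of products.\<close>
  have Ae: "(\<lambda>w. (A w *v v) \<bullet> e) differentiable (at x)" if "e \<in> Basis" for e
  proof -
    obtain j u where e: "e = axis j u" using \<open>e \<in> Basis\<close> by (auto simp: Basis_vec_def)
    have "(\<lambda>w. (A w *v v) $ j \<bullet> u) differentiable (at x)"
      using Aj[of j] by (rule differentiable_inner) simp
    then show ?thesis by (simp add: e inner_axis)
  qed
  have DQ: "frechet_derivative (\<phi> \<circ> \<Phi>) (at w) v = (\<Sum>e\<in>Basis. ((A w *v v) \<bullet> e) * D (\<Phi> w) e)" if "w \<in> S" for w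
  proof -
    have "linear (D (\<Phi> w))" using D sub that has_derivative_linear by blast
    then have "D (\<Phi> w) (\<Sum>e\<in>Basis. ((A w *v v) \<bullet> e) *\<^sub>R e) = (\<Sum>e\<in>Basis. ((A w *v v) \<bullet> e) * D (\<Phi> w) e)"
      by (simp add: linear_sum linear_cmul)
    then have "D (\<Phi> w) (A w *v v) = (\<Sum>e\<in>Basis. ((A w *v v) \<bullet> e) * D (\<Phi> w) e)"
      by (simp add: euclidean_representation)
    moreover have "frechet_derivative (\<phi> \<circ> \<Phi>) (at w) = (\<lambda>v. D (\<Phi> w) (A w *v v))"
      using frechet_derivative_at[OF Q[OF that]] by simp
    ultimately show ?thesis by simp
  qed
  have "(\<lambda>w. \<Sum>e\<in>Basis. ((A w *v v) \<bullet> e) * D (\<Phi> w) e) differentiable (at x)"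
  proof (intro differentiable_sum ballI differentiable_mult Ae)
    fix e
    have "\<Phi> differentiable (at x)" using A[OF x] differentiable_def by blast
    then show "(\<lambda>w. D (\<Phi> w) e) differentiable (at x)"
      using differentiable_compose[of "\<lambda>y. D y e" \<Phi> x UNIV] D2[of "\<Phi> x" e] sub x
      by (auto intro: differentiable_at_withinI)
  qed auto
  then obtain d where "((\<lambda>w. \<Sum>e\<in>Basis. ((A w *v v) \<bullet> e) * D (\<Phi> w) e) has_derivative d) (at x)"
    unfolding differentiable_def by blast
  then have "((\<lambda>x. frechet_derivative (\<phi> \<circ> \<Phi>) (at x) v) has_derivative d) (at x)"
    by (rule has_derivative_transform_within_open[OF _ \<open>open S\<close> x]) (simp add: DQ)
  then show "(\<lambda>x. frechet_derivative (\<phi> \<circ> \<Phi>) (at x) v) differentiable (at x)"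
    unfolding differentiable_def by blast
qed

section \<open>The Levi form as a real second derivative\<close>

lemma levi_form_eq_second_derivative:
  fixes Q :: "complex ^ 'm::finite \<Rightarrow> real"
  assumes "open S" and w: "w \<in> S"
    and diff: "\<And>x. x \<in> S \<Longrightarrow> Q differentiable (at x)"
    and diff2: "\<And>v. (\<lambda>x. frechet_derivative Q (at x) v) differentiable (at w)"
  defines "B \<equiv> \<lambda>h v. frechet_derivative (\<lambda>x. frechet_derivative Q (at x) v) (at w) h"
  shows "levi_form Q w b = (B b b + B (\<i> *s b) (\<i> *s b)) / 4"
proof -
  define D where "D x = frechet_derivative Q (at x)" for x
  have bil: "bilinear B"
    using second_order_at_C2[OF assms(1,2) diff diff2] unfolding second_order_at_def B_def by blast
  have Bd: "((\<lambda>x. D x v) has_derivative (\<lambda>h. B h v)) (at w)" for v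
    using diff2[of v] unfolding B_def D_def by (simp add: frechet_derivative_works)
  have DQ: "frechet_derivative (\<lambda>z. complex_of_real (Q z)) (at x) = (\<lambda>v. of_real (D x v))" if "x \<in> S" for x
  proof -
    have "(Q has_derivative D x) (at x)" using diff[OF that] by (simp add: D_def frechet_derivative_works)
    then have "((\<lambda>z. complex_of_real (Q z)) has_derivative (\<lambda>v. of_real (D x v))) (at x)"
      by (rule has_derivative_of_real)
    then show ?thesis by (simp add: frechet_derivative_at[symmetric])
  qed
  have axi: "axis j \<i> = \<i> *s axis j (1::complex)" for j :: 'm
    by (simp add: vec_eq_iff axis_def)
  \<comment> \<open>Obtained by multiplying out (D(u) - i D(iu)) (D(v) + i D(iv)); the halves in the
    Wirtinger operators account for the factor 1/4. The form is complex linear in \<open>u\<close>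
    and conjugate linear in \<open>v\<close>, hence determined by its values on the axes.\<close>
  define T where "T u v = complex_of_real (B u v + B (\<i> *s u) (\<i> *s v)) + \<i> * of_real (B u (\<i> *s v) - B (\<i> *s u) v)" for u v
  have W: "wirtinger j (wirtinger_bar k (\<lambda>z. complex_of_real (Q z))) w = T (axis j 1) (axis k 1) / 4" for j k
  proof -
    have "((\<lambda>x. (of_real (D x (axis k 1)) + \<i> * of_real (D x (axis k \<i>))) / 2) has_derivative
        (\<lambda>h. (of_real (B h (axis k 1)) + \<i> * of_real (B h (axis k \<i>))) / 2)) (at w)"
      by (intro bounded_linear.has_derivative[OF bounded_linear_divide] has_derivative_add has_derivative_mult_right has_derivative_of_real Bd)
    then have "(wirtinger_bar k (\<lambda>z. complex_of_real (Q z)) has_derivative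
        (\<lambda>h. (of_real (B h (axis k 1)) + \<i> * of_real (B h (axis k \<i>))) / 2)) (at w)"
      by (rule has_derivative_transform_within_open[OF _ assms(1) w]) (simp add: wirtinger_bar_def DQ)
    then have "frechet_derivative (wirtinger_bar k (\<lambda>z. complex_of_real (Q z))) (at w) =
        (\<lambda>h. (of_real (B h (axis k 1)) + \<i> * of_real (B h (axis k \<i>))) / 2)"
      by (simp add: frechet_derivative_at[symmetric])
    then show ?thesis
      by (simp add: wirtinger_def[of j] T_def axi complex_eq_iff field_simps)
  qed
  have ii: "\<i> *s (\<i> *s u) = - u" for u :: "complex^'m"
    by (simp add: vec_eq_iff mult.assoc[symmetric])
  have isum: "\<i> *s (u + v) = \<i> *s u + \<i> *s v" "\<i> *s (r *\<^sub>R u) = r *\<^sub>R (\<i> *s u)" for u v :: "complex^'m" and r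
    by (simp_all add: vec_eq_iff algebra_simps)
  note Bs = bilinear_ladd[OF bil] bilinear_radd[OF bil] bilinear_lmul[OF bil] bilinear_rmul[OF bil] bilinear_lneg[OF bil] bilinear_rneg[OF bil]
  have lT1: "linear (\<lambda>u. T u v)" for v
    by (rule linearI) (simp_all add: T_def isum Bs complex_eq_iff algebra_simps)
  have lT2: "linear (T u)" for u
    by (rule linearI) (simp_all add: T_def isum Bs complex_eq_iff algebra_simps)
  have cs: "c *s u = Re c *\<^sub>R u + Im c *\<^sub>R (\<i> *s u)" for c and u :: "complex^'m"
    by (simp add: vec_eq_iff complex_eq_iff)
  have T1: "T (c *s u) v = c * T u v" for c u v
  proof -
    have "T (\<i> *s u) v = \<i> * T u v"
      by (simp add: T_def ii Bs complex_eq_iff)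
    then show ?thesis
      by (subst cs) (simp add: linear_add[OF lT1] linear_cmul[OF lT1] complex_eq_iff algebra_simps)
  qed
  have T2: "T u (c *s v) = cnj c * T u v" for c u v
  proof -
    have "T u (\<i> *s v) = - \<i> * T u v"
      by (simp add: T_def ii Bs complex_eq_iff)
    then show ?thesis
      by (subst cs) (simp add: linear_add[OF lT2] linear_cmul[OF lT2] complex_eq_iff algebra_simps)
  qed
  have "T b b = T (\<Sum>j\<in>UNIV. b $ j *s axis j 1) (\<Sum>k\<in>UNIV. b $ k *s axis k 1)"
    by (simp only: basis_expansion)
  also have "\<dots> = (\<Sum>j\<in>UNIV. \<Sum>k\<in>UNIV. T (axis j 1) (axis k 1) * b $ j * cnj (b $ k))"
    by (simp add: linear_sum[OF lT1] linear_sum[OF lT2] T1 T2 sum_distrib_left mult_ac) (rule sum.swap)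
  finally have Tb: "T b b = \<dots>" .
  have "levi_form Q w b = Re (T b b / 4)"
    unfolding levi_form_def W Tb by (simp add: sum_divide_distrib)
  then show ?thesis by (simp add: T_def)
qed

lemma has_integral_cis: "((\<lambda>t. cis t) has_integral 0) {0..2*pi}"
proof -
  have "((\<lambda>t. cis t) has_integral (- \<i> * cis (2*pi) - (- \<i> * cis 0))) {0..2*pi}"
  proof (rule fundamental_theorem_of_calculus)
    fix t :: real
    show "((\<lambda>t. - \<i> * cis t) has_vector_derivative cis t) (at t within {0..2*pi})"
      unfolding has_vector_derivative_complex_iff by (auto intro!: derivative_eq_intros)
  qed simp
  then show ?thesis by simp
qed

text \<open>The submean inequality on a small circle in direction \<open>b\<close> is combined with
  the expansion: linear and mixed terms average to 0, squares of sine and cosine to 1/2, which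
  leaves r^2/4 (B(b,b) + B(ib,ib)) up to an error c r^2 |b|^2.\<close>

lemma psh_second_order_nonneg:
  fixes \<phi> :: "complex ^ 'm::finite \<Rightarrow> real"
  assumes "open \<Omega>" "y \<in> \<Omega>" and psh: "plurisubharmonic_on \<Omega> \<phi>" and so: "second_order_at \<phi> y L B"
  shows "B b b + B (\<i> *s b) (\<i> *s b) \<ge> 0"
proof (rule field_le_epsilon)
  fix e :: real assume "e > 0"
  \<comment> \<open>After division by r^2/4 the error is 4 c |b|^2, which has to be at most
    e.\<close>
  define c where "c = e / (4 * ((norm b)\<^sup>2 + 1))"
  have nb: "(norm b)\<^sup>2 + 1 > 0" by (simp add: add_nonneg_pos)
  have c: "c > 0" "4 * c * (norm b)\<^sup>2 \<le> e" using \<open>e > 0\<close> nb by (auto simp: c_def field_simps)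
  have linL: "linear L" and bil: "bilinear B"
    and R: "(\<lambda>h. \<phi> (y + h) - \<phi> y - L h - B h h / 2) \<in> o[nhds 0](\<lambda>h. (norm h)\<^sup>2)"
    using so by (auto simp: second_order_at_def)
  obtain d where d: "d > 0" "\<And>h. norm h < d \<Longrightarrow> \<bar>\<phi> (y + h) - \<phi> y - L h - B h h / 2\<bar> \<le> c * (norm h)\<^sup>2"
    using landau_o.smallD[OF R c(1)] by (auto simp: eventually_nhds_metric)
  obtain d' where d': "d' > 0" "ball y d' \<subseteq> \<Omega>" using assms openE by blast
  define r where "r = min d d' / (2 * (norm b + 1))"
  have nb1: "norm b + 1 > 0" by (simp add: add_nonneg_pos)
  have r: "r > 0" using d d' nb1 by (simp add: r_def)
  have rb: "r * norm b < min d d'"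
  proof -
    have "r * norm b \<le> r * (norm b + 1)" using r by simp
    also have "\<dots> = min d d' / 2" using nb1 by (simp add: r_def field_simps)
    also have "\<dots> < min d d'" using d(1) d'(1) by (simp add: min_def)
    finally show ?thesis .
  qed
  have "cball 0 r \<subseteq> {l. y + l *s b \<in> \<Omega>}"
  proof
    fix l :: complex assume "l \<in> cball 0 r"
    then have "cmod l * norm b \<le> r * norm b" by (intro mult_right_mono) auto
    then have "y + l *s b \<in> ball y d'" using rb by (simp add: dist_norm norm_vector_scalar_mult)
    then show "l \<in> {l. y + l *s b \<in> \<Omega>}" using d' by auto
  qed
  then have int: "(\<lambda>t. \<phi> (y + (0 + of_real r * cis t) *s b)) integrable_on {0..2*pi}"
    and le: "\<phi> (y + 0 *s b) \<le> 1 / (2*pi) * integral {0..2*pi} (\<lambda>t. \<phi> (y + (0 + of_real r * cis t) *s b))"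
    using psh r unfolding plurisubharmonic_on_def subharmonic_on_def by blast+
  define M where "M t = \<phi> y + L ((of_real r * cis t) *s b) + B ((of_real r * cis t) *s b) ((of_real r * cis t) *s b) / 2 + c * (r * norm b)\<^sup>2" for t
  have le2: "\<phi> (y + (0 + of_real r * cis t) *s b) \<le> M t" for t
  proof -
    have "norm ((of_real r * cis t) *s b) = r * norm b" using r by (simp add: norm_vector_scalar_mult norm_mult)
    then show ?thesis using d(2)[of "(of_real r * cis t) *s b"] rb by (simp add: M_def abs_le_iff)
  qed
  note Bs = bilinear_ladd[OF bil] bilinear_radd[OF bil] bilinear_lmul[OF bil] bilinear_rmul[OF bil]
  have cs: "(of_real r * cis t) *s b = (r * cos t) *\<^sub>R b + (r * sin t) *\<^sub>R (\<i> *s b)" for t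
    by (simp add: vec_eq_iff complex_eq_iff)
  have M_eq: "M t = \<phi> y + c * (r * norm b)\<^sup>2 + (r * L b) * cos t + (r * L (\<i> *s b)) * sin t
      + (r\<^sup>2 / 2 * B b b) * (cos t)\<^sup>2 + (r\<^sup>2 / 2 * (B b (\<i> *s b) + B (\<i> *s b) b)) * (sin t * cos t)
      + (r\<^sup>2 / 2 * B (\<i> *s b) (\<i> *s b)) * (sin t)\<^sup>2" for t
    unfolding M_def cs by (simp add: linear_add[OF linL] linear_cmul[OF linL] Bs field_simps power2_eq_square)
  \<comment> \<open>Primitives of cos^2, sin cos and sin^2.\<close>
  define p1 where "p1 t = (t + sin t * cos t) / 2" for t :: real
  define p2 where "p2 t = (sin t)\<^sup>2 / 2" for t :: real
  define p3 where "p3 t = (t - sin t * cos t) / 2" for t :: real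
  define P where "P t = (\<phi> y + c * (r * norm b)\<^sup>2) * t + (r * L b) * sin t - (r * L (\<i> *s b)) * cos t
      + (r\<^sup>2 / 2 * B b b) * p1 t + (r\<^sup>2 / 2 * (B b (\<i> *s b) + B (\<i> *s b) b)) * p2 t
      + (r\<^sup>2 / 2 * B (\<i> *s b) (\<i> *s b)) * p3 t" for t
  have "(M has_integral P (2*pi) - P 0) {0..2*pi}"
  proof (rule fundamental_theorem_of_calculus)
    fix t :: real
    have *: "(p1 has_real_derivative (cos t)\<^sup>2) (at t)"
      "(p2 has_real_derivative sin t * cos t) (at t)" "(p3 has_real_derivative (sin t)\<^sup>2) (at t)"
      unfolding p1_def p2_def p3_def
      by (auto intro!: derivative_eq_intros simp: sin_squared_eq power2_eq_square[symmetric] field_simps)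
    have "(P has_real_derivative M t) (at t)"
      unfolding P_def M_eq by (auto intro!: derivative_eq_intros * simp: algebra_simps)
    then show "(P has_vector_derivative M t) (at t within {0..2*pi})"
      by (simp add: has_real_derivative_iff_has_vector_derivative has_vector_derivative_at_within)
  qed simp
  moreover have "P (2*pi) - P 0 = 2 * pi * (\<phi> y + c * (r * norm b)\<^sup>2 + r\<^sup>2 / 4 * (B b b + B (\<i> *s b) (\<i> *s b)))"
    by (simp add: P_def p1_def p2_def p3_def field_simps)
  ultimately have M: "(M has_integral 2 * pi * (\<phi> y + c * (r * norm b)\<^sup>2 + r\<^sup>2 / 4 * (B b b + B (\<i> *s b) (\<i> *s b)))) {0..2*pi}"
    by simp
  have "integral {0..2*pi} (\<lambda>t. \<phi> (y + (0 + of_real r * cis t) *s b)) \<le> 2 * pi * (\<phi> y + c * (r * norm b)\<^sup>2 + r\<^sup>2 / 4 * (B b b + B (\<i> *s b) (\<i> *s b)))"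
    using has_integral_le[OF integrable_integral[OF int] M le2] by simp
  then have "1 / (2*pi) * integral {0..2*pi} (\<lambda>t. \<phi> (y + (0 + of_real r * cis t) *s b)) \<le> \<phi> y + c * (r * norm b)\<^sup>2 + r\<^sup>2 / 4 * (B b b + B (\<i> *s b) (\<i> *s b))"
    by (simp add: field_simps)
  with le have "0 \<le> c * (r * norm b)\<^sup>2 + r\<^sup>2 / 4 * (B b b + B (\<i> *s b) (\<i> *s b))" by simp
  also have "\<dots> = r\<^sup>2 / 4 * (4 * c * (norm b)\<^sup>2 + (B b b + B (\<i> *s b) (\<i> *s b)))"
    by (simp add: power_mult_distrib algebra_simps)
  finally have "0 \<le> 4 * c * (norm b)\<^sup>2 + (B b b + B (\<i> *s b) (\<i> *s b))"
    using r by (simp add: zero_le_mult_iff)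
  then show "0 \<le> B b b + B (\<i> *s b) (\<i> *s b) + e" using c(2) by simp
qed

section \<open>Discs centred in a chart\<close>

lemma holomorphic_components_has_derivative:
  fixes f :: "complex \<Rightarrow> complex ^ 'm::finite"
  assumes "open U" "z \<in> U" "\<And>j. (\<lambda>z. f z $ j) holomorphic_on U"
  shows "(f has_derivative (\<lambda>h. h *s (\<chi> j. deriv (\<lambda>z. f z $ j) z))) (at z)"
proof (subst has_derivative_componentwise_within, intro ballI)
  fix e :: "complex^'m" assume "e \<in> Basis"
  then obtain j u where e: "e = axis j u" by (auto simp: Basis_vec_def)
  have "((\<lambda>z. f z $ j) has_field_derivative deriv (\<lambda>z. f z $ j) z) (at z)"
    using assms holomorphic_derivI by blast
  then have "((\<lambda>z. f z $ j) has_derivative (\<lambda>h. h * deriv (\<lambda>z. f z $ j) z)) (at z)"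
    by (simp add: has_field_derivative_def mult.commute[of _ "deriv _ _"])
  then show "((\<lambda>x. f x \<bullet> e) has_derivative (\<lambda>x. (x *s (\<chi> j. deriv (\<lambda>z. f z $ j) z)) \<bullet> e)) (at z)"
    by (simp add: e inner_axis has_derivative_inner_left)
qed

lemma continuous_on_holomorphic_components:
  fixes f :: "complex \<Rightarrow> complex ^ 'm::finite"
  assumes "\<And>j. (\<lambda>z. f z $ j) holomorphic_on U"
  shows "continuous_on U f"
proof -
  have "continuous_on U (\<lambda>z. \<chi> j. f z $ j)"
    by (intro continuous_on_vec_lambda holomorphic_on_imp_continuous_on assms)
  then show ?thesis by simp
qed

text \<open>Equal dimensions make the images open (invariance of domain). The inverse is
  differentiable because it is continuous and the derivative of \<Phi> is invertible; its holomorphy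
  is recorded along discs, the form in which charts are used.\<close>

lemma holomorphic_embedding_inverse:
  fixes \<Phi> :: "complex ^ 'm::finite \<Rightarrow> complex ^ 'm"
  assumes "open S" "holomorphic_embedding_on S \<Phi>"
  obtains G where "homeomorphism S (\<Phi> ` S) \<Phi> G"
    "\<And>T. open T \<Longrightarrow> T \<subseteq> S \<Longrightarrow> open (\<Phi> ` T)"
    "\<And>f U j. open U \<Longrightarrow> (\<And>j. (\<lambda>z. f z $ j) holomorphic_on U) \<Longrightarrow> f ` U \<subseteq> \<Phi> ` S \<Longrightarrow>
       (\<lambda>z. G (f z) $ j) holomorphic_on U"
proof -
  obtain G where G: "homeomorphism S (\<Phi> ` S) \<Phi> G"
    using assms unfolding holomorphic_embedding_on_def by blast
  have inj: "inj_on \<Phi> S" and cont: "continuous_on S \<Phi>" and contG: "continuous_on (\<Phi> ` S) G"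
    and G\<Phi>: "\<And>w. w \<in> S \<Longrightarrow> G (\<Phi> w) = w"
    using G unfolding homeomorphism_def by (auto intro: inj_on_inverseI)
  have op: "open (\<Phi> ` T)" if "open T" "T \<subseteq> S" for T
    using that inj cont by (intro invariance_of_domain) (auto intro: inj_on_subset continuous_on_subset)
  have hG: "(\<lambda>z. G (f z) $ j) holomorphic_on U"
    if U: "open U" and hol: "\<And>j. (\<lambda>z. f z $ j) holomorphic_on U" and sub: "f ` U \<subseteq> \<Phi> ` S"
    for f U j
  proof -
    have "\<exists>D. ((\<lambda>z. G (f z) $ j) has_field_derivative D) (at z)" if z: "z \<in> U" for z
    proof -
      obtain w where w: "w \<in> S" "f z = \<Phi> w" using sub z by blast
      obtain A :: "complex^'m^'m" where A: "(\<Phi> has_derivative (\<lambda>v. A *v v)) (at w)"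
        using assms w unfolding holomorphic_embedding_on_def holomorphic_map_on_def by blast
      have injA: "inj (\<lambda>v. A *v v)"
        using assms w frechet_derivative_at[OF A] unfolding holomorphic_embedding_on_def by auto
      have linA: "linear (\<lambda>v. A *v v)" using A has_derivative_linear by blast
      obtain g' where g': "linear g'" "g' \<circ> (\<lambda>v. A *v v) = id"
        using linear_injective_left_inverse[OF linA injA] by blast
      have g'A: "g' (A *v v) = v" for v using g'(2) by (metis comp_apply id_apply)
      have "(G has_derivative g') (at (\<Phi> w))"
        by (rule has_derivative_inverse_dieudonne[OF assms(1) _ cont contG G\<Phi> _ A _ g'(2)])
           (use op assms w g'(1) in \<open>auto simp: linear_conv_bounded_linear\<close>)
      moreover define b where "b = (\<chi> j. deriv (\<lambda>z. f z $ j) z)"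
      have "(f has_derivative (\<lambda>h. h *s b)) (at z)"
        unfolding b_def by (rule holomorphic_components_has_derivative[OF U z hol])
      ultimately have "((\<lambda>z. G (f z)) has_derivative (\<lambda>h. g' (h *s b))) (at z)"
        using w(2) by (auto intro: has_derivative_compose)
      \<comment> \<open>An injective endomorphism is onto, so the left inverse is the inverse of a
        complex linear map and complex linear itself.\<close>
      moreover have "g' (h *s b) = h *s g' b" for h
      proof -
        obtain x where x: "b = A *v x"
          using linear_injective_imp_surjective[OF linA injA] by (metis surjD)
        then show ?thesis by (simp add: g'A flip: vector_scalar_commute)
      qed
      ultimately have "((\<lambda>z. G (f z)) has_derivative (\<lambda>h. h *s g' b)) (at z)" by simp
      from bounded_linear.has_derivative[OF bounded_linear_vec_nth[of j] this]
      have "((\<lambda>z. G (f z) $ j) has_derivative (\<lambda>h. (h *s g' b) $ j)) (at z)" .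
      moreover have "(\<lambda>h. (h *s g' b) $ j) = (*) (g' b $ j)" by (auto simp: mult.commute)
      ultimately show ?thesis
        by (metis has_field_derivative_def)
    qed
    then show ?thesis using U holomorphic_on_open by blast
  qed
  show ?thesis by (rule that[OF G op hG])
qed

text \<open>The Hermitian product rather than the real one: for fixed \<open>y\<close> it is
  holomorphic in \<open>x\<close>.\<close>

lemma vec_Cauchy_Schwarz:
  "cmod (\<Sum>j\<in>UNIV. x $ j * cnj (y $ j)) \<le> norm x * norm (y :: complex ^ 'm::finite)"
proof -
  have "cmod (\<Sum>j\<in>UNIV. x $ j * cnj (y $ j)) \<le> (\<Sum>j\<in>UNIV. \<bar>cmod (x $ j)\<bar> * \<bar>cmod (y $ j)\<bar>)"
    by (rule order_trans[OF norm_sum]) (simp add: norm_mult)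
  also have "\<dots> \<le> L2_set (\<lambda>j. cmod (x $ j)) UNIV * L2_set (\<lambda>j. cmod (y $ j)) UNIV"
    by (rule L2_set_mult_ineq)
  finally show ?thesis by (simp add: norm_vec_def)
qed

lemma norm_vec_power2: "(\<Sum>j\<in>UNIV. (cmod (x $ j))\<^sup>2) = (norm (x :: complex ^ 'm::finite))\<^sup>2"
  by (simp add: power2_norm_eq_inner inner_vec_def)

text \<open>
  In terms of \<open>t = |\<Phi>\<^sup>-\<^sup>1 - w\<^sub>0|\<^sup>2\<close>, the glued function is \<open>A \<phi> + log (cut_profile t)\<close> with \<open>A s\<^sup>2 = 128\<close>: the
  profile \<open>log t - 128 t + log 128 + 2\<close> is \<open>1\<close> at \<open>t = 1/128\<close> and negative at \<open>t = 1/16\<close>, so between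
  these radii the maximum with \<open>0\<close> glues it to \<open>0\<close>.
\<close>

definition pole_profile :: "real \<Rightarrow> real" where
  "pole_profile t = 128 * t * exp (2 - 128 * t)"

text \<open>Up to 1/128 there is no maximum with 1, as it would remove the zero at 0; at 1/128 both
  branches equal e.\<close>

definition cut_profile :: "real \<Rightarrow> real" where
  "cut_profile t = (if t \<le> 1/128 then pole_profile t else max (pole_profile t) 1)"

text \<open>With x = 128 t this is x \<le> exp (x - 1). The bound e is the source of the + 1 in the
  radius exp (- (128/s^2 + 1)).\<close>

lemma pole_profile_le: "pole_profile t \<le> exp 1"
proof -
  have "128 * t \<le> exp (128 * t - 1)" using exp_ge_add_one_self[of "128 * t - 1"] by simp
  then have "128 * t * exp (2 - 128 * t) \<le> exp (128 * t - 1) * exp (2 - 128 * t)" by (intro mult_right_mono) auto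
  then show ?thesis by (simp add: pole_profile_def flip: exp_add)
qed

lemma cut_profile_le: "cut_profile t \<le> exp 1"
  using pole_profile_le[of t] exp_ge_add_one_self[of 1] by (auto simp: cut_profile_def)

lemma pole_le_cut_profile: "pole_profile t \<le> cut_profile t"
  by (auto simp: cut_profile_def)

lemma cut_profile_ge_1: "t > 1/128 \<Longrightarrow> cut_profile t \<ge> 1"
  by (auto simp: cut_profile_def)

lemma pole_profile_16: "pole_profile (1/16) < 1"
proof -
  \<comment> \<open>The value at 1/16 is 8 exp (-6).\<close>
  have "(8::real) < (1 + 3)^2" by simp
  also have "\<dots> \<le> exp 3 ^ 2" using exp_ge_add_one_self[of "3::real"] by (intro power_mono) auto
  also have "\<dots> = exp 6" by (simp flip: exp_of_nat_mult)
  finally show ?thesis by (simp add: pole_profile_def exp_minus field_simps)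
qed

lemma cut_profile_16: "cut_profile (1/16) = 1"
  using pole_profile_16 by (simp add: cut_profile_def)

lemma continuous_cut_profile: "continuous_on UNIV cut_profile"
proof -
  have "pole_profile (1/128) = exp 1" by (simp add: pole_profile_def)
  then have "pole_profile (1/128) = max (pole_profile (1/128)) 1" using exp_ge_add_one_self[of 1] by simp
  moreover have c: "continuous_on S pole_profile" for S
    unfolding pole_profile_def[abs_def] by (intro continuous_intros)
  ultimately show ?thesis unfolding cut_profile_def[abs_def]
  proof (intro continuous_on_cases_le[where h="\<lambda>t. t"] c continuous_on_max continuous_on_const continuous_on_id)
    fix t :: real assume "t = 1/128"
    then show "pole_profile t = max (pole_profile t) 1"
      using \<open>pole_profile (1/128) = max (pole_profile (1/128)) 1\<close> by (simp only:)
  qed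
qed

text \<open>
  The comparison is with \<open>log |z|\<close> although the pole has weight 2; the slack makes the quotient
  vanish at the origin, so that the maximum is attained away from it. At a maximum only one branch
  of the gluing matters, and \<open>|g - w\<^sub>0|\<close> may be replaced there by the modulus of the holomorphic function
  \<open>\<langle>g - w\<^sub>0, e\<rangle>\<close>, where \<open>e\<close> is the value of \<open>g - w\<^sub>0\<close> at the maximum.
\<close>

lemma disc_near_center_in_chart:
  fixes \<Omega> :: "(complex ^ 'm::finite) set" and \<Phi> :: "complex ^ 'm \<Rightarrow> complex ^ 'm"
  assumes "open \<Omega>" and s: "s > 0"
    and emb: "holomorphic_embedding_on (ball 0 1) \<Phi>" and sub: "\<Phi> ` ball 0 1 \<subseteq> \<Omega>"
    and C2: "C2_on \<Omega> \<phi>" and psh: "plurisubharmonic_on \<Omega> \<phi>" and rng: "\<phi> ` \<Omega> \<subseteq> {0..1}"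
    and levi: "\<And>w x. w \<in> ball 0 1 \<Longrightarrow> levi_form (\<phi> \<circ> \<Phi>) w x \<ge> s\<^sup>2 * (\<Sum>j\<in>UNIV. (cmod (x $ j))\<^sup>2)"
    and f: "holomorphic_disc \<Omega> f" and w0: "norm w0 \<le> 1/4" and f0: "f 0 = \<Phi> w0"
    and z1: "cmod z1 < exp (- (128 / s\<^sup>2 + 1))"
  shows "f z1 \<in> \<Phi> ` ball w0 (1/4)"
proof (rule ccontr)
  assume out: "f z1 \<notin> \<Phi> ` ball w0 (1/4)"
  define A where "A = 128 / s\<^sup>2"
  have A: "A > 0" "A * s\<^sup>2 = 128" using s by (auto simp: A_def)
  have fhol: "\<And>j. (\<lambda>z. f z $ j) holomorphic_on ball 0 1" and f\<Omega>: "\<And>z. z \<in> ball 0 1 \<Longrightarrow> f z \<in> \<Omega>"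
    using f by (auto simp: holomorphic_disc_def)
  have fcont: "continuous_on (ball 0 1) f" by (rule continuous_on_holomorphic_components[OF fhol])
  obtain G where G: "homeomorphism (ball 0 1) (\<Phi> ` ball 0 1) \<Phi> G"
    and op: "\<And>T. open T \<Longrightarrow> T \<subseteq> ball 0 1 \<Longrightarrow> open (\<Phi> ` T)"
    and Ghol: "\<And>f U j. open U \<Longrightarrow> (\<And>j. (\<lambda>z. f z $ j) holomorphic_on U) \<Longrightarrow> f ` U \<subseteq> \<Phi> ` ball 0 1 \<Longrightarrow>
       (\<lambda>z. G (f z) $ j) holomorphic_on U"
    using holomorphic_embedding_inverse[OF open_ball emb] by blast
  have \<Phi>cont: "continuous_on (ball 0 1) \<Phi>" and Gcont: "continuous_on (\<Phi> ` ball 0 1) G"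
    and G\<Phi>: "\<And>w. w \<in> ball 0 1 \<Longrightarrow> G (\<Phi> w) = w"
    using G unfolding homeomorphism_def by auto
  have cb: "cball w0 (1/4) \<subseteq> ball 0 1"
  proof
    fix w assume "w \<in> cball w0 (1/4)"
    then have "norm w \<le> 1/2" using norm_triangle_sub[of w w0] w0 by (simp add: dist_norm norm_minus_commute)
    then show "w \<in> ball 0 1" by simp
  qed
  have w0b: "w0 \<in> ball 0 1" using w0 by simp
  define N where "N = \<Phi> ` cball w0 (1/4)"
  have N\<Omega>: "N \<subseteq> \<Omega>" using cb sub by (auto simp: N_def)
  have NM: "N \<subseteq> \<Phi> ` ball 0 1" using cb by (auto simp: N_def)
  have Ncomp: "compact N" unfolding N_def
    by (intro compact_continuous_image continuous_on_subset[OF \<Phi>cont cb]) auto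
  \<comment> \<open>The squared distance from w0 in the chart, continued by its boundary value 1/16;
    where d = 1/16 the profile is 1 and only A \<phi> remains.\<close>
  define d where "d y = (if y \<in> N then (norm (G y - w0))\<^sup>2 else 1/16)" for y
  have dcont: "continuous_on \<Omega> d"
  proof -
    have eq: "N \<union> (\<Omega> - \<Phi> ` ball w0 (1/4)) = \<Omega>"
      using N\<Omega> by (auto simp: N_def)
    have "continuous_on (N \<union> (\<Omega> - \<Phi> ` ball w0 (1/4))) d"
      unfolding d_def[abs_def]
    proof (rule continuous_on_cases_local)
      show "closedin (top_of_set (N \<union> (\<Omega> - \<Phi> ` ball w0 (1/4)))) N"
        using Ncomp by (intro closed_subset) (auto intro: compact_imp_closed)
      have "open (\<Phi> ` ball w0 (1/4))" using cb by (intro op) auto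
      then have "closedin (top_of_set \<Omega>) (\<Omega> - \<Phi> ` ball w0 (1/4))"
        by (simp add: Diff_eq closedin_closed_Int closed_Compl)
      then show "closedin (top_of_set (N \<union> (\<Omega> - \<Phi> ` ball w0 (1/4)))) (\<Omega> - \<Phi> ` ball w0 (1/4))"
        by (simp only: eq)
      show "continuous_on N (\<lambda>y. (norm (G y - w0))\<^sup>2)"
        by (intro continuous_intros continuous_on_subset[OF Gcont NM])
      fix y assume "y \<in> N \<and> y \<notin> N \<or> y \<in> \<Omega> - \<Phi> ` ball w0 (1/4) \<and> y \<in> N"
      then have y: "y \<in> N" "y \<notin> \<Phi> ` ball w0 (1/4)" by auto
      then obtain w where w: "w \<in> cball w0 (1/4)" "y = \<Phi> w" by (auto simp: N_def)
      with y have "dist w0 w = 1/4" by force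
      then have "norm (w - w0) = 1/4" by (simp add: dist_norm norm_minus_commute)
      moreover have "G y = w" using w cb G\<Phi> by blast
      ultimately have "(norm (G y - w0))\<^sup>2 = (1/4)\<^sup>2" by (simp only:)
      then show "(norm (G y - w0))\<^sup>2 = 1/16" by (simp add: power2_eq_square)
    qed auto
    then show ?thesis by (simp only: eq)
  qed
  have d_le: "d y \<le> 1/16" for y
  proof (cases "y \<in> N")
    case True
    then obtain w where w: "w \<in> cball w0 (1/4)" "y = \<Phi> w" by (auto simp: N_def)
    then have "norm (w - w0) \<le> 1/4" by (simp add: dist_norm norm_minus_commute)
    then have "(norm (w - w0))\<^sup>2 \<le> (1/4)\<^sup>2" by (intro power_mono) auto
    moreover have "G y = w" using w cb G\<Phi> by blast
    ultimately show ?thesis using True by (simp add: d_def power2_eq_square)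
  qed (simp add: d_def)
  have d_N: "y \<in> N" if "d y < 1/16" for y using that by (auto simp: d_def split: if_splits)
  \<comment> \<open>\<open>G\<close> is meaningful only on the image of the chart, so chart
    coordinates along the disc live on this open subset.\<close>
  define U where "U = {z \<in> ball 0 1. f z \<in> \<Phi> ` ball 0 1}"
  have Uop: "open U"
  proof -
    have "open (ball 0 1 \<inter> f -` (\<Phi> ` ball 0 1))"
      using op by (intro continuous_open_preimage[OF fcont]) auto
    moreover have "U = ball 0 1 \<inter> f -` (\<Phi> ` ball 0 1)" by (auto simp: U_def)
    ultimately show ?thesis by simp
  qed
  define g where "g z = G (f z)" for z
  have ghol: "(\<lambda>z. g z $ j) holomorphic_on U" for j
    unfolding g_def by (rule Ghol[OF Uop]) (auto simp: U_def intro: holomorphic_on_subset[OF fhol])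
  have \<Phi>g: "\<Phi> (g z) = f z" "g z \<in> ball 0 1" if "z \<in> U" for z
    using that G\<Phi> by (auto simp: U_def g_def)
  have g0: "0 \<in> U" "g 0 = w0" using w0b f0 G\<Phi> by (auto simp: U_def g_def)
  have \<phi>rng: "0 \<le> \<phi> (f z)" "\<phi> (f z) \<le> 1" if "z \<in> ball 0 1" for z using rng f\<Omega>[OF that] by auto
  have \<phi>cont: "continuous_on \<Omega> \<phi>"
    using C2 unfolding C2_on_def C1_on_def
    by (meson continuous_at_imp_continuous_on differentiable_imp_continuous_within)
  have z1_0: "z1 \<noteq> 0" using out f0 by auto
  have z1b: "z1 \<in> ball 0 1"
  proof -
    have "exp (- (128 / s\<^sup>2 + 1)) \<le> exp 0" using A(1) unfolding A_def[symmetric] by (subst exp_le_cancel_iff) linarith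
    then have "cmod z1 < exp 0" using z1 by linarith
    then show ?thesis by simp
  qed
  \<comment> \<open>\<open>out\<close> excludes the open ball only: f z1 may still lie on the
    bounding sphere, where \<open>d\<close> has the same value.\<close>
  have dz1: "d (f z1) = 1/16"
  proof (cases "f z1 \<in> N")
    case True
    then obtain w where w: "w \<in> cball w0 (1/4)" "f z1 = \<Phi> w" by (auto simp: N_def)
    with out have "dist w0 w = 1/4" by force
    then have "norm (w - w0) = 1/4" by (simp add: dist_norm norm_minus_commute)
    moreover have "G (f z1) = w" using w cb G\<Phi> by force
    ultimately have "(norm (G (f z1) - w0))\<^sup>2 = (1/4)\<^sup>2" by (simp only:)
    then show ?thesis using True by (simp add: d_def power2_eq_square)
  qed (simp add: d_def)
  \<comment> \<open>q < 1 is the hypothesis on z1. On |z| = R one has E \<le> exp (A + 1 +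
    \<epsilon>) / R, which must stay below the lower bound 1/|z1| of E z1.\<close>
  define q where "q = exp (A + 1) * cmod z1"
  have q: "0 < q" "q < 1"
  proof -
    have "q < exp (A + 1) * exp (- (A + 1))"
      unfolding q_def using z1 by (intro mult_strict_left_mono) (auto simp: A_def)
    also have "\<dots> = 1" by (simp flip: exp_add)
    finally show "q < 1" .
  qed (use z1_0 in \<open>simp add: q_def\<close>)
  obtain R where R: "q < R" "R < 1" using q dense by blast
  have z1q: "cmod z1 \<le> q" unfolding q_def using A by (simp add: mult_le_cancel_right1)
  define \<epsilon> where "\<epsilon> = ln (R / q) / 2"
  have lnp: "ln (R / q) > 0" using q R by (simp add: ln_gt_zero_iff)
  have \<epsilon>: "\<epsilon> > 0" "exp \<epsilon> * q < R"
  proof -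
    show "\<epsilon> > 0" using lnp by (simp add: \<epsilon>_def)
    have "exp \<epsilon> < exp (ln (R / q))" using lnp by (simp add: \<epsilon>_def)
    then have "exp \<epsilon> < R / q" using q R by simp
    then show "exp \<epsilon> * q < R" using q by (simp add: field_simps)
  qed
  \<comment> \<open>The exponential of the glued function plus \<epsilon>|z|^2 minus log
    |z|.\<close>
  define E where "E z = cut_profile (d (f z)) * exp (A * \<phi> (f z) + \<epsilon> * (cmod z)\<^sup>2) / cmod z" for z
  have Ez1: "E z1 \<ge> 1 / cmod z1"
  proof -
    have "0 \<le> A * \<phi> (f z1) + \<epsilon> * (cmod z1)\<^sup>2"
      using A \<epsilon> \<phi>rng[OF z1b] by simp
    then show ?thesis by (simp add: E_def dz1 cut_profile_16 divide_right_mono)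
  qed
  have expb: "exp (A * \<phi> (f z) + \<epsilon> * (cmod z)\<^sup>2) \<le> exp (A + \<epsilon>)" if "z \<in> ball 0 1" for z
  proof -
    have "(cmod z)\<^sup>2 \<le> 1" using that by (simp add: power_le_one)
    then have "\<epsilon> * (cmod z)\<^sup>2 \<le> \<epsilon> * 1" using \<epsilon> by (intro mult_left_mono) auto
    moreover have "A * \<phi> (f z) \<le> A * 1" using A \<phi>rng[OF that] by (intro mult_left_mono) auto
    ultimately show ?thesis by simp
  qed
  have Eout: "E z < 1 / cmod z1" if "cmod z = R" for z
  proof -
    have zb: "z \<in> ball 0 1" using that R by simp
    have "E z \<le> exp 1 * exp (A + \<epsilon>) / R"
      unfolding E_def that using cut_profile_le expb[OF zb, unfolded that] q R
      by (intro divide_right_mono mult_mono) auto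
    also have "\<dots> = exp \<epsilon> * q / (R * cmod z1)"
      using z1_0 by (simp add: q_def exp_add field_simps)
    also have "\<dots> < R / (R * cmod z1)"
      using \<epsilon> q R z1_0 by (intro divide_strict_right_mono) auto
    also have "\<dots> = 1 / cmod z1" using q R by simp
    finally show ?thesis .
  qed
  \<comment> \<open>Near 0 the profile is O(|z|^2), so E = O(|z|); this keeps the maximum off the
    inner circle of the annulus.\<close>
  have "\<exists>r1>0. r1 < cmod z1 \<and> (\<forall>z. cmod z = r1 \<longrightarrow> E z < 1 / cmod z1)"
  proof -
    obtain b c where bc: "(\<lambda>h. norm (g (0 + h) - g 0 - h *s b - h\<^sup>2 *s c)) \<in> o[nhds 0](\<lambda>h. (norm h)\<^sup>2)"
      using holomorphic_components_second_order[OF ghol Uop g0(1)] by blast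
    obtain \<delta> where \<delta>: "\<delta> > 0" "\<And>h. cmod h < \<delta> \<Longrightarrow> norm (g h - w0 - h *s b - h\<^sup>2 *s c) \<le> (cmod h)\<^sup>2"
      using landau_o.smallD[OF bc, of 1] by (auto simp: eventually_nhds_metric g0)
    define K where "K = norm b + norm c + 1"
    have Kpos: "K > 0" by (simp add: K_def add_nonneg_pos)
    have gK: "norm (g h - w0) \<le> K * cmod h" if "cmod h < \<delta>" "cmod h \<le> 1" for h
    proof -
      have h2: "(cmod h)\<^sup>2 \<le> cmod h" using that by (simp add: power2_eq_square mult_left_le)
      have "norm (g h - w0) = norm ((g h - w0 - h *s b - h\<^sup>2 *s c) + (h *s b + h\<^sup>2 *s c))" by simp
      also have "\<dots> \<le> norm (g h - w0 - h *s b - h\<^sup>2 *s c) + (norm (h *s b) + norm (h\<^sup>2 *s c))"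
        by (intro norm_triangle_le add_left_mono norm_triangle_ineq)
      also have "\<dots> \<le> (cmod h)\<^sup>2 + (cmod h * norm b + (cmod h)\<^sup>2 * norm c)"
        using \<delta>(2)[OF that(1)] by (simp add: norm_vector_scalar_mult norm_power)
      also have "\<dots> \<le> cmod h + (cmod h * norm b + cmod h * norm c)"
        using h2 by (intro add_mono mult_right_mono) auto
      finally show ?thesis by (simp add: K_def algebra_simps)
    qed
    have "continuous_on (ball 0 1) (\<lambda>z. d (f z))"
      using f\<Omega> by (intro continuous_on_compose2[OF dcont fcont]) auto
    then have iso: "isCont (\<lambda>z. d (f z)) 0" by (simp add: continuous_on_eq_continuous_at)
    have df0: "d (f 0) = 0"
    proof -
      have "f 0 \<in> N" unfolding N_def f0 by simp
      then show ?thesis using g0 by (simp add: d_def g_def)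
    qed
    obtain \<delta>' where \<delta>': "\<delta>' > 0" "\<And>h. cmod h < \<delta>' \<Longrightarrow> \<bar>d (f h)\<bar> < 1/128"
      using iso[unfolded continuous_at_eps_delta, rule_format, of "1/128"] df0 by auto
    define C where "C = 128 * exp 2 * K\<^sup>2 * exp (A + \<epsilon>)"
    have C: "C > 0" using Kpos by (simp add: C_def)
    define r1 where "r1 = min (min \<delta> \<delta>' / 2) (min (cmod z1 / 2) (1 / (2 * C * cmod z1)))"
    have r1: "r1 > 0" "r1 < \<delta>" "r1 < \<delta>'" "r1 < cmod z1" "r1 < 1 / (C * cmod z1)"
    proof -
      have p: "1 / (2 * C * cmod z1) > 0" using C z1_0 by simp
      show "r1 > 0" using \<delta> \<delta>' z1_0 p by (simp add: r1_def)
      have "r1 \<le> min \<delta> \<delta>' / 2" "r1 \<le> cmod z1 / 2" "r1 \<le> 1 / (2 * C * cmod z1)"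
        by (auto simp: r1_def)
      moreover have "1 / (C * cmod z1) = 2 * (1 / (2 * C * cmod z1))" by simp
      moreover have "min \<delta> \<delta>' / 2 < \<delta>" "min \<delta> \<delta>' / 2 < \<delta>'" using \<delta>(1) \<delta>'(1) by (auto simp: min_def)
      ultimately show "r1 < \<delta>" "r1 < \<delta>'" "r1 < cmod z1" "r1 < 1 / (C * cmod z1)"
        using z1_0[folded zero_less_norm_iff] p by linarith+
    qed
    have "E z < 1 / cmod z1" if z: "cmod z = r1" for z
    proof -
      have zb: "z \<in> ball 0 1" using z r1 z1b by simp
      have "\<bar>d (f z)\<bar> < 1/128" using \<delta>'(2) z r1 by simp
      then have dd: "d (f z) < 1/128" by simp
      have dg: "d (f z) = (norm (g z - w0))\<^sup>2" using d_N[of "f z"] dd by (simp add: d_def g_def)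
      also have "\<dots> \<le> (K * cmod z)\<^sup>2" using gK[of z] z r1 zb by (intro power_mono) auto
      finally have dK: "d (f z) \<le> K\<^sup>2 * (cmod z)\<^sup>2" by (simp add: power_mult_distrib)
      have "cut_profile (d (f z)) = 128 * d (f z) * exp (2 - 128 * d (f z))"
        using dd by (simp add: cut_profile_def pole_profile_def)
      also have "\<dots> \<le> 128 * (K\<^sup>2 * (cmod z)\<^sup>2) * exp 2"
        using dK dg by (intro mult_mono) auto
      finally have "cut_profile (d (f z)) * exp (A * \<phi> (f z) + \<epsilon> * (cmod z)\<^sup>2) \<le> 128 * (K\<^sup>2 * (cmod z)\<^sup>2) * exp 2 * exp (A + \<epsilon>)"
        using expb[OF zb] by (intro mult_mono) auto
      then have "E z \<le> 128 * (K\<^sup>2 * (cmod z)\<^sup>2) * exp 2 * exp (A + \<epsilon>) / cmod z"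
        unfolding E_def by (intro divide_right_mono) auto
      also have "\<dots> = C * r1" using z r1 by (simp add: C_def power2_eq_square)
      also have "\<dots> < 1 / cmod z1" using r1(5) C z1_0 by (simp add: field_simps)
      finally show ?thesis .
    qed
    then show ?thesis using r1 by blast
  qed
  then obtain r1 where r1: "r1 > 0" "r1 < cmod z1" "\<And>z. cmod z = r1 \<Longrightarrow> E z < 1 / cmod z1" by blast
  define K where "K = {z. r1 \<le> cmod z \<and> cmod z \<le> R}"
  have K1: "K \<subseteq> ball 0 1" "0 \<notin> K" using R r1 by (auto simp: K_def)
  have "compact K"
  proof -
    have "K = cball 0 R - ball 0 r1" by (auto simp: K_def)
    then show ?thesis by (simp add: compact_diff)
  qed
  moreover have "z1 \<in> K" using r1 z1q R by (auto simp: K_def)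
  moreover have fK: "continuous_on K f" by (rule continuous_on_subset[OF fcont K1(1)])
  have "continuous_on K E"
  proof -
    have "continuous_on K (\<lambda>z. cut_profile (d (f z)))"
      by (rule continuous_on_compose2[OF continuous_cut_profile continuous_on_compose2[OF dcont fK]]) (use f\<Omega> K1 in auto)
    moreover have "continuous_on K (\<lambda>z. \<phi> (f z))"
      by (rule continuous_on_compose2[OF \<phi>cont fK]) (use f\<Omega> K1 in auto)
    ultimately show ?thesis unfolding E_def[abs_def] using K1 by (intro continuous_intros) auto
  qed
  ultimately obtain z where z: "z \<in> K" "\<And>w. w \<in> K \<Longrightarrow> E w \<le> E z"
    using continuous_attains_sup[of K E] by auto
  have Ez: "E z \<ge> 1 / cmod z1" using z(2)[OF \<open>z1 \<in> K\<close>] Ez1 by simp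
  define O' where "O' = {z. r1 < cmod z \<and> cmod z < R}"
  have O'op: "open O'"
  proof -
    have "O' = ball 0 R - cball 0 r1" by (auto simp: O'_def)
    then show ?thesis by (simp add: open_Diff)
  qed
  have zO: "z \<in> O'" using z(1) Eout[of z] r1(3)[of z] Ez by (auto simp: O'_def K_def less_le)
  have O'K: "O' \<subseteq> K" by (auto simp: O'_def K_def)
  have z0: "z \<noteq> 0" using zO r1 by (auto simp: O'_def)
  have zb: "z \<in> ball 0 1" using K1 z(1) by auto
  have dfO: "continuous_on O' (\<lambda>z. d (f z))"
    by (rule continuous_on_subset[OF continuous_on_compose2[OF dcont fK] O'K]) (use f\<Omega> K1 in auto)
  have cutpos: "cut_profile (d (f z)) > 0"
  proof -
    have "0 < 1 / cmod z1" using z1_0 by simp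
    then have "0 < E z" using Ez by linarith
    then show ?thesis using z0 by (simp add: E_def zero_less_mult_iff zero_less_divide_iff)
  qed
  \<comment> \<open>With \<open>d < 1/16\<close> the chart is available near z. In the opposite case
    the profile equals 1 at z and is at least 1 nearby, so it can be replaced by 1 without losing
    the maximum.\<close>
  show False
  proof (cases "cut_profile (d (f z)) = pole_profile (d (f z)) \<and> d (f z) < 1/16")
    case False
    have dz: "d (f z) > 1/128" "cut_profile (d (f z)) = 1"
    proof -
      show "d (f z) > 1/128"
      proof (rule ccontr)
        assume "\<not> d (f z) > 1/128"
        then have "d (f z) \<le> 1/128" by linarith
        moreover from this have "cut_profile (d (f z)) = pole_profile (d (f z))" by (simp add: cut_profile_def)
        ultimately show False using False by linarith
      qed
      then have mx: "cut_profile (d (f z)) = max (pole_profile (d (f z))) 1" by (simp add: cut_profile_def)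
      show "cut_profile (d (f z)) = 1"
      proof (cases "d (f z) = 1/16")
        case True then show ?thesis using cut_profile_16 by (simp only:)
      next
        case neq: False
        then have "cut_profile (d (f z)) \<noteq> pole_profile (d (f z))" using False d_le[of "f z"] by linarith
        then show ?thesis using mx by (auto simp: max_def split: if_splits)
      qed
    qed
    have "open (O' \<inter> (\<lambda>z. d (f z)) -` {1/128<..})"
      by (rule continuous_open_preimage[OF dfO O'op]) simp
    then obtain \<rho> where \<rho>: "\<rho> > 0" "ball z \<rho> \<subseteq> O' \<inter> (\<lambda>z. d (f z)) -` {1/128<..}"
      using zO dz openE by (metis IntI greaterThan_iff vimageI)
    have nz: "w \<noteq> 0" if "w \<in> ball z \<rho>" for w
    proof -
      have "w \<in> O'" using that \<rho>(2) by blast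
      then show ?thesis using r1(1) by (auto simp: O'_def)
    qed
    define S where "S w = A * \<phi> (f w)" for w
    have "asymp_submean S z" unfolding S_def
    proof (rule asymp_submean_compose[OF _ _ fhol open_ball zb])
      have so: "second_order_at \<phi> (f z) (frechet_derivative \<phi> (at (f z)))
           (\<lambda>h v. frechet_derivative (\<lambda>x. frechet_derivative \<phi> (at x) v) (at (f z)) h)" (is "second_order_at _ _ ?L ?B")
        using C2 f\<Omega>[OF zb] unfolding C2_on_def C1_on_def by (intro second_order_at_C2[OF \<open>open \<Omega>\<close>]) auto
      show "second_order_at (\<lambda>y. A * \<phi> y) (f z) (\<lambda>h. A * ?L h) (\<lambda>h k. A * ?B h k)"
        by (rule second_order_at_cmult[OF so])
      show "0 \<le> A * ?B b b + A * ?B (\<i> *s b) (\<i> *s b)" for b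
        using psh_second_order_nonneg[OF \<open>open \<Omega>\<close> f\<Omega>[OF zb] psh so, of b] A
        by (simp flip: distrib_left)
    qed
    note sub = this
    have khol: "(\<lambda>w. 1 / w) holomorphic_on ball z \<rho>"
      by (intro holomorphic_intros) (use nz in blast)
    have knz: "1 / w \<noteq> 0" if "w \<in> ball z \<rho>" for w using nz[OF that] by simp
    have mx: "cmod (1 / w) * exp (S w + \<epsilon> * (cmod w)\<^sup>2) \<le> cmod (1 / z) * exp (S z + \<epsilon> * (cmod z)\<^sup>2)"
      if w: "w \<in> ball z \<rho>" for w
    proof -
      have "cmod (1 / w) * exp (S w + \<epsilon> * (cmod w)\<^sup>2) = 1 * exp (A * \<phi> (f w) + \<epsilon> * (cmod w)\<^sup>2) / cmod w"
        by (simp add: S_def norm_divide)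
      also have "\<dots> \<le> E w"
        unfolding E_def using w \<rho>(2) by (intro divide_right_mono mult_right_mono cut_profile_ge_1) auto
      also have "\<dots> \<le> E z" using w \<rho>(2) O'K by (intro z(2)) auto
      also have "\<dots> = cmod (1 / z) * exp (S z + \<epsilon> * (cmod z)\<^sup>2)"
        by (simp add: E_def dz S_def norm_divide)
      finally show ?thesis .
    qed
    show False by (rule no_local_max_strictly_subharmonic[OF khol knz \<rho>(1) sub \<epsilon>(1) mx])
  next
    case True
    define e where "e = g z - w0"
    have zN: "f z \<in> N" using True d_N by auto
    have de: "d (f z) = (norm e)\<^sup>2" using zN by (simp add: d_def g_def e_def)
    have e0: "e \<noteq> 0" using True cutpos de by (auto simp: pole_profile_def)
    have zU: "z \<in> U" using zN NM zb by (auto simp: U_def)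
    define \<gamma> where "\<gamma> w = (\<Sum>j\<in>UNIV. (g w - w0) $ j * cnj (e $ j))" for w
    have \<gamma>hol: "\<gamma> holomorphic_on U" unfolding \<gamma>_def vector_minus_component
      by (intro holomorphic_intros ghol)
    have \<gamma>z: "\<gamma> z = of_real ((norm e)\<^sup>2)"
    proof -
      have "\<gamma> z = (\<Sum>j\<in>UNIV. e $ j * cnj (e $ j))" by (simp only: \<gamma>_def e_def)
      also have "\<dots> = of_real (\<Sum>j\<in>UNIV. (cmod (e $ j))\<^sup>2)"
        by (simp only: complex_norm_square of_real_sum)
      finally show ?thesis by (simp only: norm_vec_power2)
    qed
    have "open (O' \<inter> (\<lambda>z. d (f z)) -` {..<1/16})"
      by (rule continuous_open_preimage[OF dfO O'op]) simp
    moreover have "open (U \<inter> \<gamma> -` (- {0}))"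
      by (rule continuous_open_preimage[OF holomorphic_on_imp_continuous_on[OF \<gamma>hol] Uop]) auto
    ultimately have "open ((O' \<inter> (\<lambda>z. d (f z)) -` {..<1/16}) \<inter> (U \<inter> \<gamma> -` (- {0})))" by blast
    moreover have "z \<in> (O' \<inter> (\<lambda>z. d (f z)) -` {..<1/16}) \<inter> (U \<inter> \<gamma> -` (- {0}))"
      using zO True zU \<gamma>z e0 by auto
    ultimately obtain \<rho> where \<rho>: "\<rho> > 0" "ball z \<rho> \<subseteq> (O' \<inter> (\<lambda>z. d (f z)) -` {..<1/16}) \<inter> (U \<inter> \<gamma> -` (- {0}))"
      using openE by blast
    have inb: "w \<in> O'" "d (f w) < 1/16" "w \<in> U" "\<gamma> w \<noteq> 0" "w \<noteq> 0" if "w \<in> ball z \<rho>" for w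
    proof -
      have "w \<in> (O' \<inter> (\<lambda>z. d (f z)) -` {..<1/16}) \<inter> (U \<inter> \<gamma> -` (- {0}))" using that \<rho>(2) by blast
      then show "w \<in> O'" "d (f w) < 1/16" "w \<in> U" "\<gamma> w \<noteq> 0" by auto
      then show "w \<noteq> 0" using r1 by (auto simp: O'_def)
    qed
    \<comment> \<open>128 = A s^2: over the directions b and ib the subtracted term costs 512 |b|^2,
      exactly the lower bound 4 A s^2 |b|^2 that the Levi form of
      \<open>\<phi> \<circ> \<Phi>\<close> provides.\<close>
    define Q where "Q w = A * (\<phi> \<circ> \<Phi>) w + (- 128) * (norm (w - w0))\<^sup>2" for w
    define S where "S w = Q (g w)" for w
    have gz: "g z \<in> ball 0 1" using \<Phi>g zU by blast
    have hm: "holomorphic_map_on (ball 0 1) \<Phi>" using emb by (simp add: holomorphic_embedding_on_def)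
    note C2\<Phi> = C2_compose_holomorphic_map[OF open_ball hm sub C2]
    have "asymp_submean S z" unfolding S_def
    proof (rule asymp_submean_compose[OF _ _ ghol Uop zU])
      have so: "second_order_at (\<phi> \<circ> \<Phi>) (g z) (frechet_derivative (\<phi> \<circ> \<Phi>) (at (g z)))
           (\<lambda>h v. frechet_derivative (\<lambda>x. frechet_derivative (\<phi> \<circ> \<Phi>) (at x) v) (at (g z)) h)" (is "second_order_at _ _ ?L ?B")
        by (intro second_order_at_C2[OF open_ball gz] C2\<Phi> gz)
      show "second_order_at Q (g z) (\<lambda>h. A * ?L h + (-128) * (2 * ((g z - w0) \<bullet> h))) (\<lambda>h k. A * ?B h k + (-128) * (2 * (h \<bullet> k)))"
        unfolding Q_def[abs_def]
        by (intro second_order_at_add second_order_at_cmult so second_order_at_norm_power2)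
      fix b
      have "levi_form (\<phi> \<circ> \<Phi>) (g z) b = (?B b b + ?B (\<i> *s b) (\<i> *s b)) / 4"
        by (rule levi_form_eq_second_derivative[OF open_ball gz C2\<Phi>(1) C2\<Phi>(2)[OF gz]])
      then have "4 * (s\<^sup>2 * (norm b)\<^sup>2) \<le> ?B b b + ?B (\<i> *s b) (\<i> *s b)"
        using levi[OF gz, of b] by (simp add: norm_vec_power2)
      then have "A * (4 * (s\<^sup>2 * (norm b)\<^sup>2)) \<le> A * (?B b b + ?B (\<i> *s b) (\<i> *s b))"
        using A by (intro mult_left_mono) auto
      moreover have "A * (4 * (s\<^sup>2 * (norm b)\<^sup>2)) = 512 * (norm b)\<^sup>2" using A(2) by (simp add: mult.assoc[symmetric] mult.commute[of A]) 
      moreover have "(\<i> *s b) \<bullet> (\<i> *s b) = (norm b)\<^sup>2"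
        using norm_vector_scalar_mult[of \<i> b] by (simp flip: power2_norm_eq_inner)
      ultimately have le: "512 * (norm b)\<^sup>2 \<le> A * ?B b b + A * ?B (\<i> *s b) (\<i> *s b)"
        and nn: "(\<i> *s b) \<bullet> (\<i> *s b) = (norm b)\<^sup>2" "b \<bullet> b = (norm b)\<^sup>2"
        by (simp_all only: power2_norm_eq_inner distrib_left)
      show "0 \<le> A * ?B b b + - 128 * (2 * (b \<bullet> b)) + (A * ?B (\<i> *s b) (\<i> *s b) + - 128 * (2 * ((\<i> *s b) \<bullet> (\<i> *s b))))"
        unfolding nn using le by linarith
    qed
    note sub = this
    have \<gamma>h: "\<gamma> holomorphic_on ball z \<rho>"
      by (rule holomorphic_on_subset[OF \<gamma>hol]) (use inb(3) in blast)
    \<comment> \<open>The square matches the weight 2 of the pole.\<close>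
    have khol: "(\<lambda>w. (\<gamma> w)\<^sup>2 / w) holomorphic_on ball z \<rho>"
      by (intro holomorphic_intros \<gamma>h inb(5))
    have knz: "(\<gamma> w)\<^sup>2 / w \<noteq> 0" if "w \<in> ball z \<rho>" for w using inb(4,5)[OF that] by simp
    have zz: "z \<in> ball z \<rho>" using \<rho>(1) by simp
    have mx: "cmod ((\<gamma> w)\<^sup>2 / w) * exp (S w + \<epsilon> * (cmod w)\<^sup>2) \<le> cmod ((\<gamma> z)\<^sup>2 / z) * exp (S z + \<epsilon> * (cmod z)\<^sup>2)"
      if w: "w \<in> ball z \<rho>" for w
    proof -
      \<comment> \<open>Normalised by 128 c exp 2 = |e|^2; the Cauchy-Schwarz bound is then an
        equality at w = z.\<close>
      define c where "c = (norm e)\<^sup>2 / (128 * exp 2)"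
      have Epole: "pole_profile (d (f w)) * exp (A * \<phi> (f w) + \<epsilon> * (cmod w)\<^sup>2) / cmod w
          = 128 * exp 2 * (norm (g w - w0))\<^sup>2 * exp (S w + \<epsilon> * (cmod w)\<^sup>2) / cmod w" if "w \<in> ball z \<rho>" for w
      proof -
        have "f w \<in> N" using d_N inb(2)[OF that] by blast
        then have "d (f w) = (norm (g w - w0))\<^sup>2" by (simp add: d_def g_def)
        then show ?thesis
          using \<Phi>g(1)[OF inb(3)[OF that]] by (simp add: pole_profile_def S_def Q_def flip: exp_add)
      qed
      have "cmod (\<gamma> w) \<le> norm (g w - w0) * norm e" unfolding \<gamma>_def by (rule vec_Cauchy_Schwarz)
      then have "(cmod (\<gamma> w))\<^sup>2 \<le> (norm (g w - w0) * norm e)\<^sup>2" by (intro power_mono) auto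
      then have "cmod ((\<gamma> w)\<^sup>2 / w) * exp (S w + \<epsilon> * (cmod w)\<^sup>2) \<le> (norm (g w - w0) * norm e)\<^sup>2 / cmod w * exp (S w + \<epsilon> * (cmod w)\<^sup>2)"
        unfolding norm_divide norm_power by (intro mult_right_mono divide_right_mono) auto
      also have "\<dots> = c * (pole_profile (d (f w)) * exp (A * \<phi> (f w) + \<epsilon> * (cmod w)\<^sup>2) / cmod w)"
        unfolding Epole[OF w] by (simp add: c_def power_mult_distrib)
      also have "\<dots> \<le> c * E w"
        unfolding E_def c_def by (intro mult_left_mono divide_right_mono mult_right_mono pole_le_cut_profile) auto
      also have "\<dots> \<le> c * E z"
        using w inb O'K unfolding c_def by (intro mult_left_mono z(2)) auto
      also have "\<dots> = c * (pole_profile (d (f z)) * exp (A * \<phi> (f z) + \<epsilon> * (cmod z)\<^sup>2) / cmod z)"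
        using True by (simp add: E_def)
      also have "\<dots> = cmod ((\<gamma> z)\<^sup>2 / z) * exp (S z + \<epsilon> * (cmod z)\<^sup>2)"
        unfolding Epole[OF zz] e_def[symmetric] by (simp add: c_def \<gamma>z norm_divide norm_power norm_mult power2_eq_square)
      finally show ?thesis .
    qed
    show False by (rule no_local_max_strictly_subharmonic[OF khol knz \<rho>(1) sub \<epsilon>(1) mx])
  qed
qed

section \<open>Propagation of compactness and tautness\<close>

text \<open>The common root of both conclusions. One compact set serves all discs, so the property
  applies to sequences (tautness) as well as to continuous families (pseudoconvexity).\<close>

definition disc_propagation :: "(complex ^ 'm::finite) set \<Rightarrow> bool" where
  "disc_propagation \<Omega> \<longleftrightarrow>
     (\<forall>L \<rho>. compact L \<and> L \<subseteq> \<Omega> \<and> \<rho> < 1 \<longrightarrow>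
       (\<exists>L'. compact L' \<and> L' \<subseteq> \<Omega> \<and>
         (\<forall>f z w. holomorphic_disc \<Omega> f \<longrightarrow> cmod z \<le> \<rho> \<longrightarrow> cmod w \<le> \<rho> \<longrightarrow> f z \<in> L \<longrightarrow> f w \<in> L')))"

text \<open>The radius \<open>r0\<close> is chosen before \<open>L\<close>: it depends on
  \<open>s\<close> alone. The compact set \<open>L'\<close> is a finite union of images of closed
  half balls, under charts centred in \<open>L\<close>.\<close>

lemma wHHR_disc_step:
  fixes \<Omega> :: "(complex ^ 'm::finite) set"
  assumes "wHHR_domain \<Omega>"
  obtains r0 where "r0 > 0"
    "\<And>L. compact L \<Longrightarrow> L \<subseteq> \<Omega> \<Longrightarrow> \<exists>L'. compact L' \<and> L' \<subseteq> \<Omega> \<and>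
       (\<forall>f z w. holomorphic_disc \<Omega> f \<longrightarrow> cmod z < 1 \<longrightarrow> cmod (w - z) < r0 * (1 - cmod z) \<longrightarrow> f z \<in> L \<longrightarrow> f w \<in> L')"
proof -
  define chart where "chart s \<zeta> \<Phi> \<phi> \<longleftrightarrow>
        holomorphic_embedding_on (ball 0 1) \<Phi> \<and> \<Phi> ` ball 0 1 \<subseteq> \<Omega> \<and>
        C2_on \<Omega> \<phi> \<and> plurisubharmonic_on \<Omega> \<phi> \<and> \<phi> ` \<Omega> \<subseteq> {0..1} \<and>
        \<Phi> 0 = \<zeta> \<and>
        (\<forall>w\<in>ball 0 1. \<forall>x. levi_form (\<phi> \<circ> \<Phi>) w x \<ge> s\<^sup>2 * (\<Sum>j\<in>UNIV. (cmod (x $ j))\<^sup>2))"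
    for s \<zeta> and \<Phi> :: "complex ^ 'm \<Rightarrow> complex ^ 'm" and \<phi>
  from assms obtain s where op: "open \<Omega>" and s: "s > 0" and ex: "\<forall>\<zeta>\<in>\<Omega>. \<exists>\<Phi> \<phi>. chart s \<zeta> \<Phi> \<phi>"
    unfolding wHHR_domain_def is_domain_def chart_def by auto
  obtain \<Phi> \<phi> where ch: "\<And>\<zeta>. \<zeta> \<in> \<Omega> \<Longrightarrow> chart s \<zeta> (\<Phi> \<zeta>) (\<phi> \<zeta>)"
    using ex by metis
  have \<Phi>: "holomorphic_embedding_on (ball 0 1) (\<Phi> \<zeta>)" "\<Phi> \<zeta> ` ball 0 1 \<subseteq> \<Omega>" "\<Phi> \<zeta> 0 = \<zeta>"
    and \<phi>: "C2_on \<Omega> (\<phi> \<zeta>)" "plurisubharmonic_on \<Omega> (\<phi> \<zeta>)" "\<phi> \<zeta> ` \<Omega> \<subseteq> {0..1}" if "\<zeta> \<in> \<Omega>" for \<zeta>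
    using ch[OF that] unfolding chart_def by blast+
  have levi: "levi_form (\<phi> \<zeta> \<circ> \<Phi> \<zeta>) w x \<ge> s\<^sup>2 * (\<Sum>j\<in>UNIV. (cmod (x $ j))\<^sup>2)"
    if "\<zeta> \<in> \<Omega>" "w \<in> ball 0 1" for \<zeta> w x
    using ch[OF that(1)] that(2) unfolding chart_def by blast
  define r0 where "r0 = exp (- (128 / s\<^sup>2 + 1))"
  have r0: "r0 > 0" by (simp add: r0_def)
  have opn: "open (\<Phi> \<zeta> ` ball 0 (1/4))" if "\<zeta> \<in> \<Omega>" for \<zeta>
  proof (rule holomorphic_embedding_inverse[OF open_ball \<Phi>(1)[OF that]])
    fix G assume "\<And>T. open T \<Longrightarrow> T \<subseteq> ball 0 1 \<Longrightarrow> open (\<Phi> \<zeta> ` T)"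
    then show ?thesis by (simp add: subset_ball)
  qed
  have sub12: "\<Phi> \<zeta> ` cball 0 (1/2) \<subseteq> \<Omega>" if "\<zeta> \<in> \<Omega>" for \<zeta>
  proof -
    have "cball 0 (1/2) \<subseteq> (ball 0 1 :: (complex^'m) set)" by auto
    then show ?thesis using \<Phi>(2)[OF that] by blast
  qed
  have comp: "compact (\<Phi> \<zeta> ` cball 0 (1/2))" if "\<zeta> \<in> \<Omega>" for \<zeta>
  proof (rule compact_continuous_image)
    have "continuous_on (ball 0 1) (\<Phi> \<zeta>)"
      using \<Phi>(1)[OF that] unfolding holomorphic_embedding_on_def homeomorphism_def by blast
    then show "continuous_on (cball 0 (1/2)) (\<Phi> \<zeta>)" by (rule continuous_on_subset) auto
  qed simp
  have step: "f w \<in> \<Phi> \<zeta> ` cball 0 (1/2)"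
    if \<zeta>: "\<zeta> \<in> \<Omega>" and f: "holomorphic_disc \<Omega> f" and z: "cmod z < 1" and w: "cmod (w - z) < r0 * (1 - cmod z)"
      and fz: "f z \<in> \<Phi> \<zeta> ` ball 0 (1/4)" for \<zeta> f z w
  proof -
    \<comment> \<open>Recentring at z; 1 - |z| is the radius of the largest disc around z inside the
      unit disc.\<close>
    define F where "F u = f (z + of_real (1 - cmod z) * u)" for u
    have inb: "z + of_real (1 - cmod z) * u \<in> ball 0 1" if "u \<in> ball 0 1" for u
    proof -
      have "cmod (z + of_real (1 - cmod z) * u) \<le> cmod z + (1 - cmod z) * cmod u"
        using z norm_triangle_ineq[of z "of_real (1 - cmod z) * u"] by (simp add: norm_mult del: of_real_diff)
      also have "\<dots> < cmod z + (1 - cmod z) * 1"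
        using that z by (intro add_strict_left_mono mult_strict_left_mono) auto
      finally show ?thesis by simp
    qed
    have "(\<lambda>u. F u $ j) holomorphic_on ball 0 1" for j
    proof -
      have "((\<lambda>z. f z $ j) \<circ> (\<lambda>u. z + of_real (1 - cmod z) * u)) holomorphic_on ball 0 1"
        using f inb unfolding holomorphic_disc_def
        by (intro holomorphic_on_compose_gen[where t="ball 0 1"] holomorphic_intros) auto
      then show ?thesis by (simp add: F_def o_def)
    qed
    then have F: "holomorphic_disc \<Omega> F"
      using f inb unfolding holomorphic_disc_def F_def by blast
    obtain w0 where w0: "w0 \<in> ball 0 (1/4)" "f z = \<Phi> \<zeta> w0" using fz by blast
    define u where "u = (w - z) / of_real (1 - cmod z)"
    have nz: "complex_of_real (1 - cmod z) \<noteq> 0" using z by simp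
    have u: "F u = f w" unfolding F_def u_def using nz by (simp del: of_real_diff)
    have "cmod u < r0"
      unfolding u_def norm_divide using w z by (simp add: field_simps del: of_real_diff)
    then have "F u \<in> \<Phi> \<zeta> ` ball w0 (1/4)"
      using w0
      by (intro disc_near_center_in_chart[OF op s \<Phi>(1,2)[OF \<zeta>] \<phi>[OF \<zeta>] levi[OF \<zeta>] F]) (auto simp: F_def r0_def)
    moreover have "ball w0 (1/4) \<subseteq> cball 0 (1/2)"
    proof
      fix x assume "x \<in> ball w0 (1/4)"
      then show "x \<in> cball 0 (1/2)" using w0(1) norm_triangle_sub[of x w0] by (simp add: dist_norm norm_minus_commute)
    qed
    ultimately show ?thesis using u by auto
  qed
  show ?thesis
  proof (rule that[OF r0])
    fix L assume L: "compact L" "L \<subseteq> \<Omega>"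
    have cov: "L \<subseteq> (\<Union>\<zeta>\<in>L. \<Phi> \<zeta> ` ball 0 (1/4))"
    proof
      fix \<zeta> assume "\<zeta> \<in> L"
      then have "\<Phi> \<zeta> 0 = \<zeta>" using \<Phi>(3) L by blast
      moreover have "\<Phi> \<zeta> 0 \<in> \<Phi> \<zeta> ` ball 0 (1/4)" by (intro imageI) simp
      ultimately have "\<zeta> \<in> \<Phi> \<zeta> ` ball 0 (1/4)" by simp
      then show "\<zeta> \<in> (\<Union>\<zeta>\<in>L. \<Phi> \<zeta> ` ball 0 (1/4))" using \<open>\<zeta> \<in> L\<close> by blast
    qed
    \<comment> \<open>Quarter balls, since the disc estimate wants \<open>norm w0 \<le> 1/4\<close>;
      the ball of radius 1/4 around w0 then lies in the half ball.\<close>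
    obtain C where C: "C \<subseteq> L" "finite C" "L \<subseteq> (\<Union>\<zeta>\<in>C. \<Phi> \<zeta> ` ball 0 (1/4))"
      by (rule compactE_image[OF L(1) _ cov]) (use opn L in auto)
    define L' where "L' = (\<Union>\<zeta>\<in>C. \<Phi> \<zeta> ` cball 0 (1/2))"
    have "compact L'" unfolding L'_def using C L comp by (intro compact_UN) auto
    moreover have "L' \<subseteq> \<Omega>" unfolding L'_def using C L sub12 by blast
    moreover have "f w \<in> L'" if "holomorphic_disc \<Omega> f" "cmod z < 1" "cmod (w - z) < r0 * (1 - cmod z)" "f z \<in> L" for f z w
    proof -
      obtain \<zeta> where \<zeta>: "\<zeta> \<in> C" "f z \<in> \<Phi> \<zeta> ` ball 0 (1/4)" using C(3) \<open>f z \<in> L\<close> by blast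
      then have "\<zeta> \<in> \<Omega>" using C L by blast
      from step[OF this that(1-3) \<zeta>(2)] show ?thesis using \<zeta>(1) by (auto simp: L'_def)
    qed
    ultimately show "\<exists>L'. compact L' \<and> L' \<subseteq> \<Omega> \<and>
       (\<forall>f z w. holomorphic_disc \<Omega> f \<longrightarrow> cmod z < 1 \<longrightarrow> cmod (w - z) < r0 * (1 - cmod z) \<longrightarrow> f z \<in> L \<longrightarrow> f w \<in> L')"
      by blast
  qed
qed

text \<open>The segment from z to w is walked in steps of length at most \<delta>. By convexity it
  stays in the disc of radius \<rho>, so the admissible step length does not degenerate, and about 2
  \<rho> / \<delta> steps suffice for all pairs.\<close>

lemma wHHR_disc_propagation:
  fixes \<Omega> :: "(complex ^ 'm::finite) set"
  assumes "wHHR_domain \<Omega>"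
  shows "disc_propagation \<Omega>"
  unfolding disc_propagation_def
proof (intro allI impI)
  fix L \<rho> assume asm: "compact L \<and> L \<subseteq> \<Omega> \<and> \<rho> < (1::real)"
  obtain r0 where r0: "r0 > 0"
    "\<And>L. compact L \<Longrightarrow> L \<subseteq> \<Omega> \<Longrightarrow> \<exists>L'. compact L' \<and> L' \<subseteq> \<Omega> \<and>
       (\<forall>f z w. holomorphic_disc \<Omega> f \<longrightarrow> cmod z < 1 \<longrightarrow> cmod (w - z) < r0 * (1 - cmod z) \<longrightarrow> f z \<in> L \<longrightarrow> f w \<in> L')"
    using wHHR_disc_step[OF assms] by blast
  \<comment> \<open>Half of the admissible length, since a step must be strictly shorter than r0 (1
    - |v|).\<close>
  define \<delta> where "\<delta> = r0 * (1 - \<rho>) / 2"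
  have \<delta>: "\<delta> > 0" "\<delta> < r0 * (1 - \<rho>)" using r0(1) asm by (auto simp: \<delta>_def)
  have chain: "\<exists>L'. compact L' \<and> L' \<subseteq> \<Omega> \<and>
      (\<forall>f z w. holomorphic_disc \<Omega> f \<longrightarrow> cmod z \<le> \<rho> \<longrightarrow> cmod w \<le> \<rho> \<longrightarrow> cmod (w - z) \<le> real n * \<delta> \<longrightarrow> f z \<in> L \<longrightarrow> f w \<in> L')" for n
  proof (induction n)
    case 0
    then show ?case using asm by (intro exI[of _ L]) auto
  next
    case (Suc n)
    then obtain L1 where L1: "compact L1" "L1 \<subseteq> \<Omega>"
      "\<And>f z w. holomorphic_disc \<Omega> f \<Longrightarrow> cmod z \<le> \<rho> \<Longrightarrow> cmod w \<le> \<rho> \<Longrightarrow> cmod (w - z) \<le> real n * \<delta> \<Longrightarrow> f z \<in> L \<Longrightarrow> f w \<in> L1"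
      by blast
    obtain L2 where L2: "compact L2" "L2 \<subseteq> \<Omega>"
      "\<And>f z w. holomorphic_disc \<Omega> f \<Longrightarrow> cmod z < 1 \<Longrightarrow> cmod (w - z) < r0 * (1 - cmod z) \<Longrightarrow> f z \<in> L1 \<Longrightarrow> f w \<in> L2"
      using r0(2)[OF L1(1,2)] by blast
    have "f w \<in> L2" if f: "holomorphic_disc \<Omega> f" and zw: "cmod z \<le> \<rho>" "cmod w \<le> \<rho>" "cmod (w - z) \<le> real (Suc n) * \<delta>" and fz: "f z \<in> L" for f z w
    proof -
      \<comment> \<open>The last of n + 1 equal pieces is split off: the first n cover at most n
        \<delta>, the last at most \<delta>.\<close>
      define t where "t = real n / real (Suc n)"
      have t: "0 \<le> t" "t \<le> 1" "1 - t = 1 / real (Suc n)" by (auto simp: t_def field_simps)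
      define v where "v = (1 - t) *\<^sub>R z + t *\<^sub>R w"
      have "v \<in> cball 0 \<rho>"
        using convexD[OF convex_cball, of z 0 \<rho> w "1 - t" t] zw t by (simp add: v_def)
      then have v: "cmod v \<le> \<rho>" by simp
      have "v - z = t *\<^sub>R (w - z)" by (simp add: v_def algebra_simps)
      then have "cmod (v - z) = t * cmod (w - z)" using t by simp
      also have "\<dots> \<le> t * (real (Suc n) * \<delta>)" using t zw by (intro mult_left_mono) auto
      also have "\<dots> = real n * \<delta>" by (simp add: t_def)
      finally have "f v \<in> L1" by (rule L1(3)[OF f zw(1) v _ fz])
      have "w - v = (1 - t) *\<^sub>R (w - z)" by (simp add: v_def algebra_simps)
      then have "cmod (w - v) = (1 - t) * cmod (w - z)" using t by simp
      also have "\<dots> \<le> (1 - t) * (real (Suc n) * \<delta>)" using t zw by (intro mult_left_mono) auto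
      also have "\<dots> = \<delta>" unfolding t(3) by simp
      also have "\<dots> < r0 * (1 - \<rho>)" by (rule \<delta>)
      also have "\<dots> \<le> r0 * (1 - cmod v)" using v r0 by (intro mult_left_mono) auto
      finally show ?thesis using v asm by (intro L2(3)[OF f _ _ \<open>f v \<in> L1\<close>]) auto
    qed
    then show ?case using L2(1,2) by blast
  qed
  obtain n where n: "2 * \<rho> / \<delta> \<le> real n" using real_arch_simple by blast
  have dist: "cmod (w - z) \<le> real n * \<delta>" if "cmod z \<le> \<rho>" "cmod w \<le> \<rho>" for z w
  proof -
    have "cmod (w - z) \<le> 2 * \<rho>" using norm_triangle_ineq4[of w z] that by linarith
    also have "\<dots> \<le> real n * \<delta>" using n \<delta> by (simp add: field_simps)
    finally show ?thesis .
  qed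
  obtain L' where "compact L'" "L' \<subseteq> \<Omega>"
    "\<And>f z w. holomorphic_disc \<Omega> f \<Longrightarrow> cmod z \<le> \<rho> \<Longrightarrow> cmod w \<le> \<rho> \<Longrightarrow> cmod (w - z) \<le> real n * \<delta> \<Longrightarrow> f z \<in> L \<Longrightarrow> f w \<in> L'"
    using chain[of n] by blast
  then show "\<exists>L'. compact L' \<and> L' \<subseteq> \<Omega> \<and>
         (\<forall>f z w. holomorphic_disc \<Omega> f \<longrightarrow> cmod z \<le> \<rho> \<longrightarrow> cmod w \<le> \<rho> \<longrightarrow> f z \<in> L \<longrightarrow> f w \<in> L')"
    using dist by (intro exI[of _ L']) blast
qed

section \<open>Normal families of vector-valued discs and tautness\<close>

text \<open>The scalar theorem is applied to one coordinate after the other; earlier limits survive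
  the passage to a further subsequence. The set \<open>J\<close> carries the induction.\<close>

lemma Montel_finite_family:
  fixes f :: "nat \<Rightarrow> complex \<Rightarrow> complex ^ 'm::finite"
  assumes "open S" and hol: "\<And>n j. (\<lambda>z. f n z $ j) holomorphic_on S"
    and bd: "\<And>K. compact K \<Longrightarrow> K \<subseteq> S \<Longrightarrow> \<exists>B. \<forall>n. \<forall>z\<in>K. norm (f n z) \<le> B"
  shows "\<exists>r g. strict_mono (r :: nat \<Rightarrow> nat) \<and> (\<forall>j\<in>J. g j holomorphic_on S \<and>
      (\<forall>K. compact K \<and> K \<subseteq> S \<longrightarrow> uniform_limit K (\<lambda>n z. f (r n) z $ j) (g j) sequentially))"
  (is "\<exists>r g. ?P J r g")
proof -
  have "finite J" by simp
  then show ?thesis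
  proof (induction J)
    case empty
    then show ?case by (intro exI[of _ id]) (auto simp: strict_mono_def)
  next
    case (insert i J)
    then obtain r g where rg: "?P J r g" by blast
    have bdd: "\<exists>B. \<forall>h\<in>range (\<lambda>n z. f (r n) z $ i). \<forall>z\<in>K. cmod (h z) \<le> B" if K: "compact K" "K \<subseteq> S" for K
    proof -
      obtain B where B: "\<And>n z. z \<in> K \<Longrightarrow> norm (f n z) \<le> B" using bd[OF K] by blast
      have "cmod (f (r n) z $ i) \<le> B" if "z \<in> K" for n z
        using B[OF that, of "r n"] Finite_Cartesian_Product.norm_nth_le[of "f (r n) z" i] by linarith
      then show ?thesis by blast
    qed
    have holr: "h holomorphic_on S" if "h \<in> range (\<lambda>n z. f (r n) z $ i)" for h
      using that hol by auto
    obtain h r' where h: "h holomorphic_on S" "strict_mono (r' :: nat \<Rightarrow> nat)"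
      "\<And>x. x \<in> S \<Longrightarrow> ((\<lambda>n. f (r (r' n)) x $ i) \<longlongrightarrow> h x) sequentially"
      "\<And>K. compact K \<Longrightarrow> K \<subseteq> S \<Longrightarrow> uniform_limit K ((\<lambda>n z. f (r n) z $ i) \<circ> r') h sequentially"
    proof (rule Montel[OF assms(1) holr bdd subset_refl])
      fix h r'
      assume "h holomorphic_on S" "strict_mono (r' :: nat \<Rightarrow> nat)"
        "\<And>x. x \<in> S \<Longrightarrow> ((\<lambda>n. f (r (r' n)) x $ i) \<longlongrightarrow> h x) sequentially"
        "\<And>K. compact K \<Longrightarrow> K \<subseteq> S \<Longrightarrow> uniform_limit K ((\<lambda>n z. f (r n) z $ i) \<circ> r') h sequentially"
      then show thesis by (rule that)
    qed
    have sm: "strict_mono (r \<circ> r')" using rg h(2) by (auto intro: strict_mono_o)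
    have "uniform_limit K (\<lambda>n z. f ((r \<circ> r') n) z $ j) (if j = i then h else g j) sequentially"
      if "j \<in> insert i J" "compact K" "K \<subseteq> S" for j K
    proof (cases "j = i")
      case True
      then show ?thesis using h(4)[OF that(2,3)] by (simp add: o_def)
    next
      case False
      then have "uniform_limit K (\<lambda>n z. f (r n) z $ j) (g j) sequentially" using rg that by blast
      from filterlim_compose[OF this filterlim_subseq[OF h(2)]]
      show ?thesis using False by (simp add: o_def)
    qed
    moreover have "(if j = i then h else g j) holomorphic_on S" if "j \<in> insert i J" for j
      using rg h(1) that by auto
    ultimately have "?P (insert i J) (r \<circ> r') (\<lambda>j. if j = i then h else g j)"
      using sm by (intro conjI ballI allI impI) blast+
    then have "\<exists>g. ?P (insert i J) (r \<circ> r') g" by (rule exI[of _ "\<lambda>j. if j = i then h else g j"])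
    then show ?case by (rule exI[of _ "r \<circ> r'"])
  qed
qed

text \<open>Failure of compact divergence provides infinitely many discs that meet one compact
  \<open>L\<close> over one compact \<open>K\<close>; propagation confines them, on each smaller
  disc, to a compact part of \<Omega>. This gives the bounds for Montel and keeps the limit away
  from the boundary.\<close>

lemma disc_propagation_imp_taut:
  fixes \<Omega> :: "(complex ^ 'm::finite) set"
  assumes pr: "disc_propagation \<Omega>"
  shows "taut \<Omega>"
  unfolding taut_def
proof (intro allI impI)
  fix f :: "nat \<Rightarrow> complex \<Rightarrow> complex ^ 'm" assume f: "\<forall>n. holomorphic_disc \<Omega> (f n)"
  show "\<exists>r :: nat \<Rightarrow> nat. strict_mono r \<and>
           ((\<exists>g. holomorphic_disc \<Omega> g \<and> disc_locally_uniform_limit (f \<circ> r) g) \<or>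
            disc_compactly_divergent \<Omega> (f \<circ> r))"
  proof (cases "disc_compactly_divergent \<Omega> f")
    case True
    then show ?thesis by (intro exI[of _ id]) (auto simp: strict_mono_def)
  next
    case False
    then obtain K L where KL: "compact K" "K \<subseteq> ball 0 1" "compact L" "L \<subseteq> \<Omega>"
      and inf: "\<exists>\<^sub>F n in sequentially. f n ` K \<inter> L \<noteq> {}"
      unfolding disc_compactly_divergent_def frequently_def by auto
    then have "infinite {n. f n ` K \<inter> L \<noteq> {}}" by (simp add: frequently_cofinite flip: cofinite_eq_sequentially)
    then obtain r where r: "strict_mono (r :: nat \<Rightarrow> nat)" "\<And>n. f (r n) ` K \<inter> L \<noteq> {}"
      using infinite_enumerate[of "{n. f n ` K \<inter> L \<noteq> {}}"] by blast
    have disc: "holomorphic_disc \<Omega> (f (r n))" for n using f by blast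
    have cmp: "\<exists>\<rho><1. K \<subseteq> cball 0 \<rho>" if cK: "compact K" "K \<subseteq> ball 0 1" for K :: "complex set"
    proof (cases "K = {}")
      case False
      obtain z where "z \<in> K" "\<forall>w\<in>K. cmod w \<le> cmod z"
        using continuous_attains_sup[OF cK(1) False, of cmod] by (auto intro: continuous_intros)
      then show ?thesis using cK(2) by (intro exI[of _ "cmod z"]) auto
    qed (auto intro: exI[of _ 0])
    obtain \<rho>0 where \<rho>0: "\<rho>0 < 1" "\<And>z. z \<in> K \<Longrightarrow> cmod z \<le> \<rho>0"
      using cmp[OF KL(1,2)] by (auto simp: subset_iff)
    have loc: "\<exists>L'. compact L' \<and> L' \<subseteq> \<Omega> \<and> (\<forall>n. \<forall>w. cmod w \<le> \<rho> \<longrightarrow> f (r n) w \<in> L')" if "\<rho> < 1" for \<rho>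
    proof -
      \<comment> \<open>The radius must also cover \<open>K\<close>, where the discs are known to
        meet \<open>L\<close>.\<close>
      have "max \<rho> \<rho>0 < 1" using that \<rho>0 by simp
      then obtain L' where L': "compact L'" "L' \<subseteq> \<Omega>"
         "\<And>f z w. holomorphic_disc \<Omega> f \<Longrightarrow> cmod z \<le> max \<rho> \<rho>0 \<Longrightarrow> cmod w \<le> max \<rho> \<rho>0 \<Longrightarrow> f z \<in> L \<Longrightarrow> f w \<in> L'"
        using pr[unfolded disc_propagation_def, rule_format, of L "max \<rho> \<rho>0"] KL by meson
      have "f (r n) w \<in> L'" if "cmod w \<le> \<rho>" for n w
      proof -
        obtain z where "z \<in> K" "f (r n) z \<in> L" using r(2)[of n] by blast
        then show ?thesis using \<rho>0(2)[of z] that by (intro L'(3)[OF disc, of z]) auto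
      qed
      then show ?thesis using L' by blast
    qed
    obtain r' g where r': "strict_mono (r' :: nat \<Rightarrow> nat)"
      and g: "\<And>j. g j holomorphic_on ball 0 1"
        "\<And>j K. compact K \<Longrightarrow> K \<subseteq> ball 0 1 \<Longrightarrow> uniform_limit K (\<lambda>n z. f (r (r' n)) z $ j) (g j) sequentially"
    proof -
      have "\<exists>B. \<forall>n. \<forall>z\<in>K. norm (f (r n) z) \<le> B" if K: "compact K" "K \<subseteq> ball 0 1" for K
      proof -
        obtain \<rho> where \<rho>: "\<rho> < 1" "K \<subseteq> cball 0 \<rho>" using cmp[OF K] by blast
        obtain L' where L': "compact L'" "\<And>n w. cmod w \<le> \<rho> \<Longrightarrow> f (r n) w \<in> L'" using loc[OF \<rho>(1)] by blast
        then obtain B where "\<And>y. y \<in> L' \<Longrightarrow> norm y \<le> B" using compact_imp_bounded bounded_iff by metis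
        then show ?thesis using L'(2) \<rho>(2) by (intro exI[of _ B]) (auto simp: subset_iff)
      qed
      then have "\<exists>r' g. strict_mono (r' :: nat \<Rightarrow> nat) \<and> (\<forall>j\<in>UNIV. g j holomorphic_on ball 0 1 \<and>
          (\<forall>K. compact K \<and> K \<subseteq> ball 0 1 \<longrightarrow> uniform_limit K (\<lambda>n z. f (r (r' n)) z $ j) (g j) sequentially))"
        using disc unfolding holomorphic_disc_def by (intro Montel_finite_family) auto
      then obtain r' g where "strict_mono (r' :: nat \<Rightarrow> nat)" "\<And>j. g j holomorphic_on ball 0 1"
        "\<And>j K. compact K \<Longrightarrow> K \<subseteq> ball 0 1 \<Longrightarrow> uniform_limit K (\<lambda>n z. f (r (r' n)) z $ j) (g j) sequentially"
        by blast
      then show ?thesis by (rule that)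
    qed
    define G where "G z = (\<chi> j. g j z)" for z
    have unif: "uniform_limit K (f \<circ> (r \<circ> r')) G sequentially" if K: "compact K" "K \<subseteq> ball 0 1" for K
    proof (rule uniform_limitI)
      fix e :: real assume "e > 0"
      define e' where "e' = e / real CARD('m)"
      have e': "e' > 0" using \<open>e > 0\<close> by (simp add: e'_def)
      have "\<forall>\<^sub>F n in sequentially. \<forall>j\<in>UNIV. \<forall>z\<in>K. dist (f (r (r' n)) z $ j) (g j z) < e'"
        using uniform_limitD[OF g(2)[OF K] e'] by (intro eventually_ball_finite) auto
      then show "\<forall>\<^sub>F n in sequentially. \<forall>z\<in>K. dist ((f \<circ> (r \<circ> r')) n z) (G z) < e"
      proof eventually_elim
        case (elim n)
        show ?case
        proof
          fix z assume z: "z \<in> K"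
          have "norm (f (r (r' n)) z - G z) \<le> (\<Sum>j\<in>UNIV. norm ((f (r (r' n)) z - G z) $ j))"
            unfolding norm_vec_def by (rule L2_set_le_sum) simp
          also have "\<dots> < (\<Sum>j\<in>(UNIV :: 'm set). e')"
            using elim z by (intro sum_strict_mono) (auto simp: G_def dist_norm)
          also have "\<dots> = e" by (simp add: e'_def)
          finally show "dist ((f \<circ> (r \<circ> r')) n z) (G z) < e" by (simp add: dist_norm)
        qed
      qed
    qed
    have "G z \<in> \<Omega>" if "z \<in> ball 0 1" for z
    proof -
      obtain L' where L': "compact L'" "L' \<subseteq> \<Omega>" "\<And>n w. cmod w \<le> cmod z \<Longrightarrow> f (r n) w \<in> L'" using loc[of "cmod z"] \<open>z \<in> ball 0 1\<close> by auto
      have lim: "(\<lambda>n. (f \<circ> (r \<circ> r')) n z) \<longlonglongrightarrow> G z"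
        using unif[of "{z}"] that by (intro tendsto_uniform_limitI[where S="{z}"]) auto
      have "(f \<circ> (r \<circ> r')) n z \<in> L'" for n by (simp add: L'(3))
      then have "G z \<in> L'"
        by (rule closed_sequentially[OF compact_imp_closed[OF L'(1)] _ lim])
      then show ?thesis using L'(2) by blast
    qed
    then have "holomorphic_disc \<Omega> G"
      using g(1) unfolding holomorphic_disc_def G_def by auto
    moreover have "disc_locally_uniform_limit (f \<circ> (r \<circ> r')) G"
      using unif unfolding disc_locally_uniform_limit_def by blast
    moreover have "strict_mono (r \<circ> r')" using r(1) r' by (rule strict_mono_o)
    ultimately show ?thesis by blast
  qed
qed

section \<open>Pseudoconvexity\<close>

text \<open>Since cnj \<zeta> = 1/\<zeta> on the circle, the product is a Laurent polynomial, and
  conjugation moves negative powers to positive ones without changing the real part. This closes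
  real parts of polynomials under multiplication.\<close>

lemma Re_poly_mult_cnj_on_circle:
  fixes p q :: "complex poly"
  shows "\<exists>r. \<forall>\<zeta>. cmod \<zeta> = 1 \<longrightarrow> Re (poly p \<zeta> * cnj (poly q \<zeta>)) = Re (poly r \<zeta>)"
proof (induction q arbitrary: p)
  case 0
  then show ?case by (intro exI[of _ 0]) simp
next
  case (pCons a q)
  obtain b p' where p: "p = pCons b p'" by (metis pCons_cases)
  obtain r where r: "\<And>\<zeta>. cmod \<zeta> = 1 \<Longrightarrow> Re (poly p' \<zeta> * cnj (poly q \<zeta>)) = Re (poly r \<zeta>)"
    using pCons.IH by blast
  have "Re (poly p \<zeta> * cnj (poly (pCons a q) \<zeta>)) = Re (poly (smult (cnj a) p + smult (cnj b) (pCons 0 q) + r) \<zeta>)"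
    if \<zeta>: "cmod \<zeta> = 1" for \<zeta>
  proof -
    have 1: "\<zeta> * cnj \<zeta> = 1" using \<zeta> by (simp flip: complex_norm_square)
    have "poly p \<zeta> * cnj (poly (pCons a q) \<zeta>) = cnj a * poly p \<zeta> + b * cnj (\<zeta> * poly q \<zeta>) + (\<zeta> * cnj \<zeta>) * (poly p' \<zeta> * cnj (poly q \<zeta>))"
      by (simp add: p algebra_simps)
    then have "Re (poly p \<zeta> * cnj (poly (pCons a q) \<zeta>)) = Re (cnj a * poly p \<zeta>) + Re (b * cnj (\<zeta> * poly q \<zeta>)) + Re (poly p' \<zeta> * cnj (poly q \<zeta>))"
      by (simp only: 1 plus_complex.sel mult_1_left)
    moreover have "Re (b * cnj (\<zeta> * poly q \<zeta>)) = Re (cnj b * (\<zeta> * poly q \<zeta>))"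
      by (simp add: algebra_simps)
    moreover have "poly (smult (cnj a) p + smult (cnj b) (pCons 0 q) + r) \<zeta> = cnj a * poly p \<zeta> + cnj b * (\<zeta> * poly q \<zeta>) + poly r \<zeta>"
      by simp
    ultimately show ?thesis by (simp only: r[OF \<zeta>] plus_complex.sel)
  qed
  then show ?case by blast
qed

text \<open>Stone-Weierstrass for the algebra of real parts of polynomials. Polynomials are wanted
  because exp (- p) extends holomorphically into the disc and Re p has an exact circle mean.\<close>

lemma approx_on_circle_by_Re_poly:
  fixes h :: "complex \<Rightarrow> real"
  assumes "continuous_on (sphere 0 1) h" "e > 0"
  obtains p :: "complex poly" where "\<And>\<zeta>. cmod \<zeta> = 1 \<Longrightarrow> \<bar>h \<zeta> - Re (poly p \<zeta>)\<bar> < e"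
proof -
  define R where "R = {f :: complex \<Rightarrow> real. \<exists>p. \<forall>\<zeta>. cmod \<zeta> = 1 \<longrightarrow> f \<zeta> = Re (poly p \<zeta>)}"
  interpret function_ring_on R "sphere 0 1 :: complex set"
  proof
    fix f assume "f \<in> R"
    then obtain p where p: "\<And>\<zeta>. cmod \<zeta> = 1 \<Longrightarrow> f \<zeta> = Re (poly p \<zeta>)" unfolding R_def by blast
    have "continuous_on (sphere 0 1) (\<lambda>\<zeta>. Re (poly p \<zeta>))" by (intro continuous_intros)
    then show "continuous_on (sphere 0 1) f" by (rule continuous_on_eq) (simp add: p)
  next
    fix f g assume fg: "f \<in> R" "g \<in> R"
    then obtain p q where p: "\<And>\<zeta>. cmod \<zeta> = 1 \<Longrightarrow> f \<zeta> = Re (poly p \<zeta>)" "\<And>\<zeta>. cmod \<zeta> = 1 \<Longrightarrow> g \<zeta> = Re (poly q \<zeta>)"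
      unfolding R_def by blast
    then show "(\<lambda>x. f x + g x) \<in> R" unfolding R_def by (auto intro!: exI[of _ "p + q"])
    obtain r where r: "\<And>\<zeta>. cmod \<zeta> = 1 \<Longrightarrow> Re (poly p \<zeta> * cnj (poly q \<zeta>)) = Re (poly r \<zeta>)"
      using Re_poly_mult_cnj_on_circle[of p q] by blast
    have "f \<zeta> * g \<zeta> = Re (poly (smult (1/2) (p * q + r)) \<zeta>)" if "cmod \<zeta> = 1" for \<zeta>
    proof -
      have "Re x * Re y = (Re (x * y) + Re (x * cnj y)) / 2" for x y by simp
      then have "f \<zeta> * g \<zeta> = (Re (poly p \<zeta> * poly q \<zeta>) + Re (poly r \<zeta>)) / 2"
        using p[OF that] r[OF that] by presburger
      moreover have "poly (smult (1/2) (p * q + r)) \<zeta> = (poly p \<zeta> * poly q \<zeta> + poly r \<zeta>) / 2" by simp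
      ultimately show ?thesis by (simp only: Re_divide_numeral plus_complex.sel)
    qed
    then show "(\<lambda>x. f x * g x) \<in> R" unfolding R_def by blast
  next
    fix c :: real
    show "(\<lambda>_. c) \<in> R" unfolding R_def by (auto intro!: exI[of _ "[:of_real c:]"])
  next
    fix x y :: complex assume "x \<noteq> y"
    have "Re \<in> R" unfolding R_def by (auto intro!: exI[of _ "[:0, 1:]"])
    moreover have "Im \<in> R" unfolding R_def by (auto intro!: exI[of _ "[:0, - \<i>:]"])
    ultimately show "\<exists>f\<in>R. f x \<noteq> f y" using \<open>x \<noteq> y\<close> by (metis complex_eqI)
  qed auto
  obtain g where "g \<in> R" "\<And>x. x \<in> sphere 0 1 \<Longrightarrow> \<bar>h x - g x\<bar> < e"
    using Stone_Weierstrass_basic[OF assms] by blast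
  then show ?thesis using that unfolding R_def by fastforce
qed

text \<open>Mean value property, from Cauchy's formula for the derivative of \<zeta> p(\<zeta>) at
  0.\<close>

lemma has_integral_poly_cis:
  fixes p :: "complex poly"
  shows "((\<lambda>t. Re (poly p (cis t))) has_integral 2 * pi * Re (poly p 0)) {0..2*pi}"
proof -
  define h where "h \<zeta> = \<zeta> * poly p \<zeta>" for \<zeta>
  have "h holomorphic_on ball 0 2" unfolding h_def by (intro holomorphic_intros)
  from Cauchy_derivative_circle_integral[OF this, of 1]
  have "deriv h 0 = of_real (1 / (2 * pi)) * integral {0..2*pi} (\<lambda>t. h (cis t) * cis (- t))" by simp
  moreover have "(h has_field_derivative poly p 0) (at 0)"
    unfolding h_def by (auto intro!: derivative_eq_intros poly_DERIV)
  then have "deriv h 0 = poly p 0" by (rule DERIV_imp_deriv)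
  moreover have "h (cis t) * cis (- t) = poly p (cis t)" for t
    by (simp add: h_def cis_mult mult.commute mult.left_commute)
  ultimately have "integral {0..2*pi} (\<lambda>t. poly p (cis t)) = 2 * pi * poly p 0"
    by (simp add: field_simps)
  moreover have "(\<lambda>t. poly p (cis t)) integrable_on {0..2*pi}"
    by (intro integrable_continuous_real continuous_intros)
  ultimately have "((\<lambda>t. poly p (cis t)) has_integral 2 * pi * poly p 0) {0..2*pi}"
    by (metis integrable_integral)
  from has_integral_linear[OF this bounded_linear_Re] show ?thesis by (simp add: o_def)
qed

section \<open>The distance to the boundary and the continuity principle\<close>

lemma mem_if_dist_less_infdist_Compl: "dist x y < infdist x (- S) \<Longrightarrow> y \<in> S"
  by (metis ComplI infdist_le not_less)

text \<open>\<open>infdist\<close> to the empty set is 0 by convention, hence the assumption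
  \<open>S \<noteq> UNIV\<close>.\<close>

lemma le_infdist_Compl:
  fixes S :: "'a::metric_space set"
  assumes "S \<noteq> UNIV" "ball x d \<subseteq> S"
  shows "d \<le> infdist x (- S)"
proof -
  have "- S \<noteq> {}" using assms by auto
  then show ?thesis unfolding infdist_notempty[OF \<open>- S \<noteq> {}\<close>]
    using assms(2) by (intro cINF_greatest) (auto simp: subset_iff not_less[symmetric])
qed

text \<open>The continuity principle, for the discs that fill the balls of radius \<open>exp (- Re p)\<close> around
  the points of a given affine disc.\<close>

lemma disc_propagation_continuity_principle:
  fixes \<Omega> :: "(complex ^ 'm::finite) set"
  assumes "open \<Omega>" and pr: "disc_propagation \<Omega>"
    and disc: "\<And>\<zeta>. cmod \<zeta> \<le> 1 \<Longrightarrow> a + \<zeta> *s b \<in> \<Omega>"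
    and bdry: "\<And>\<zeta> t. cmod \<zeta> = 1 \<Longrightarrow> 0 \<le> t \<Longrightarrow> t \<le> 1 \<Longrightarrow> a + \<zeta> *s b + (of_real t * exp (- poly p \<zeta>)) *s v \<in> \<Omega>"
  shows "a + exp (- poly p 0) *s v \<in> \<Omega>"
proof -
  \<comment> \<open>\<open>t\<close> scales the displacement along \<open>v\<close>, from the given
    affine disc at t = 0 to the disc through the target point at t = 1.\<close>
  define D where "D t \<zeta> = a + \<zeta> *s b + (of_real t * exp (- poly p \<zeta>)) *s v" for t :: real and \<zeta>
  have D_eq: "D t \<zeta> = (\<chi> j. a $ j + \<zeta> * b $ j + of_real t * exp (- poly p \<zeta>) * v $ j)" for t \<zeta>
    by (simp add: D_def vec_eq_iff)
  have contD: "continuous_on UNIV (\<lambda>x. D (fst x) (snd x))"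
    unfolding D_eq by (intro continuous_intros)
  define U where "U = (\<lambda>x. D (fst x) (snd x)) -` \<Omega>"
  have Uop: "open U" unfolding U_def using contD \<open>open \<Omega>\<close> by (simp add: continuous_on_open_vimage)
  have "{0..1} \<times> sphere 0 1 \<subseteq> U" unfolding U_def D_def using bdry by auto
  \<comment> \<open>Propagation speaks of interior points, so the closed disc |\<zeta>| \<le> 1 must
    sit inside a larger one; compactness of the boundary circles gives a margin \<eta> uniform in
    t.\<close>
  then obtain \<eta> where \<eta>: "\<eta> > 0" "(\<Union>x\<in>{0..1} \<times> sphere 0 1. ball x \<eta>) \<subseteq> U"
    using compact_subset_open_imp_ball_epsilon_subset[of "{0..1} \<times> sphere 0 1" U] Uop by (auto simp: compact_Times)
  have ann: "D t \<zeta> \<in> \<Omega>" if t: "t \<in> {0..1}" and \<zeta>: "1 \<le> cmod \<zeta>" "cmod \<zeta> < 1 + \<eta>" for t \<zeta>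
  proof -
    have "dist (t, \<zeta> / of_real (cmod \<zeta>)) (t, \<zeta>) = cmod (\<zeta> / of_real (cmod \<zeta>) - \<zeta>)"
      by (simp add: dist_Pair_Pair dist_norm)
    also have "\<zeta> / of_real (cmod \<zeta>) - \<zeta> = of_real (1 - cmod \<zeta>) * (\<zeta> / of_real (cmod \<zeta>))"
    proof -
      have "complex_of_real (cmod \<zeta>) \<noteq> 0" using \<zeta> by auto
      then show ?thesis by (simp add: field_simps)
    qed
    also have "cmod \<dots> = cmod \<zeta> - 1"
    proof -
      have "\<zeta> \<noteq> 0" using \<zeta> by auto
      then have "cmod (\<zeta> / of_real (cmod \<zeta>)) = 1" by (simp add: norm_divide)
      moreover have "cmod (of_real (1 - cmod \<zeta>)) = cmod \<zeta> - 1" using \<zeta> by (simp only: norm_of_real)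
      ultimately show ?thesis by (simp only: norm_mult mult_1_right)
    qed
    finally have "(t, \<zeta>) \<in> ball (t, \<zeta> / of_real (cmod \<zeta>)) \<eta>" using \<zeta> by simp
    moreover have "(t, \<zeta> / of_real (cmod \<zeta>)) \<in> {0..1} \<times> sphere 0 1"
    proof -
      have "\<zeta> \<noteq> 0" using \<zeta> by auto
      then show ?thesis using t by (simp add: norm_divide)
    qed
    ultimately have "(t, \<zeta>) \<in> U" using \<eta>(2) by blast
    then show ?thesis by (simp add: U_def)
  qed
  define R where "R = 1 + \<eta>"
  have R: "R > 1" using \<eta> by (simp add: R_def)
  define T where "T = {t \<in> {0..1}. \<forall>\<zeta>. cmod \<zeta> \<le> 1 \<longrightarrow> D t \<zeta> \<in> \<Omega>}"
  \<comment> \<open>One boundary point of each disc; together they form a compact set that every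
    disc of the family meets.\<close>
  define L where "L = (\<lambda>t. D t 1) ` {0..1}"
  have contD1: "continuous_on UNIV (\<lambda>t. D t \<zeta>)" for \<zeta>
    unfolding D_eq by (intro continuous_intros)
  have "compact L" unfolding L_def
    by (intro compact_continuous_image continuous_on_subset[OF contD1]) auto
  moreover have "L \<subseteq> \<Omega>" unfolding L_def D_def using bdry[of 1] by auto
  moreover have "1 / R < 1" using R by simp
  ultimately obtain L' where L': "compact L'" "L' \<subseteq> \<Omega>"
    "\<And>f z w. holomorphic_disc \<Omega> f \<Longrightarrow> cmod z \<le> 1 / R \<Longrightarrow> cmod w \<le> 1 / R \<Longrightarrow> f z \<in> L \<Longrightarrow> f w \<in> L'"
    using pr[unfolded disc_propagation_def, rule_format, of L "1 / R"] by meson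
  have TL: "D t \<zeta> \<in> L'" if t: "t \<in> T" and \<zeta>: "cmod \<zeta> \<le> 1" for t \<zeta>
  proof -
    have "holomorphic_disc \<Omega> (\<lambda>z. D t (of_real R * z))"
      unfolding holomorphic_disc_def
    proof
      show "\<forall>j. (\<lambda>z. D t (of_real R * z) $ j) holomorphic_on ball 0 1"
        unfolding D_eq by (auto intro!: holomorphic_intros)
      show "(\<lambda>z. D t (of_real R * z)) ` ball 0 1 \<subseteq> \<Omega>"
      proof (rule image_subsetI)
        fix z :: complex assume "z \<in> ball 0 1"
        then have "R * cmod z < R * 1" using R by (intro mult_strict_left_mono) auto
        moreover have "cmod (of_real R * z) = R * cmod z" using R by (simp add: norm_mult)
        ultimately have "cmod (of_real R * z) < 1 + \<eta>" by (simp only: R_def mult_1_right)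
        then show "D t (of_real R * z) \<in> \<Omega>"
          using t ann[of t "of_real R * z"] unfolding T_def by (cases "cmod (of_real R * z) \<le> 1") auto
      qed
    qed
    from L'(3)[OF this, of "1 / of_real R" "\<zeta> / of_real R"] show ?thesis
      using R \<zeta> t by (auto simp: norm_divide divide_right_mono L_def T_def)
  qed
  \<comment> \<open>By \<open>TL\<close> membership in the open set \<Omega> may be replaced by
    membership in the compact set \<open>L'\<close>, a closed condition.\<close>
  have "closedin (top_of_set {0..1}) T"
  proof -
    have "T = {0..1} \<inter> (\<Inter>\<zeta>\<in>cball 0 1. (\<lambda>t. D t \<zeta>) -` L')"
      using TL L'(2) by (auto simp: T_def)
    moreover have "closed (\<Inter>\<zeta>\<in>cball 0 1. (\<lambda>t. D t \<zeta>) -` L')"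
      using continuous_closed_vimage[OF compact_imp_closed[OF L'(1)]] contD1
      by (intro closed_INT ballI) (auto simp: continuous_on_eq_continuous_at)
    ultimately show ?thesis by (simp add: closedin_closed_Int)
  qed
  moreover have "openin (top_of_set {0..1}) T"
  proof -
    have "\<exists>e>0. \<forall>t'\<in>{0..1}. dist t' t < e \<longrightarrow> t' \<in> T" if "t \<in> T" for t
    proof -
      have sub: "{t} \<times> cball 0 1 \<subseteq> U" using that unfolding T_def U_def by auto
      obtain e where e: "e > 0" "(\<Union>x\<in>{t} \<times> cball 0 1. ball x e) \<subseteq> U"
        using compact_subset_open_imp_ball_epsilon_subset[OF _ Uop sub] by (auto simp: compact_Times)
      have "t' \<in> T" if t': "t' \<in> {0..1}" "dist t' t < e" for t'
      proof -
        have "D t' \<zeta> \<in> \<Omega>" if "cmod \<zeta> \<le> 1" for \<zeta>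
        proof -
          have "(t', \<zeta>) \<in> ball (t, \<zeta>) e" using t' by (simp add: dist_Pair_Pair dist_commute)
          then have "(t', \<zeta>) \<in> U" using e(2) that by force
          then show ?thesis by (simp add: U_def)
        qed
        then show ?thesis using t' by (simp add: T_def)
      qed
      then show ?thesis using e(1) by blast
    qed
    then show ?thesis unfolding openin_euclidean_subtopology_iff by (auto simp: T_def)
  qed
  moreover have "0 \<in> T" using disc by (simp add: T_def D_def)
  moreover have "connected {0..1::real}" by simp
  ultimately have "T = {0..1}" unfolding connected_clopen by blast
  then have "1 \<in> T" by simp
  then have "D 1 0 \<in> \<Omega>" by (simp add: T_def)
  then show ?thesis by (simp add: D_def)
qed

text \<open>If exp (- Re p) stays below the boundary distance on the circle, the continuity
  principle carries the bound to the centre. There Re p(0) is the circle mean of Re p, so letting Re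
  p approach \<open>h\<close> from above gives the inequality.\<close>

lemma neg_ln_infdist_submean:
  fixes \<Omega> :: "(complex ^ 'm::finite) set"
  assumes "open \<Omega>" and pr: "disc_propagation \<Omega>" and "\<Omega> \<noteq> UNIV"
    and disc: "\<And>\<zeta>. cmod \<zeta> \<le> 1 \<Longrightarrow> a + \<zeta> *s b \<in> \<Omega>"
  defines "h \<equiv> \<lambda>\<zeta>. - ln (infdist (a + \<zeta> *s b) (- \<Omega>))"
  shows "h 0 \<le> 1 / (2*pi) * integral {0..2*pi} (\<lambda>t. h (cis t))"
proof -
  have pos: "infdist (a + \<zeta> *s b) (- \<Omega>) > 0" if "cmod \<zeta> \<le> 1" for \<zeta>
    using disc[OF that] assms(1,3) by (intro infdist_pos_not_in_closed) auto
  have caff: "continuous_on S (\<lambda>\<zeta>. a + \<zeta> *s b)" for S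
  proof -
    have "continuous_on S (\<lambda>\<zeta>. a + (\<chi> j. \<zeta> * b $ j))" by (intro continuous_intros)
    then show ?thesis by (simp add: vector_scalar_mult_def)
  qed
  have conth: "continuous_on (cball 0 1) h"
    unfolding h_def
    by (intro continuous_on_minus continuous_on_ln continuous_on_infdist caff) (metis less_irrefl mem_cball_0 pos)
  have inth: "(\<lambda>t. h (cis t)) integrable_on {0..2*pi}"
    by (intro integrable_continuous_real continuous_on_compose2[OF conth] continuous_intros) auto
  have "h 0 \<le> 1 / (2*pi) * integral {0..2*pi} (\<lambda>t. h (cis t)) + 2 * e" if "e > 0" for e
  proof -
    \<comment> \<open>Approximating h + e with error e places Re p strictly above h and at most 2e
      above it.\<close>
    have "continuous_on (sphere 0 1) (\<lambda>\<zeta>. h \<zeta> + e)"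
      by (intro continuous_intros continuous_on_subset[OF conth]) auto
    then obtain p where p: "\<And>\<zeta>. cmod \<zeta> = 1 \<Longrightarrow> \<bar>h \<zeta> + e - Re (poly p \<zeta>)\<bar> < e"
      using approx_on_circle_by_Re_poly[OF _ \<open>e > 0\<close>] by blast
    have hp: "h \<zeta> < Re (poly p \<zeta>)" "Re (poly p \<zeta>) \<le> h \<zeta> + 2 * e" if "cmod \<zeta> = 1" for \<zeta>
      using p[OF that] by linarith+
    have "ball a (exp (- Re (poly p 0))) \<subseteq> \<Omega>"
    proof
      fix y assume "y \<in> ball a (exp (- Re (poly p 0)))"
      then have y: "norm (y - a) < exp (- Re (poly p 0))" by (simp add: dist_norm norm_minus_commute)
      \<comment> \<open>Chosen so that the disc takes the value y at \<zeta> = 0; |y - a| < exp (-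
        Re p(0)) means |v| < 1.\<close>
      define v where "v = exp (poly p 0) *s (y - a)"
      have "norm v = exp (Re (poly p 0)) * norm (y - a)" by (simp only: v_def norm_vector_scalar_mult norm_exp_eq_Re)
      also have "\<dots> < exp (Re (poly p 0)) * exp (- Re (poly p 0))" using y by (intro mult_strict_left_mono) auto
      finally have v: "norm v < 1" by (simp flip: exp_add)
      have "a + exp (- poly p 0) *s v \<in> \<Omega>"
      proof (rule disc_propagation_continuity_principle[OF assms(1) pr disc])
        fix \<zeta> :: complex and t :: real assume \<zeta>: "cmod \<zeta> = 1" and t: "0 \<le> t" "t \<le> 1"
        have "norm ((of_real t * exp (- poly p \<zeta>)) *s v) = (t * norm v) * exp (- Re (poly p \<zeta>))"
          using t by (simp add: norm_vector_scalar_mult norm_mult)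
        also have "\<dots> \<le> 1 * exp (- Re (poly p \<zeta>))"
          using t v by (intro mult_right_mono mult_le_one) auto
        also have "\<dots> < exp (- h \<zeta>)" using hp(1)[OF \<zeta>] by simp
        also have "\<dots> = infdist (a + \<zeta> *s b) (- \<Omega>)" using pos[of \<zeta>] \<zeta> by (simp add: h_def)
        finally show "a + \<zeta> *s b + (of_real t * exp (- poly p \<zeta>)) *s v \<in> \<Omega>"
          by (intro mem_if_dist_less_infdist_Compl[of "a + \<zeta> *s b"]) (simp add: dist_norm)
      qed
      moreover have "exp (- poly p 0) *s v = y - a"
        by (simp add: v_def exp_minus)
      ultimately show "y \<in> \<Omega>" by simp
    qed
    then have "exp (- Re (poly p 0)) \<le> infdist a (- \<Omega>)" using assms(3) by (intro le_infdist_Compl)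
    then have "- Re (poly p 0) \<le> ln (infdist a (- \<Omega>))" using pos[of 0] by (simp add: ln_ge_iff)
    then have "h 0 \<le> Re (poly p 0)" by (simp add: h_def)
    moreover have "2 * pi * Re (poly p 0) \<le> integral {0..2*pi} (\<lambda>t. h (cis t)) + 2 * e * (2 * pi)"
    proof (rule has_integral_le[OF has_integral_poly_cis])
      have "((\<lambda>t. 2 * e) has_integral 2 * e * (2 * pi)) {0..2*pi}"
        using has_integral_const_real[of "2 * e" 0 "2 * pi"] by (simp add: mult.commute)
      then show "((\<lambda>t. h (cis t) + 2 * e) has_integral integral {0..2*pi} (\<lambda>t. h (cis t)) + 2 * e * (2 * pi)) {0..2*pi}"
        by (intro has_integral_add integrable_integral inth)
      show "Re (poly p (cis t)) \<le> h (cis t) + 2 * e" for t by (rule hp(2)) simp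
    qed
    then have "Re (poly p 0) \<le> 1 / (2*pi) * integral {0..2*pi} (\<lambda>t. h (cis t)) + 2 * e"
      using pi_gt_zero by (simp add: field_simps)
    ultimately show ?thesis by linarith
  qed
  note le = this
  show ?thesis
  proof (rule field_le_epsilon)
    fix e :: real assume "e > 0"
    then show "h 0 \<le> 1 / (2*pi) * integral {0..2*pi} (\<lambda>t. h (cis t)) + e" using le[of "e / 2"] by simp
  qed
qed

text \<open>The mean of a + exp(it) b is a; the norm is then taken inside the integral.\<close>

lemma norm_submean:
  fixes a b :: "complex ^ 'm::finite"
  shows "norm a \<le> 1 / (2*pi) * integral {0..2*pi} (\<lambda>t. norm (a + cis t *s b))"
proof -
  have bl: "bounded_linear (\<lambda>\<zeta>. \<zeta> *s b)"
    by (rule linear_conv_bounded_linear[THEN iffD1], rule linearI) (auto simp: vec_eq_iff algebra_simps)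
  have "((\<lambda>t. a) has_integral (2 * pi) *\<^sub>R a) {0..2*pi}"
    using has_integral_const_real[of a 0 "2 * pi"] by simp
  moreover have "((\<lambda>t. cis t *s b) has_integral 0) {0..2*pi}"
    using has_integral_linear[OF has_integral_cis bl] by (simp add: o_def)
  ultimately have F: "((\<lambda>t. a + cis t *s b) has_integral (2 * pi) *\<^sub>R a + 0) {0..2*pi}"
    by (rule has_integral_add)
  have "continuous_on {0..2*pi} (\<lambda>t. cis t *s b)"
    by (intro bounded_linear.continuous_on[OF bl] continuous_intros)
  then have "(\<lambda>t. norm (a + cis t *s b)) integrable_on {0..2*pi}"
    by (intro integrable_continuous_real continuous_on_norm continuous_on_add continuous_on_const)
  then have "norm (integral {0..2*pi} (\<lambda>t. a + cis t *s b)) \<le> integral {0..2*pi} (\<lambda>t. norm (a + cis t *s b))"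
    using F by (intro integral_norm_bound_integral) auto
  then show ?thesis using integral_unique[OF F] by (simp add: field_simps)
qed

lemma continuous_on_imp_usc_on: "continuous_on S u \<Longrightarrow> usc_on S u"
  unfolding usc_on_def
proof
  fix c assume "continuous_on S u"
  then have "openin (top_of_set S) (S \<inter> u -` {..<c})" by (rule continuous_openin_preimage_gen) simp
  moreover have "S \<inter> u -` {..<c} = {z \<in> S. u z < c}" by auto
  ultimately show "openin (top_of_set S) {z \<in> S. u z < c}" by simp
qed

lemma disc_propagation_imp_pseudoconvex:
  fixes \<Omega> :: "(complex ^ 'm::finite) set"
  assumes "open \<Omega>" and pr: "disc_propagation \<Omega>"
  shows "pseudoconvex \<Omega>"
proof -
  define v where "v z = - ln (infdist z (- \<Omega>))" for z
  define u where "u z = max (norm z) (v z)" for z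
  have pos: "infdist z (- \<Omega>) > 0" if "z \<in> \<Omega>" "\<Omega> \<noteq> UNIV" for z
    using that assms(1) by (intro infdist_pos_not_in_closed) auto
  have contv: "continuous_on \<Omega> v"
  proof (cases "\<Omega> = UNIV")
    case True
    \<comment> \<open>The distance to the empty set is 0 and ln 0 = 0, so \<open>v\<close> vanishes
      and \<open>u\<close> is the norm.\<close>
    then have "v = (\<lambda>_. 0)" by (auto simp: v_def infdist_def)
    then show ?thesis by simp
  next
    case False
    then show ?thesis unfolding v_def
      by (intro continuous_on_minus continuous_on_ln continuous_on_infdist continuous_on_id) (metis less_irrefl pos)
  qed
  have contu: "continuous_on \<Omega> u" unfolding u_def by (intro continuous_intros contv)
  have vsub: "v a \<le> 1 / (2*pi) * integral {0..2*pi} (\<lambda>t. v (a + cis t *s b))"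
    if "\<And>\<zeta>. cmod \<zeta> \<le> 1 \<Longrightarrow> a + \<zeta> *s b \<in> \<Omega>" for a b
  proof (cases "\<Omega> = UNIV")
    case True
    then have "v = (\<lambda>_. 0)" by (auto simp: v_def infdist_def)
    then show ?thesis by simp
  next
    case False
    from neg_ln_infdist_submean[OF assms this that] show ?thesis by (simp add: v_def)
  qed
  have usub: "(\<lambda>t. u (a + cis t *s b)) integrable_on {0..2*pi} \<and>
      u a \<le> 1 / (2*pi) * integral {0..2*pi} (\<lambda>t. u (a + cis t *s b))"
    if disc: "\<And>\<zeta>. cmod \<zeta> \<le> 1 \<Longrightarrow> a + \<zeta> *s b \<in> \<Omega>" for a b
  proof -
    have "continuous_on {0..2*pi} (\<lambda>t. a + (\<chi> j. cis t * b $ j))" by (intro continuous_intros)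
    then have c: "continuous_on {0..2*pi} (\<lambda>t. a + cis t *s b)" by (simp add: vector_scalar_mult_def)
    have iu: "(\<lambda>t. u (a + cis t *s b)) integrable_on {0..2*pi}"
      by (intro integrable_continuous_real continuous_on_compose2[OF contu c]) (auto intro: disc)
    have iv: "(\<lambda>t. v (a + cis t *s b)) integrable_on {0..2*pi}"
      by (intro integrable_continuous_real continuous_on_compose2[OF contv c]) (auto intro: disc)
    have "integral {0..2*pi} (\<lambda>t. norm (a + cis t *s b)) \<le> integral {0..2*pi} (\<lambda>t. u (a + cis t *s b))"
      by (intro integral_le iu integrable_continuous_real continuous_on_norm c) (simp add: u_def)
    then have "1 / (2*pi) * integral {0..2*pi} (\<lambda>t. norm (a + cis t *s b)) \<le> 1 / (2*pi) * integral {0..2*pi} (\<lambda>t. u (a + cis t *s b))"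
      by (intro mult_left_mono) auto
    moreover have "integral {0..2*pi} (\<lambda>t. v (a + cis t *s b)) \<le> integral {0..2*pi} (\<lambda>t. u (a + cis t *s b))"
      by (intro integral_le iu iv) (simp add: u_def)
    then have "1 / (2*pi) * integral {0..2*pi} (\<lambda>t. v (a + cis t *s b)) \<le> 1 / (2*pi) * integral {0..2*pi} (\<lambda>t. u (a + cis t *s b))"
      by (intro mult_left_mono) auto
    ultimately have "u a \<le> 1 / (2*pi) * integral {0..2*pi} (\<lambda>t. u (a + cis t *s b))"
      unfolding u_def[of a] using norm_submean[of a b] vsub[OF disc] by linarith
    then show ?thesis using iu by blast
  qed
  have "plurisubharmonic_on \<Omega> u"
    unfolding plurisubharmonic_on_def subharmonic_on_def
  proof (intro conjI allI impI)
    show "usc_on \<Omega> u" by (rule continuous_on_imp_usc_on[OF contu])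
    fix a b :: "complex^'m"
    have "continuous_on {l. a + l *s b \<in> \<Omega>} (\<lambda>l. a + (\<chi> j. l * b $ j))" by (intro continuous_intros)
    then have "continuous_on {l. a + l *s b \<in> \<Omega>} (\<lambda>l. a + l *s b)" by (simp add: vector_scalar_mult_def)
    then show "usc_on {l. a + l *s b \<in> \<Omega>} (\<lambda>l. u (a + l *s b))"
      by (intro continuous_on_imp_usc_on continuous_on_compose2[OF contu]) auto
    fix c :: complex and r :: real assume r: "0 < r" and sub: "cball c r \<subseteq> {l. a + l *s b \<in> \<Omega>}"
    \<comment> \<open>Moving c into \<open>a\<close> and r into \<open>b\<close> turns the given
      circle into the unit circle.\<close>
    have eq: "a + (c + of_real r * \<zeta>) *s b = (a + c *s b) + \<zeta> *s (of_real r *s b)" for \<zeta>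
      by (simp add: vec_eq_iff algebra_simps)
    have "(a + c *s b) + \<zeta> *s (of_real r *s b) \<in> \<Omega>" if "cmod \<zeta> \<le> 1" for \<zeta>
    proof -
      have "c + of_real r * \<zeta> \<in> cball c r" using that r by (simp add: dist_norm norm_mult)
      then show ?thesis using sub unfolding eq[symmetric] by blast
    qed
    from usub[OF this]
    show "(\<lambda>t. u (a + (c + of_real r * cis t) *s b)) integrable_on {0..2*pi}"
      "u (a + c *s b) \<le> 1 / (2*pi) * integral {0..2*pi} (\<lambda>t. u (a + (c + of_real r * cis t) *s b))"
      unfolding eq by blast+
  qed
  moreover have "compact (closure {z \<in> \<Omega>. u z < c}) \<and> closure {z \<in> \<Omega>. u z < c} \<subseteq> \<Omega>" for c
  proof
    have "bounded {z \<in> \<Omega>. u z < c}" unfolding bounded_iff u_def by (intro exI[of _ c]) auto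
    then show "compact (closure {z \<in> \<Omega>. u z < c})" by (simp add: compact_closure)
    show "closure {z \<in> \<Omega>. u z < c} \<subseteq> \<Omega>"
    proof (cases "\<Omega> = UNIV")
      case False
      \<comment> \<open>The sublevel set is trapped in a subset of \<Omega> that is closed in the
        whole space.\<close>
      have "{z \<in> \<Omega>. u z < c} \<subseteq> {z. exp (- c) \<le> infdist z (- \<Omega>)}"
      proof
        fix z assume "z \<in> {z \<in> \<Omega>. u z < c}"
        then have z: "z \<in> \<Omega>" "- c < ln (infdist z (- \<Omega>))" by (auto simp: u_def v_def)
        then have "exp (- c) < exp (ln (infdist z (- \<Omega>)))" by simp
        then show "z \<in> {z. exp (- c) \<le> infdist z (- \<Omega>)}" using pos[OF z(1) False] by simp
      qed
      moreover have "closed {z. exp (- c) \<le> infdist z (- \<Omega>)}"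
        by (intro closed_Collect_le continuous_intros)
      ultimately have "closure {z \<in> \<Omega>. u z < c} \<subseteq> {z. exp (- c) \<le> infdist z (- \<Omega>)}"
        by (rule closure_minimal)
      also have "\<dots> \<subseteq> \<Omega>"
      proof
        fix z assume "z \<in> {z. exp (- c) \<le> infdist z (- \<Omega>)}"
        then have "0 < infdist z (- \<Omega>)" by (auto intro: less_le_trans[OF exp_gt_zero])
        then show "z \<in> \<Omega>" by (intro mem_if_dist_less_infdist_Compl[of z z]) simp
      qed
      finally show ?thesis .
    qed simp
  qed
  ultimately show ?thesis unfolding pseudoconvex_def using assms(1) contu by blast
qed

theorem corollary1p6:
  fixes \<Omega> :: "(complex ^ 'm::finite) set"
  assumes "wHHR_domain \<Omega>"
  shows "taut \<Omega> \<and> pseudoconvex \<Omega>"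
proof -
  have "open \<Omega>" using assms by (simp add: wHHR_domain_def is_domain_def)
  then show ?thesis
    using wHHR_disc_propagation[OF assms] disc_propagation_imp_taut disc_propagation_imp_pseudoconvex
    by blast
qed

end
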